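(* Let $\mathfrak{A}\subset\mathcal{B}(\mathcal{H})$ be a concrete C*-algebra with unit and $\Phi:\mathfrak{A}\to\mathfrak{A}$ a unital completely positive map. Let $(\mathcal{H}_\infty,\pi_\infty,\mathbf{V}_\infty)$ be the Stinespring-type representation of $\Phi$ described in the context (so $\pi_\infty$ is a faithful representation of $\mathfrak{A}$, $\mathbf{V}_\infty$ is an isometry on $\mathcal{H}_\infty$, and $\mathbf{V}_\infty^*\pi_\infty(a)\mathbf{V}_\infty=\pi_\infty(\Phi(a))$ for all $a\in\mathfrak{A}$), and let $(\widehat{\mathbf{V}},\widehat{\mathcal{H}},\mathbf{Z})$ be the minimal unitary dilation of $\mathbf{V}_\infty$. Then there exists a C*-algebra with unit $\widehat{\mathfrak{A}}\subset\mathcal{B}(\widehat{\mathcal{H}})$ such that: 1. $\mathbf{Z}\pi_\infty(\mathfrak{A})\mathbf{Z}^*\subset\widehat{\mathfrak{A}}$; 2. $\mathbf{Z}^*\widehat{\mathfrak{A}}\mathbf{Z}=\pi_\infty(\mathfrak{A})$; 3. $\mathbf{Z}^*\widehat{\mathbf{V}}^*X\widehat{\mathbf{V}}\mathbf{Z}=\mathbf{V}_\infty^*\mathbf{Z}^*X\mathbf{Z}\mathbf{V}_\infty$ for all $X\in\widehat{\mathfrak{A}}$. Furthermore, $\widehat{\Phi}(X)=\widehat{\mathbf{V}}^*X\widehat{\mathbf{V}}$ defines a *-homomorphism $\widehat{\Phi}:\widehat{\mathfrak{A}}\to\widehat{\mathfrak{A}}$ such that, for all $a\in\mathfrak{A}$,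 $X\in\widehat{\mathfrak{A}}$ and $n\in\mathbb{N}$, $$\pi_\infty(\Phi^n(a))=\mathbf{Z}^*\widehat{\Phi}^n(\mathbf{Z}\pi_\infty(a)\mathbf{Z}^* )\mathbf{Z}\qquad\text{and}\qquad \mathbf{Z}^*\widehat{\Phi}^n(X)\mathbf{Z}=\pi_\infty\big(\Phi^n(\pi_\infty^{-1}(\mathbf{Z}^*X\mathbf{Z}))\big).$$
   Context: The algebra $\mathfrak{A}$ contains the identity operator of $\mathcal{H}$. Stinespring dilation: for a unital completely positive map $\Psi:\mathfrak{A}\to\mathcal{B}(\mathcal{K})$, let $\mathfrak{A}\overline{\otimes}_\Psi\mathcal{K}$ be the Hilbert space obtained from $\mathfrak{A}\otimes\mathcal{K}$ with semi-inner product $\langle a_1\otimes\xi_1,a_2\otimes\xi_2\rangle_\Psi=\langle\xi_1,\Psi(a_1^*a_2)\xi_2\rangle$ by quotienting by null vectors and completing. The Stinespring dilation of $\Psi$ is $(\mathbf{V}_\Psi,\sigma_\Psi,\mathfrak{A}\overline{\otimes}_\Psi\mathcal{K})$ with $\sigma_\Psi(a)(x\overline{\otimes}_\Psi\xi)=ax\overline{\otimes}_\Psi\xi$ and $\mathbf{V}_\Psi\xi=\mathbf{1}\overline{\otimes}_\Psi\xi$. Stinespring-type representation: put $\mathcal{H}_0=\mathcal{H}$, $\sigma_0=\mathrm{id}$, and recursively $\Phi_n=\sigma_n\circ\Phi$ and $(\mathbf{V}_n,\sigma_{n+1},\mathcal{H}_{n+1})$ the Stinespring dilation of $\Phi_n:\mathfrak{A}\to\mathcal{B}(\mathcal{H}_n)$.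 Then $\mathcal{H}_\infty=\bigoplus_{n\ge0}\mathcal{H}_n$, $\pi_\infty(a)=\bigoplus_{n\ge0}\sigma_n(a)$ and $\mathbf{V}_\infty(\Psi_0,\Psi_1,\dots)=(0,\mathbf{V}_0\Psi_0,\mathbf{V}_1\Psi_1,\dots)$. Minimal unitary dilation: for a linear isometry $\mathbf{V}$ on a Hilbert space $\mathcal{K}$ it is a triple $(\widehat{\mathbf{V}},\widehat{\mathcal{H}},\mathbf{Z})$ where $\mathbf{Z}:\mathcal{K}\to\widehat{\mathcal{H}}$ is a linear isometry and $\widehat{\mathbf{V}}$ a unitary on $\widehat{\mathcal{H}}$ with $\widehat{\mathbf{V}}^n\mathbf{Z}=\mathbf{Z}\mathbf{V}^n$ for all $n\in\mathbb{N}$ and $\widehat{\mathcal{H}}=\bigvee_{k\in\mathbb{Z}}\widehat{\mathbf{V}}^k\mathbf{Z}\mathcal{K}$. *)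

theory Defs
  imports "HOL-Analysis.Analysis"
begin

section \<open>Hilbert spaces with explicit carrier\<close>

text \<open>The Hilbert spaces of the Stinespring tower are produced by recursion on \<open>n\<close>, so they cannot
  be types of a type class.  They are records with a carrier set; nothing is required of the
  operations outside the carrier.\<close>

record 'v hspace =
  pts :: "'v set"
  add :: "'v \<Rightarrow> 'v \<Rightarrow> 'v"
  zero :: "'v"
  scl :: "complex \<Rightarrow> 'v \<Rightarrow> 'v"
  ip :: "'v \<Rightarrow> 'v \<Rightarrow> complex"

definition hnorm :: "'v hspace \<Rightarrow> 'v \<Rightarrow> real" where
  "hnorm H x = sqrt (Re (ip H x x))"

definition diff :: "'v hspace \<Rightarrow> 'v \<Rightarrow> 'v \<Rightarrow> 'v" where
  "diff H x y = add H x (scl H (-1) y)"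

text \<open>The library locale \<open>Metric_space\<close> asks for symmetry and nonnegativity of the distance also
  outside the carrier, whence the case distinction.\<close>

definition hdist :: "'v hspace \<Rightarrow> 'v \<Rightarrow> 'v \<Rightarrow> real" where
  "hdist H x y = (if x \<in> pts H \<and> y \<in> pts H then hnorm H (diff H x y) else 0)"

text \<open>Inner products are linear in the second argument.\<close>

locale inner_product_space =
  fixes H :: "'v hspace"
  assumes zero_closed: "zero H \<in> pts H"
    and add_closed: "\<lbrakk>x \<in> pts H; y \<in> pts H\<rbrakk> \<Longrightarrow> add H x y \<in> pts H"
    and scl_closed: "x \<in> pts H \<Longrightarrow> scl H c x \<in> pts H"
    and add_assoc: "\<lbrakk>x \<in> pts H; y \<in> pts H; z \<in> pts H\<rbrakk>
          \<Longrightarrow> add H (add H x y) z = add H x (add H y z)"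
    and add_commute: "\<lbrakk>x \<in> pts H; y \<in> pts H\<rbrakk> \<Longrightarrow> add H x y = add H y x"
    and add_zero: "x \<in> pts H \<Longrightarrow> add H x (zero H) = x"
    and add_uminus: "x \<in> pts H \<Longrightarrow> add H x (scl H (-1) x) = zero H"
    and scl_one: "x \<in> pts H \<Longrightarrow> scl H 1 x = x"
    and scl_scl: "x \<in> pts H \<Longrightarrow> scl H c (scl H d x) = scl H (c * d) x"
    and scl_add_right: "\<lbrakk>x \<in> pts H; y \<in> pts H\<rbrakk>
          \<Longrightarrow> scl H c (add H x y) = add H (scl H c x) (scl H c y)"
    and scl_add_left: "x \<in> pts H \<Longrightarrow> scl H (c + d) x = add H (scl H c x) (scl H d x)"
    and ip_commute: "\<lbrakk>x \<in> pts H; y \<in> pts H\<rbrakk> \<Longrightarrow> ip H y x = cnj (ip H x y)"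
    and ip_add_right: "\<lbrakk>x \<in> pts H; y \<in> pts H; z \<in> pts H\<rbrakk>
          \<Longrightarrow> ip H x (add H y z) = ip H x y + ip H x z"
    and ip_scl_right: "\<lbrakk>x \<in> pts H; y \<in> pts H\<rbrakk> \<Longrightarrow> ip H x (scl H c y) = c * ip H x y"
    and ip_nonneg: "x \<in> pts H \<Longrightarrow> 0 \<le> Re (ip H x x)"
    and ip_definite: "\<lbrakk>x \<in> pts H; ip H x x = 0\<rbrakk> \<Longrightarrow> x = zero H"

locale hilbert_space = inner_product_space H for H :: "'v hspace" +
  assumes complete: "Metric_space.mcomplete (pts H) (hdist H)"

definition subspace_of :: "'v hspace \<Rightarrow> 'v set \<Rightarrow> bool" where
  "subspace_of H M \<longleftrightarrow> M \<subseteq> pts H \<and> zero H \<in> M \<and> (\<forall>x\<in>M. \<forall>y\<in>M. add H x y \<in> M)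
     \<and> (\<forall>c. \<forall>x\<in>M. scl H c x \<in> M)"

definition closed_span :: "'v hspace \<Rightarrow> 'v set \<Rightarrow> 'v set" where
  "closed_span H S = Metric_space.mtopology (pts H) (hdist H) closure_of (subspace_of H hull S)"


section \<open>Bounded operators and concrete C*-algebras\<close>

text \<open>Operators are extensional functions on the carrier, so that HOL equality is equality of
  operators.  In \<open>S \<circ>\<^bsub>H\<^esub> T\<close> the subscript is the space on which \<open>T\<close> is defined.\<close>

type_synonym 'v op = "'v \<Rightarrow> 'v"

definition op_comp :: "('v \<Rightarrow> 'w) \<Rightarrow> 'u hspace \<Rightarrow> ('u \<Rightarrow> 'v) \<Rightarrow> 'u \<Rightarrow> 'w"
    ("(_/ \<circ>\<^bsub>_\<^esub> _)" [56, 0, 55] 55) where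
  "S \<circ>\<^bsub>H\<^esub> T = compose (pts H) S T"

definition op_id :: "'v hspace \<Rightarrow> 'v op" where
  "op_id H = restrict (\<lambda>x. x) (pts H)"

definition op_add :: "'v hspace \<Rightarrow> 'w hspace \<Rightarrow> ('v \<Rightarrow> 'w) \<Rightarrow> ('v \<Rightarrow> 'w) \<Rightarrow> 'v \<Rightarrow> 'w" where
  "op_add H K S T = restrict (\<lambda>x. add K (S x) (T x)) (pts H)"

definition op_scl :: "'v hspace \<Rightarrow> 'w hspace \<Rightarrow> complex \<Rightarrow> ('v \<Rightarrow> 'w) \<Rightarrow> 'v \<Rightarrow> 'w" where
  "op_scl H K c T = restrict (\<lambda>x. scl K c (T x)) (pts H)"

definition bounded_ops :: "'v hspace \<Rightarrow> 'w hspace \<Rightarrow> ('v \<Rightarrow> 'w) set" where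
  "bounded_ops H K = {T \<in> pts H \<rightarrow>\<^sub>E pts K.
     (\<forall>x\<in>pts H. \<forall>y\<in>pts H. T (add H x y) = add K (T x) (T y)) \<and>
     (\<forall>c. \<forall>x\<in>pts H. T (scl H c x) = scl K c (T x)) \<and>
     (\<exists>B. \<forall>x\<in>pts H. hnorm K (T x) \<le> B * hnorm H x)}"

definition adj :: "'v hspace \<Rightarrow> 'w hspace \<Rightarrow> ('v \<Rightarrow> 'w) \<Rightarrow> 'w \<Rightarrow> 'v" where
  "adj H K T = (THE S. S \<in> bounded_ops K H \<and>
     (\<forall>x\<in>pts H. \<forall>y\<in>pts K. ip H x (S y) = ip K (T x) y))"

definition opnorm :: "'v hspace \<Rightarrow> 'w hspace \<Rightarrow> ('v \<Rightarrow> 'w) \<Rightarrow> real" where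
  "opnorm H K T = (SUP x \<in> {x \<in> pts H. hnorm H x \<le> 1}. hnorm K (T x))"

definition opdist :: "'v hspace \<Rightarrow> 'v op \<Rightarrow> 'v op \<Rightarrow> real" where
  "opdist H S T = (if S \<in> bounded_ops H H \<and> T \<in> bounded_ops H H
     then opnorm H H (op_add H H S (op_scl H H (-1) T)) else 0)"

definition unital_cstar_algebra :: "'v hspace \<Rightarrow> 'v op set \<Rightarrow> bool" where
  "unital_cstar_algebra H A \<longleftrightarrow> A \<subseteq> bounded_ops H H \<and> op_id H \<in> A
     \<and> (\<forall>a\<in>A. \<forall>b\<in>A. op_add H H a b \<in> A)
     \<and> (\<forall>c. \<forall>a\<in>A. op_scl H H c a \<in> A)
     \<and> (\<forall>a\<in>A. \<forall>b\<in>A. (a \<circ>\<^bsub>H\<^esub> b) \<in> A)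
     \<and> (\<forall>a\<in>A. adj H H a \<in> A)
     \<and> closedin (Metric_space.mtopology (bounded_ops H H) (opdist H)) A"

definition star_hom ::
  "'v hspace \<Rightarrow> 'v op set \<Rightarrow> 'w hspace \<Rightarrow> 'w op set \<Rightarrow> ('v op \<Rightarrow> 'w op) \<Rightarrow> bool" where
  "star_hom H A K B \<rho> \<longleftrightarrow> \<rho> \<in> A \<rightarrow> B
     \<and> (\<forall>a\<in>A. \<forall>b\<in>A. \<rho> (op_add H H a b) = op_add K K (\<rho> a) (\<rho> b))
     \<and> (\<forall>c. \<forall>a\<in>A. \<rho> (op_scl H H c a) = op_scl K K c (\<rho> a))
     \<and> (\<forall>a\<in>A. \<forall>b\<in>A. \<rho> (a \<circ>\<^bsub>H\<^esub> b) = (\<rho> a \<circ>\<^bsub>K\<^esub> \<rho> b))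
     \<and> (\<forall>a\<in>A. \<rho> (adj H H a) = adj K K (\<rho> a))"

definition faithful_representation ::
  "'v hspace \<Rightarrow> 'v op set \<Rightarrow> 'w hspace \<Rightarrow> ('v op \<Rightarrow> 'w op) \<Rightarrow> bool" where
  "faithful_representation H A K \<rho> \<longleftrightarrow> star_hom H A K (bounded_ops K K) \<rho>
     \<and> \<rho> (op_id H) = op_id K \<and> inj_on \<rho> A"

definition isometry :: "'v hspace \<Rightarrow> 'w hspace \<Rightarrow> ('v \<Rightarrow> 'w) \<Rightarrow> bool" where
  "isometry H K V \<longleftrightarrow> V \<in> bounded_ops H K \<and> (\<forall>x\<in>pts H. hnorm K (V x) = hnorm H x)"

definition unitary :: "'v hspace \<Rightarrow> 'v op \<Rightarrow> bool" where
  "unitary H U \<longleftrightarrow> U \<in> bounded_ops H H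
     \<and> (adj H H U \<circ>\<^bsub>H\<^esub> U) = op_id H \<and> (U \<circ>\<^bsub>H\<^esub> adj H H U) = op_id H"

primrec op_power :: "'v hspace \<Rightarrow> 'v op \<Rightarrow> nat \<Rightarrow> 'v op" where
  "op_power H T 0 = op_id H"
| "op_power H T (Suc n) = (T \<circ>\<^bsub>H\<^esub> op_power H T n)"

definition unitary_zpower :: "'v hspace \<Rightarrow> 'v op \<Rightarrow> int \<Rightarrow> 'v op" where
  "unitary_zpower H U k =
     (if 0 \<le> k then op_power H U (nat k) else op_power H (adj H H U) (nat (- k)))"

text \<open>An \<open>n \<times> n\<close> matrix over \<open>\<B>(H)\<close> is given by its entries with indices below \<open>n\<close>; positivity is
  positivity of the operator it defines on the \<open>n\<close>-fold direct sum of \<open>H\<close>.\<close>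

definition positive_matrix :: "'v hspace \<Rightarrow> nat \<Rightarrow> (nat \<Rightarrow> nat \<Rightarrow> 'v op) \<Rightarrow> bool" where
  "positive_matrix H n a \<longleftrightarrow> (\<forall>\<xi>. (\<forall>i<n. \<xi> i \<in> pts H) \<longrightarrow>
     (\<Sum>i<n. \<Sum>j<n. ip H (\<xi> i) (a i j (\<xi> j))) \<in> \<real>\<^sub>\<ge>\<^sub>0)"

definition completely_positive ::
  "'v hspace \<Rightarrow> 'v op set \<Rightarrow> 'w hspace \<Rightarrow> ('v op \<Rightarrow> 'w op) \<Rightarrow> bool" where
  "completely_positive H A K \<Psi> \<longleftrightarrow> \<Psi> \<in> A \<rightarrow> bounded_ops K K
     \<and> (\<forall>a\<in>A. \<forall>b\<in>A. \<Psi> (op_add H H a b) = op_add K K (\<Psi> a) (\<Psi> b))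
     \<and> (\<forall>c. \<forall>a\<in>A. \<Psi> (op_scl H H c a) = op_scl K K c (\<Psi> a))
     \<and> (\<forall>n a. (\<forall>i<n. \<forall>j<n. a i j \<in> A) \<longrightarrow> positive_matrix H n a
          \<longrightarrow> positive_matrix K n (\<lambda>i j. \<Psi> (a i j)))"

definition unital :: "'v hspace \<Rightarrow> 'w hspace \<Rightarrow> ('v op \<Rightarrow> 'w op) \<Rightarrow> bool" where
  "unital H K \<Psi> \<longleftrightarrow> \<Psi> (op_id H) = op_id K"


section \<open>Completion of a semi-inner product space\<close>

text \<open>The completion of \<open>S\<close> modulo its null vectors consists of the Cauchy sequences of \<open>S\<close> modulo
  sequences tending to zero in seminorm.  An equivalence class is represented by one of its members,
  chosen once and for all, rather than by the set of its members: this makes the result of type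
  \<open>nat \<Rightarrow> 's\<close>, through which a datatype may recurse.  Only the values of the operations of \<open>S\<close> on its
  carrier matter, and the vector space laws need hold in \<open>S\<close> only modulo null vectors.\<close>

definition cauchy_seqs :: "'s hspace \<Rightarrow> (nat \<Rightarrow> 's) set" where
  "cauchy_seqs S = {s. (\<forall>n. s n \<in> pts S) \<and>
     (\<forall>e>0. \<exists>N. \<forall>m\<ge>N. \<forall>n\<ge>N. hnorm S (diff S (s m) (s n)) < e)}"

definition cauchy_rep :: "'s hspace \<Rightarrow> (nat \<Rightarrow> 's) \<Rightarrow> nat \<Rightarrow> 's" where
  "cauchy_rep S s =
     (SOME t. t \<in> cauchy_seqs S \<and> (\<lambda>n. hnorm S (diff S (s n) (t n))) \<longlonglongrightarrow> 0)"

definition completion :: "'s hspace \<Rightarrow> (nat \<Rightarrow> 's) hspace" where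
  "completion S = \<lparr>
     pts = cauchy_rep S ` cauchy_seqs S,
     add = (\<lambda>s t. cauchy_rep S (\<lambda>n. add S (s n) (t n))),
     zero = cauchy_rep S (\<lambda>_. zero S),
     scl = (\<lambda>c s. cauchy_rep S (\<lambda>n. scl S c (s n))),
     ip = (\<lambda>s t. lim (\<lambda>n. ip S (s n) (t n))) \<rparr>"

definition completion_emb :: "'s hspace \<Rightarrow> 's \<Rightarrow> nat \<Rightarrow> 's" where
  "completion_emb S x = cauchy_rep S (\<lambda>_. x)"

text \<open>Relabelling of the elements of a space along an injection.\<close>

definition transport :: "('v \<Rightarrow> 'w) \<Rightarrow> 'v hspace \<Rightarrow> 'w hspace" where
  "transport f H = \<lparr>
     pts = f ` pts H,
     add = (\<lambda>x y. f (add H (inv f x) (inv f y))),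
     zero = f (zero H),
     scl = (\<lambda>c x. f (scl H c (inv f x))),
     ip = (\<lambda>x y. ip H (inv f x) (inv f y)) \<rparr>"

definition transport_op :: "('v \<Rightarrow> 'w) \<Rightarrow> 'v hspace \<Rightarrow> 'v op \<Rightarrow> 'w op" where
  "transport_op f H T = restrict (\<lambda>x. f (T (inv f x))) (f ` pts H)"


section \<open>The Stinespring dilation\<close>

text \<open>One type holding all spaces of the tower: \<open>Base\<close> labels the vectors of \<open>H\<close>, and \<open>Compl\<close> labels
  representing Cauchy sequences in \<open>\<AA> \<otimes> K\<close> for \<open>K\<close> at the preceding level.\<close>

datatype ('a, 'h) tower = Base 'h | Compl "nat \<Rightarrow> ('a \<times> ('a, 'h) tower) list"

text \<open>The space \<open>\<AA> \<otimes> K\<close> with its semi-inner product.  A list of pairs stands for the sum of the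
  elementary tensors of its entries.  Lists denoting the same tensor differ by a null vector, so the
  quotient by null vectors is not affected by working with lists.\<close>

definition tensor_space ::
  "'h hspace \<Rightarrow> 'h op set \<Rightarrow> 'w hspace \<Rightarrow> ('h op \<Rightarrow> 'w op) \<Rightarrow> ('h op \<times> 'w) list hspace" where
  "tensor_space H A K \<Psi> = \<lparr>
     pts = lists (A \<times> pts K),
     add = (@),
     zero = [],
     scl = (\<lambda>c. map (\<lambda>(a, \<xi>). (a, scl K c \<xi>))),
     ip = (\<lambda>u v. \<Sum>(a, \<xi>)\<leftarrow>u. \<Sum>(b, \<eta>)\<leftarrow>v. ip K \<xi> (\<Psi> (adj H H a \<circ>\<^bsub>H\<^esub> b) \<eta>)) \<rparr>"

definition stinespring_space ::
  "'h hspace \<Rightarrow> 'h op set \<Rightarrow> ('h op, 'h) tower hspace \<Rightarrow> ('h op \<Rightarrow> ('h op, 'h) tower op)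
     \<Rightarrow> ('h op, 'h) tower hspace" where
  "stinespring_space H A K \<Psi> = transport Compl (completion (tensor_space H A K \<Psi>))"

definition stinespring_tensor ::
  "'h hspace \<Rightarrow> 'h op set \<Rightarrow> ('h op, 'h) tower hspace \<Rightarrow> ('h op \<Rightarrow> ('h op, 'h) tower op)
     \<Rightarrow> 'h op \<Rightarrow> ('h op, 'h) tower \<Rightarrow> ('h op, 'h) tower" where
  "stinespring_tensor H A K \<Psi> a \<xi> = Compl (completion_emb (tensor_space H A K \<Psi>) [(a, \<xi>)])"

definition stinespring_rep ::
  "'h hspace \<Rightarrow> 'h op set \<Rightarrow> ('h op, 'h) tower hspace \<Rightarrow> ('h op \<Rightarrow> ('h op, 'h) tower op)
     \<Rightarrow> 'h op \<Rightarrow> ('h op, 'h) tower op" where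
  "stinespring_rep H A K \<Psi> a =
     (THE T. T \<in> bounded_ops (stinespring_space H A K \<Psi>) (stinespring_space H A K \<Psi>) \<and>
        (\<forall>x\<in>A. \<forall>\<xi>\<in>pts K. T (stinespring_tensor H A K \<Psi> x \<xi>)
            = stinespring_tensor H A K \<Psi> (a \<circ>\<^bsub>H\<^esub> x) \<xi>))"

definition stinespring_isometry ::
  "'h hspace \<Rightarrow> 'h op set \<Rightarrow> ('h op, 'h) tower hspace \<Rightarrow> ('h op \<Rightarrow> ('h op, 'h) tower op)
     \<Rightarrow> ('h op, 'h) tower op" where
  "stinespring_isometry H A K \<Psi> =
     restrict (\<lambda>\<xi>. stinespring_tensor H A K \<Psi> (op_id H) \<xi>) (pts K)"


section \<open>The Stinespring-type representation\<close>

text \<open>The pair \<open>(\<H>\<^sub>n, \<sigma>\<^sub>n)\<close>; at level \<open>0\<close> it is \<open>(\<H>, id)\<close> up to the label \<open>Base\<close>.\<close>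

primrec tower_level ::
  "'h hspace \<Rightarrow> 'h op set \<Rightarrow> ('h op \<Rightarrow> 'h op) \<Rightarrow> nat
     \<Rightarrow> ('h op, 'h) tower hspace \<times> ('h op \<Rightarrow> ('h op, 'h) tower op)" where
  "tower_level H A \<Phi> 0 = (transport Base H, transport_op Base H)"
| "tower_level H A \<Phi> (Suc n) =
     (let K = fst (tower_level H A \<Phi> n); \<Psi> = snd (tower_level H A \<Phi> n) \<circ> \<Phi>
      in (stinespring_space H A K \<Psi>, stinespring_rep H A K \<Psi>))"

definition tower_space ::
  "'h hspace \<Rightarrow> 'h op set \<Rightarrow> ('h op \<Rightarrow> 'h op) \<Rightarrow> nat \<Rightarrow> ('h op, 'h) tower hspace" where
  "tower_space H A \<Phi> n = fst (tower_level H A \<Phi> n)"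

definition tower_rep ::
  "'h hspace \<Rightarrow> 'h op set \<Rightarrow> ('h op \<Rightarrow> 'h op) \<Rightarrow> nat \<Rightarrow> 'h op \<Rightarrow> ('h op, 'h) tower op" where
  "tower_rep H A \<Phi> n = snd (tower_level H A \<Phi> n)"

definition tower_isometry ::
  "'h hspace \<Rightarrow> 'h op set \<Rightarrow> ('h op \<Rightarrow> 'h op) \<Rightarrow> nat \<Rightarrow> ('h op, 'h) tower op" where
  "tower_isometry H A \<Phi> n =
     stinespring_isometry H A (tower_space H A \<Phi> n) (tower_rep H A \<Phi> n \<circ> \<Phi>)"

definition direct_sum :: "(nat \<Rightarrow> 'v hspace) \<Rightarrow> (nat \<Rightarrow> 'v) hspace" where
  "direct_sum H = \<lparr>
     pts = {f. (\<forall>n. f n \<in> pts (H n)) \<and> summable (\<lambda>n. (hnorm (H n) (f n))\<^sup>2)},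
     add = (\<lambda>f g n. add (H n) (f n) (g n)),
     zero = (\<lambda>n. zero (H n)),
     scl = (\<lambda>c f n. scl (H n) c (f n)),
     ip = (\<lambda>f g. \<Sum>n. ip (H n) (f n) (g n)) \<rparr>"

definition space_inf ::
  "'h hspace \<Rightarrow> 'h op set \<Rightarrow> ('h op \<Rightarrow> 'h op) \<Rightarrow> (nat \<Rightarrow> ('h op, 'h) tower) hspace" where
  "space_inf H A \<Phi> = direct_sum (tower_space H A \<Phi>)"

definition rep_inf ::
  "'h hspace \<Rightarrow> 'h op set \<Rightarrow> ('h op \<Rightarrow> 'h op) \<Rightarrow> 'h op \<Rightarrow> (nat \<Rightarrow> ('h op, 'h) tower) op" where
  "rep_inf H A \<Phi> a = restrict (\<lambda>f n. tower_rep H A \<Phi> n a (f n)) (pts (space_inf H A \<Phi>))"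

definition isometry_inf ::
  "'h hspace \<Rightarrow> 'h op set \<Rightarrow> ('h op \<Rightarrow> 'h op) \<Rightarrow> (nat \<Rightarrow> ('h op, 'h) tower) op" where
  "isometry_inf H A \<Phi> =
     restrict (\<lambda>f n. case n of 0 \<Rightarrow> zero (tower_space H A \<Phi> 0)
                        | Suc m \<Rightarrow> tower_isometry H A \<Phi> m (f m))
       (pts (space_inf H A \<Phi>))"


section \<open>Minimal unitary dilation\<close>

definition minimal_unitary_dilation ::
  "'v hspace \<Rightarrow> 'v op \<Rightarrow> 'w op \<Rightarrow> 'w hspace \<Rightarrow> ('v \<Rightarrow> 'w) \<Rightarrow> bool" where
  "minimal_unitary_dilation K V Vh Hh Z \<longleftrightarrow>
     hilbert_space Hh \<and> isometry K Hh Z \<and> unitary Hh Vh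
     \<and> (\<forall>n. (op_power Hh Vh n \<circ>\<^bsub>K\<^esub> Z) = (Z \<circ>\<^bsub>K\<^esub> op_power K V n))
     \<and> closed_span Hh (\<Union>k. (unitary_zpower Hh Vh k \<circ>\<^bsub>K\<^esub> Z) ` pts K) = pts Hh"

end

theory Submission
  imports Defs
begin

text \<open>
  Put \<open>K = \<H>\<^sub>\<infinity>\<close>, \<open>R = \<pi>(\<AA>)\<close> and let \<open>U\<close> be the unitary dilation of \<open>V\<close> on \<open>G\<close>.  Once \<open>K\<close> is known to be a
  Hilbert space, \<open>R\<close> a C*-algebra and \<open>V\<close> an isometry with \<open>V\<^sup>* \<pi>(a) V = \<pi>(\<Phi> a)\<close>, the theorem follows from
  \<open>U Z = Z V\<close> and \<open>V\<^sup>* R V \<subseteq> R\<close> alone.  Indeed \<open>U Z = Z V\<close> gives \<open>Z\<^sup>* U\<^sup>* X U Z = V\<^sup>* Z\<^sup>* X Z V\<close> for every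
  operator \<open>X\<close>, so all formulas for powers hold by induction as soon as there is a unital C*-algebra on
  \<open>G\<close> that contains \<open>Z R Z\<^sup>*\<close>, is stable under \<open>X \<mapsto> U\<^sup>* X U\<close>, and is compressed by \<open>Z\<close> into \<open>R\<close>.

  The algebra generated by the operators \<open>U\<^sup>-\<^sup>n Z r Z\<^sup>* U\<^sup>n\<close> has these properties, but its compressions are
  awkward to control.  A larger algebra is easier.  Consider the operators
  \<open>l = U\<^sup>-\<^sup>n Z r\<^sub>n V \<dots> V r\<^sub>0\<close> from \<open>K\<close> to \<open>G\<close> (\<open>lift\<close>, \<open>words\<close>).  By \<open>U\<^sup>-\<^sup>n Z = U\<^sup>-\<^sup>n\<^sup>-\<^sup>1 Z V\<close> the level \<open>n\<close> of \<open>l\<close> can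
  be raised, and by \<open>V\<^sup>* R V \<subseteq> R\<close> the projection onto a lower level has the same form; hence the set of
  these \<open>l\<close> is mapped into itself by all \<open>U\<^sup>-\<^sup>n Z r Z\<^sup>* U\<^sup>n\<close>, and \<open>Z\<^sup>* l \<in> R\<close> (\<open>adj_lift_word\<close>).  Let \<open>F\<close>
  (\<open>corners\<close>) consist of all \<open>T\<close> with \<open>l\<^sup>* T \<in> R\<close> for every \<open>l\<close>.  It is a norm-closed space that contains
  \<open>Z\<close>.  The operators \<open>X\<close> for which every \<open>U\<^sup>-\<^sup>n X U\<^sup>n\<close> and its adjoint map \<open>F\<close> into itself
  (\<open>dilation_algebra\<close>) form a C*-algebra stable under conjugation by \<open>U\<close> for formal reasons; it contains
  \<open>Z R Z\<^sup>*\<close> by the invariance just described, and \<open>X Z \<in> F\<close> gives \<open>Z\<^sup>* X Z \<in> R\<close>.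

  For the tower, complete positivity is used in a single form (\<open>cp_conjugate\<close>): conjugating a positive
  matrix over \<open>\<AA>\<close> by elements of \<open>\<AA>\<close> before applying \<open>\<Psi>\<close> shows that the semi-inner product is positive,
  that \<open>\<sigma>\<^sub>\<Psi>\<close> is contractive, and that \<open>\<sigma>\<^sub>\<Psi>\<close> is again completely positive, which is what the recursion
  needs.  The vectors \<open>1 \<otimes> \<xi>\<close> give \<open>V\<^sub>n\<^sup>* \<sigma>\<^sub>n\<^sub>+\<^sub>1(a) V\<^sub>n = \<sigma>\<^sub>n(\<Phi> a)\<close>, and summing over \<open>n\<close> gives the
  covariance of \<open>V\<close>.  Contractivity makes \<open>\<pi>(a)\<close> bounded; since level \<open>0\<close> is the identity representation,
  \<open>\<pi>\<close> is injective and \<open>\<pi>(\<AA>)\<close> is norm closed.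
\<close>

section \<open>Semi-inner products\<close>

text \<open>Every argument about norms and limits below needs only the sesquilinear form, never the vector
  space laws.  Isolating this makes Cauchy-Schwarz and the triangle inequality available for the
  tensor spaces of lists, where the vector space laws hold only modulo null vectors.\<close>

locale semi_inner_product_space =
  fixes S :: "'v hspace"
  assumes zero_in: "zero S \<in> pts S"
    and add_in: "\<lbrakk>x \<in> pts S; y \<in> pts S\<rbrakk> \<Longrightarrow> add S x y \<in> pts S"
    and scl_in: "x \<in> pts S \<Longrightarrow> scl S c x \<in> pts S"
    and ip_cnj: "\<lbrakk>x \<in> pts S; y \<in> pts S\<rbrakk> \<Longrightarrow> ip S y x = cnj (ip S x y)"
    and ip_add: "\<lbrakk>x \<in> pts S; y \<in> pts S; z \<in> pts S\<rbrakk> \<Longrightarrow> ip S x (add S y z) = ip S x y + ip S x z"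
    and ip_scl: "\<lbrakk>x \<in> pts S; y \<in> pts S\<rbrakk> \<Longrightarrow> ip S x (scl S c y) = c * ip S x y"
    and ip_zero: "x \<in> pts S \<Longrightarrow> ip S x (zero S) = 0"
    and ip_pos: "x \<in> pts S \<Longrightarrow> 0 \<le> Re (ip S x x)"
begin

lemma diff_in: "\<lbrakk>x \<in> pts S; y \<in> pts S\<rbrakk> \<Longrightarrow> diff S x y \<in> pts S"
  by (simp add: diff_def add_in scl_in)

lemmas in_simps = zero_in add_in scl_in diff_in

lemma ip_diff: "\<lbrakk>x \<in> pts S; y \<in> pts S; z \<in> pts S\<rbrakk> \<Longrightarrow> ip S x (diff S y z) = ip S x y - ip S x z"
  by (simp add: diff_def ip_add ip_scl scl_in)

lemma ip_add_left:
  assumes "x \<in> pts S" "y \<in> pts S" "z \<in> pts S"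
  shows "ip S (add S x y) z = ip S x z + ip S y z"
  using ip_cnj[of z "add S x y"] ip_cnj[of z x] ip_cnj[of z y] assms by (simp add: in_simps ip_add)

lemma ip_scl_left:
  assumes "x \<in> pts S" "z \<in> pts S"
  shows "ip S (scl S c x) z = cnj c * ip S x z"
  using ip_cnj[of z "scl S c x"] ip_cnj[of z x] assms by (simp add: in_simps ip_scl)

lemma ip_zero_left: "x \<in> pts S \<Longrightarrow> ip S (zero S) x = 0"
  using ip_cnj[of x "zero S"] by (simp add: in_simps ip_zero)

lemma ip_diff_left:
  assumes "x \<in> pts S" "y \<in> pts S" "z \<in> pts S"
  shows "ip S (diff S x y) z = ip S x z - ip S y z"
  using ip_cnj[of z "diff S x y"] ip_cnj[of z x] ip_cnj[of z y] assms by (simp add: in_simps ip_diff)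

lemmas ip_simps = ip_add ip_scl ip_zero ip_diff ip_add_left ip_scl_left ip_zero_left ip_diff_left

lemma hnorm_ge_0 [simp]: "x \<in> pts S \<Longrightarrow> 0 \<le> hnorm S x"
  by (simp add: hnorm_def ip_pos)

lemma hnorm_sq: "x \<in> pts S \<Longrightarrow> (hnorm S x)\<^sup>2 = Re (ip S x x)"
  by (simp add: hnorm_def ip_pos)

lemma ip_self: "x \<in> pts S \<Longrightarrow> ip S x x = complex_of_real ((hnorm S x)\<^sup>2)"
  using ip_cnj[of x x] by (simp add: hnorm_sq complex_eq_iff)

lemma Re_ip_commute: "\<lbrakk>x \<in> pts S; y \<in> pts S\<rbrakk> \<Longrightarrow> Re (ip S y x) = Re (ip S x y)"
  using ip_cnj[of x y] by simp

lemma cauchy_schwarz: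
  assumes x: "x \<in> pts S" and y: "y \<in> pts S"
  shows "cmod (ip S x y) \<le> hnorm S x * hnorm S y"
proof -
  \<comment> \<open>positivity on \<open>x + t y\<close> with \<open>t\<close> a real multiple of \<open>cnj w\<close>, so that \<open>t w\<close> is real\<close>
  define p q w where "p = Re (ip S x x)" and "q = Re (ip S y y)" and "w = ip S x y"
  have quad: "0 \<le> p - 2 * r * (cmod w)\<^sup>2 + r\<^sup>2 * (cmod w)\<^sup>2 * q" for r :: real
  proof -
    define t where "t = - complex_of_real r * cnj w"
    have "ip S y x = cnj w" unfolding w_def using ip_cnj[OF x y] .
    moreover have "ip S y y = complex_of_real q" using ip_self[OF y] hnorm_sq[OF y] by (simp add: q_def)
    ultimately have "ip S (add S x (scl S t y)) (add S x (scl S t y))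
        = ip S x x + t * w + cnj t * cnj w + cnj t * t * q"
      using x y by (simp add: ip_simps in_simps w_def algebra_simps)
    also have "Re \<dots> = p - 2 * r * (cmod w)\<^sup>2 + r\<^sup>2 * (cmod w)\<^sup>2 * q"
      unfolding t_def p_def by (simp add: cmod_power2) (simp add: algebra_simps power2_eq_square)
    finally show ?thesis using ip_pos[of "add S x (scl S t y)"] x y by (simp add: in_simps)
  qed
  have p0: "0 \<le> p" and q0: "0 \<le> q" using ip_pos x y by (auto simp: p_def q_def)
  have "(cmod w)\<^sup>2 \<le> p * q"
  proof (cases "q = 0")
    case True
    have "(cmod w)\<^sup>2 = 0"
    proof (rule ccontr)
      assume "(cmod w)\<^sup>2 \<noteq> 0"
      hence pos: "(cmod w)\<^sup>2 > 0" by simp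
      \<comment> \<open>for \<open>q = 0\<close> the bound in \<open>quad\<close> is linear in \<open>r\<close>, and this \<open>r\<close> violates it\<close>
      have "0 \<le> p - 2 * ((p + 1) / (cmod w)\<^sup>2) * (cmod w)\<^sup>2"
        using quad[of "(p + 1) / (cmod w)\<^sup>2"] True by simp
      moreover have "(p + 1) / (cmod w)\<^sup>2 * (cmod w)\<^sup>2 = p + 1" using pos by simp
      ultimately have "0 \<le> p - 2 * (p + 1)" by (simp only: mult.assoc)
      thus False using p0 by simp
    qed
    thus ?thesis using True by simp
  next
    case False
    hence "q > 0" using q0 by simp
    moreover have "0 \<le> p - 2 * (1 / q) * (cmod w)\<^sup>2 + (1 / q)\<^sup>2 * (cmod w)\<^sup>2 * q" by (rule quad)
    hence "0 \<le> p - (cmod w)\<^sup>2 / q" using False by (simp add: field_simps power2_eq_square)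
    ultimately show ?thesis by (simp add: field_simps)
  qed
  also have "p * q = (hnorm S x * hnorm S y)\<^sup>2"
    using x y by (simp add: power_mult_distrib hnorm_sq p_def q_def)
  finally show ?thesis unfolding w_def by (rule power2_le_imp_le) (simp add: x y)
qed

lemma hnorm_eq_of_ip:
  assumes "x \<in> pts S" "y \<in> pts S" "\<And>z. z \<in> pts S \<Longrightarrow> ip S z x = ip S z y"
  shows "hnorm S x = hnorm S y"
proof -
  have "Re (ip S x y) = Re (ip S y y)" using assms(3)[of y] Re_ip_commute[OF assms(1,2)] assms(2) by simp
  thus ?thesis using assms(3)[OF assms(1)] by (simp add: hnorm_def)
qed

lemma hnorm_triangle:
  assumes x: "x \<in> pts S" and y: "y \<in> pts S"
  shows "hnorm S (add S x y) \<le> hnorm S x + hnorm S y"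
proof (rule power2_le_imp_le)
  have "(hnorm S (add S x y))\<^sup>2 = (hnorm S x)\<^sup>2 + (hnorm S y)\<^sup>2 + 2 * Re (ip S x y)"
    using x y by (simp add: hnorm_sq in_simps ip_simps Re_ip_commute)
  also have "\<dots> \<le> (hnorm S x)\<^sup>2 + (hnorm S y)\<^sup>2 + 2 * (hnorm S x * hnorm S y)"
    using cauchy_schwarz[OF x y] complex_Re_le_cmod[of "ip S x y"] by simp
  finally show "(hnorm S (add S x y))\<^sup>2 \<le> (hnorm S x + hnorm S y)\<^sup>2"
    by (simp add: power2_sum)
qed (simp add: x y)

lemma hnorm_scl:
  assumes "x \<in> pts S"
  shows "hnorm S (scl S c x) = cmod c * hnorm S x"
proof -
  have "(hnorm S (scl S c x))\<^sup>2 = (cmod c * hnorm S x)\<^sup>2"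
    using assms by (simp add: hnorm_sq in_simps ip_simps power_mult_distrib cmod_power2)
      (simp add: power2_eq_square algebra_simps)
  thus ?thesis using assms by (simp add: in_simps power2_eq_iff_nonneg)
qed

lemma hnorm_diff_commute:
  assumes "x \<in> pts S" "y \<in> pts S"
  shows "hnorm S (diff S x y) = hnorm S (diff S y x)"
  using assms by (simp add: hnorm_def ip_simps in_simps)

lemma hnorm_diff_self: "x \<in> pts S \<Longrightarrow> hnorm S (diff S x x) = 0"
  by (simp add: hnorm_def ip_simps in_simps)

lemma hnorm_diff_triangle:
  assumes "x \<in> pts S" "y \<in> pts S" "z \<in> pts S"
  shows "hnorm S (diff S x z) \<le> hnorm S (diff S x y) + hnorm S (diff S y z)"
proof -
  have "hnorm S (diff S x z) = hnorm S (add S (diff S x y) (diff S y z))"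
    by (rule hnorm_eq_of_ip) (use assms in \<open>simp_all add: ip_simps in_simps\<close>)
  thus ?thesis using hnorm_triangle[of "diff S x y" "diff S y z"] assms by (simp add: in_simps)
qed

lemma hnorm_triangle_diff:
  assumes "x \<in> pts S" "y \<in> pts S"
  shows "hnorm S x \<le> hnorm S (diff S x y) + hnorm S y"
proof -
  have "hnorm S x = hnorm S (add S (diff S x y) y)"
    by (rule hnorm_eq_of_ip) (use assms in \<open>simp_all add: ip_simps in_simps\<close>)
  thus ?thesis using hnorm_triangle[of "diff S x y" y] assms by (simp add: in_simps)
qed

lemma hnorm_zero: "hnorm S (zero S) = 0"
  by (simp add: hnorm_def ip_simps in_simps)

lemma ip_zero_of_hnorm:
  assumes "x \<in> pts S" "hnorm S x = 0" "z \<in> pts S"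
  shows "ip S z x = 0"
  using cauchy_schwarz[of z x] assms by simp

lemma parallelogram:
  assumes "x \<in> pts S" "y \<in> pts S"
  shows "(hnorm S (diff S x y))\<^sup>2 + (hnorm S (add S x y))\<^sup>2 = 2 * (hnorm S x)\<^sup>2 + 2 * (hnorm S y)\<^sup>2"
  using assms by (simp add: hnorm_sq ip_simps in_simps)

lemma ip_diff_bound:
  assumes "x \<in> pts S" "y \<in> pts S" "x' \<in> pts S" "y' \<in> pts S"
  shows "cmod (ip S x y - ip S x' y') \<le> hnorm S (diff S x x') * hnorm S y + hnorm S x' * hnorm S (diff S y y')"
proof -
  have "ip S x y - ip S x' y' = ip S (diff S x x') y + ip S x' (diff S y y')"
    using assms by (simp add: ip_simps in_simps)
  also have "cmod \<dots> \<le> cmod (ip S (diff S x x') y) + cmod (ip S x' (diff S y y'))"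
    by (rule norm_triangle_ineq)
  finally show ?thesis
    using cauchy_schwarz[of "diff S x x'" y] cauchy_schwarz[of x' "diff S y y'"] assms
    by (simp add: in_simps)
qed

end


section \<open>Inner product spaces and Hilbert spaces\<close>

sublocale inner_product_space \<subseteq> semi_inner_product_space H
proof
  show "ip H x (zero H) = 0" if "x \<in> pts H" for x
  proof -
    have "ip H x (zero H) = ip H x (add H x (scl H (-1) x))" using that by (simp add: add_uminus)
    thus ?thesis using that by (simp add: ip_add_right ip_scl_right scl_closed)
  qed
qed ((rule ip_commute; assumption)
    | simp add: zero_closed add_closed scl_closed ip_add_right ip_scl_right ip_nonneg)+

context inner_product_space
begin

lemma hnorm_eq_0: "x \<in> pts H \<Longrightarrow> hnorm H x = 0 \<longleftrightarrow> x = zero H"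
  using ip_self[of x] ip_definite[of x] hnorm_zero by auto

lemma hnorm_diff_eq_0:
  assumes x: "x \<in> pts H" and y: "y \<in> pts H"
  shows "hnorm H (diff H x y) = 0 \<longleftrightarrow> x = y"
proof
  assume "hnorm H (diff H x y) = 0"
  hence z: "diff H x y = zero H" using x y by (simp add: hnorm_eq_0 diff_in)
  have "x = add H x (add H (scl H (-1) y) y)"
    using x y add_uminus[of y] add_commute[of y "scl H (-1) y"] by (simp add: add_zero scl_in)
  also have "\<dots> = add H (diff H x y) y"
    using x y by (simp add: diff_def add_assoc scl_in)
  also have "\<dots> = y" using z y add_zero[of y] add_commute[of y "zero H"] by (simp add: zero_in)
  finally show "x = y" .
qed (simp add: y hnorm_diff_self)

text \<open>Equations between vectors are proved by comparing inner products, which replaces computations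
  with the vector space laws.\<close>

lemma vec_eqI:
  assumes "x \<in> pts H" "y \<in> pts H" "\<And>z. z \<in> pts H \<Longrightarrow> ip H z x = ip H z y"
  shows "x = y"
proof -
  have "ip H (diff H x y) (diff H x y) = 0"
    using assms by (simp add: ip_diff in_simps)
  hence "hnorm H (diff H x y) = 0" by (simp add: hnorm_def)
  thus ?thesis using assms by (simp add: hnorm_diff_eq_0)
qed

text \<open>A vector orthogonal to a dense set is no longer than its distance to any approximant.\<close>

lemma vec_eqI_dense:
  assumes x: "x \<in> pts H" and y: "y \<in> pts H"
    and D: "D \<subseteq> pts H" and dense: "\<And>g e. \<lbrakk>g \<in> pts H; e > 0\<rbrakk> \<Longrightarrow> \<exists>d\<in>D. hnorm H (diff H g d) < e"
    and eq: "\<And>z. z \<in> D \<Longrightarrow> ip H z x = ip H z y"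
  shows "x = y"
proof -
  let ?v = "diff H x y"
  have v: "?v \<in> pts H" using x y by (simp add: diff_in)
  have "hnorm H ?v < e" if e: "e > 0" for e
  proof (rule ccontr)
    assume "\<not> hnorm H ?v < e"
    obtain d where d: "d \<in> D" "hnorm H (diff H ?v d) < e" using dense[OF v e] by blast
    have dH: "d \<in> pts H" using d D by blast
    have "ip H d ?v = 0" using eq[OF d(1)] x y dH by (simp add: ip_diff)
    hence "(hnorm H ?v)\<^sup>2 = Re (ip H (diff H ?v d) ?v)" using v dH by (simp add: hnorm_sq ip_diff_left)
    also have "\<dots> \<le> hnorm H (diff H ?v d) * hnorm H ?v"
      using cauchy_schwarz[of "diff H ?v d" ?v] complex_Re_le_cmod v dH by (meson diff_in order_trans)
    finally have "hnorm H ?v \<le> hnorm H (diff H ?v d)"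
      using \<open>\<not> hnorm H ?v < e\<close> e by (simp add: power2_eq_square)
    thus False using d \<open>\<not> hnorm H ?v < e\<close> by simp
  qed
  from this[of "hnorm H ?v"] have "hnorm H ?v = 0" using hnorm_ge_0[OF v] by force
  thus ?thesis using x y by (simp add: hnorm_diff_eq_0)
qed

lemma metric_space_hdist: "Metric_space (pts H) (hdist H)"
proof
  show "hdist H x z \<le> hdist H x y + hdist H y z" if "x \<in> pts H" "y \<in> pts H" "z \<in> pts H" for x y z
    using that by (simp add: hdist_def hnorm_diff_triangle)
qed (auto simp: hdist_def diff_in hnorm_diff_commute hnorm_diff_eq_0)

text \<open>The default value of \<open>hdist\<close> outside the carrier disappears here; all later arguments about
  completeness speak of norms of differences only.\<close>

lemma mcomplete_iff:
  "Metric_space.mcomplete (pts H) (hdist H) \<longleftrightarrow>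
    (\<forall>X. (\<forall>n. X n \<in> pts H) \<longrightarrow> (\<forall>e>0. \<exists>N. \<forall>m\<ge>N. \<forall>n\<ge>N. hnorm H (diff H (X m) (X n)) < e)
       \<longrightarrow> (\<exists>x\<in>pts H. (\<lambda>n. hnorm H (diff H (X n) x)) \<longlonglongrightarrow> 0))"
proof -
  interpret M: Metric_space "pts H" "hdist H" by (rule metric_space_hdist)
  have 1: "M.MCauchy X \<longleftrightarrow> (\<forall>n. X n \<in> pts H) \<and>
      (\<forall>e>0. \<exists>N. \<forall>m\<ge>N. \<forall>n\<ge>N. hnorm H (diff H (X m) (X n)) < e)" for X
  proof (cases "\<forall>n. X n \<in> pts H")
    case True
    thus ?thesis by (auto simp: M.MCauchy_def hdist_def)
  qed (auto simp: M.MCauchy_def)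
  have 2: "limitin M.mtopology X x sequentially \<longleftrightarrow>
      x \<in> pts H \<and> (\<lambda>n. hnorm H (diff H (X n) x)) \<longlonglongrightarrow> 0" if "\<forall>n. X n \<in> pts H" for X x
  proof (cases "x \<in> pts H")
    case True
    hence "(\<lambda>n. hdist H (X n) x) = (\<lambda>n. hnorm H (diff H (X n) x))" using that by (auto simp: hdist_def)
    thus ?thesis using that True by (simp add: M.limitin_metric_dist_null)
  qed (auto simp: M.limitin_metric_dist_null)
  have "(M.MCauchy X \<longrightarrow> (\<exists>x. limitin M.mtopology X x sequentially)) \<longleftrightarrow>
      ((\<forall>n. X n \<in> pts H) \<longrightarrow> (\<forall>e>0. \<exists>N. \<forall>m\<ge>N. \<forall>n\<ge>N. hnorm H (diff H (X m) (X n)) < e)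
       \<longrightarrow> (\<exists>x\<in>pts H. (\<lambda>n. hnorm H (diff H (X n) x)) \<longlonglongrightarrow> 0))" for X
  proof (cases "\<forall>n. X n \<in> pts H")
    case True
    show ?thesis unfolding 1 2[OF True] Bex_def using True by simp
  next
    case False
    thus ?thesis unfolding 1 by blast
  qed
  thus ?thesis unfolding M.mcomplete_def by simp
qed

end

lemma hilbert_spaceI:
  assumes "inner_product_space H"
    and "\<And>X. \<lbrakk>\<And>n. X n \<in> pts H; \<And>e. e > 0 \<Longrightarrow> \<exists>N. \<forall>m\<ge>N. \<forall>n\<ge>N. hnorm H (diff H (X m) (X n)) < e\<rbrakk>
      \<Longrightarrow> \<exists>x\<in>pts H. (\<lambda>n. hnorm H (diff H (X n) x)) \<longlonglongrightarrow> 0"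
  shows "hilbert_space H"
  using assms inner_product_space.mcomplete_iff[OF assms(1)]
  by (simp add: hilbert_space_def hilbert_space_axioms_def)

lemma (in hilbert_space) cauchy_convergent:
  assumes "\<And>n. X n \<in> pts H" "\<And>e. e > 0 \<Longrightarrow> \<exists>N. \<forall>m\<ge>N. \<forall>n\<ge>N. hnorm H (diff H (X m) (X n)) < e"
  obtains x where "x \<in> pts H" "(\<lambda>n. hnorm H (diff H (X n) x)) \<longlonglongrightarrow> 0"
  using complete assms unfolding mcomplete_iff by blast

context semi_inner_product_space
begin

lemma hnorm_tendsto:
  assumes X: "\<And>n. X n \<in> pts S" and x: "x \<in> pts S" and lim: "(\<lambda>n. hnorm S (diff S (X n) x)) \<longlonglongrightarrow> 0"
  shows "(\<lambda>n. hnorm S (X n)) \<longlonglongrightarrow> hnorm S x"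
proof -
  have "\<bar>hnorm S (X n) - hnorm S x\<bar> \<le> hnorm S (diff S (X n) x)" for n
    using hnorm_triangle_diff[OF X x, of n] hnorm_triangle_diff[OF x X, of n]
      hnorm_diff_commute[OF x X, of n] by linarith
  hence "(\<lambda>n. hnorm S (X n) - hnorm S x) \<longlonglongrightarrow> 0"
    by (intro Lim_null_comparison[OF _ lim]) simp
  thus ?thesis by (simp add: LIM_zero_iff)
qed

lemma ip_tendsto:
  assumes X: "\<And>n. X n \<in> pts S" and x: "x \<in> pts S" and lim: "(\<lambda>n. hnorm S (diff S (X n) x)) \<longlonglongrightarrow> 0"
    and Y: "\<And>n. Y n \<in> pts S" and y: "y \<in> pts S" and limY: "(\<lambda>n. hnorm S (diff S (Y n) y)) \<longlonglongrightarrow> 0"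
  shows "(\<lambda>n. ip S (X n) (Y n)) \<longlonglongrightarrow> ip S x y"
proof -
  let ?g = "\<lambda>n. hnorm S (diff S (X n) x) * hnorm S (Y n) + hnorm S x * hnorm S (diff S (Y n) y)"
  have hY: "(\<lambda>n. hnorm S (Y n)) \<longlonglongrightarrow> hnorm S y" using Y y limY by (rule hnorm_tendsto)
  have "?g \<longlonglongrightarrow> 0 * hnorm S y + hnorm S x * 0"
    using hY lim limY by (intro tendsto_intros)
  hence g0: "?g \<longlonglongrightarrow> 0" by simp
  have bd: "cmod (ip S (X n) (Y n) - ip S x y) \<le> ?g n" for n
    using ip_diff_bound[of "X n" "Y n" x y] X Y x y by blast
  have "(\<lambda>n. ip S (X n) (Y n) - ip S x y) \<longlonglongrightarrow> 0"
    using always_eventually[OF allI[OF bd]] g0 by (rule Lim_null_comparison)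
  thus ?thesis by (simp add: LIM_zero_iff)
qed

end

section \<open>Bounded operators\<close>

lemma op_comp_apply [simp]: "x \<in> pts H \<Longrightarrow> (S \<circ>\<^bsub>H\<^esub> T) x = S (T x)"
  by (simp add: op_comp_def compose_def)

lemma op_id_apply [simp]: "x \<in> pts H \<Longrightarrow> op_id H x = x"
  by (simp add: op_id_def)

lemma op_add_apply [simp]: "x \<in> pts H \<Longrightarrow> op_add H K S T x = add K (S x) (T x)"
  by (simp add: op_add_def)

lemma op_scl_apply [simp]: "x \<in> pts H \<Longrightarrow> op_scl H K c T x = scl K c (T x)"
  by (simp add: op_scl_def)

lemma bounded_opsI:
  assumes "T \<in> pts H \<rightarrow>\<^sub>E pts K"
    and "\<And>x y. \<lbrakk>x \<in> pts H; y \<in> pts H\<rbrakk> \<Longrightarrow> T (add H x y) = add K (T x) (T y)"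
    and "\<And>c x. x \<in> pts H \<Longrightarrow> T (scl H c x) = scl K c (T x)"
    and "\<And>x. x \<in> pts H \<Longrightarrow> hnorm K (T x) \<le> B * hnorm H x"
  shows "T \<in> bounded_ops H K"
  unfolding bounded_ops_def using assms by blast

lemma bounded_ops_mem: "\<lbrakk>T \<in> bounded_ops H K; x \<in> pts H\<rbrakk> \<Longrightarrow> T x \<in> pts K"
  and bounded_ops_add: "\<lbrakk>T \<in> bounded_ops H K; x \<in> pts H; y \<in> pts H\<rbrakk> \<Longrightarrow> T (add H x y) = add K (T x) (T y)"
  and bounded_ops_scl: "\<lbrakk>T \<in> bounded_ops H K; x \<in> pts H\<rbrakk> \<Longrightarrow> T (scl H c x) = scl K c (T x)"
  by (auto simp: bounded_ops_def)

lemma bounded_ops_PiE: "T \<in> bounded_ops H K \<Longrightarrow> T \<in> pts H \<rightarrow>\<^sub>E pts K"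
  by (simp add: bounded_ops_def)

lemma bounded_ops_bound:
  assumes "T \<in> bounded_ops H K" "semi_inner_product_space H"
  obtains B where "B \<ge> 0" "\<And>x. x \<in> pts H \<Longrightarrow> hnorm K (T x) \<le> B * hnorm H x"
proof -
  interpret H: semi_inner_product_space H by fact
  obtain B where B: "\<forall>x\<in>pts H. hnorm K (T x) \<le> B * hnorm H x"
    using assms(1) by (auto simp: bounded_ops_def)
  show thesis
  proof (rule that[of "\<bar>B\<bar>"])
    show "hnorm K (T x) \<le> \<bar>B\<bar> * hnorm H x" if "x \<in> pts H" for x
    proof -
      have "B * hnorm H x \<le> \<bar>B\<bar> * hnorm H x" using that by (simp add: mult_right_mono)
      thus ?thesis using B that by force
    qed
  qed simp
qed

lemma op_eqI:
  assumes "S \<in> bounded_ops H K" "T \<in> bounded_ops H K" "\<And>x. x \<in> pts H \<Longrightarrow> S x = T x"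
  shows "S = T"
  using assms PiE_ext[of S "pts H" "\<lambda>_. pts K" T] by (auto simp: bounded_ops_def)

lemma bounded_ops_diff:
  assumes "T \<in> bounded_ops H K" "inner_product_space H" "x \<in> pts H" "y \<in> pts H"
  shows "T (diff H x y) = diff K (T x) (T y)"
  using assms inner_product_space.scl_closed[OF assms(2)]
  by (simp add: diff_def bounded_ops_add bounded_ops_scl)

lemma bounded_ops_tendsto:
  assumes R: "R \<in> bounded_ops G M" and "inner_product_space G" "inner_product_space M"
    and X: "\<And>n. X n \<in> pts G" and g: "g \<in> pts G" and lim: "(\<lambda>n. hnorm G (diff G (X n) g)) \<longlonglongrightarrow> 0"
  shows "(\<lambda>n. hnorm M (diff M (R (X n)) (R g))) \<longlonglongrightarrow> 0"
proof -
  interpret G: inner_product_space G by fact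
  interpret M: inner_product_space M by fact
  obtain B where B: "B \<ge> 0" "\<And>x. x \<in> pts G \<Longrightarrow> hnorm M (R x) \<le> B * hnorm G x"
    using bounded_ops_bound[OF R G.semi_inner_product_space_axioms] by metis
  have bd: "norm (hnorm M (diff M (R (X n)) (R g))) \<le> B * hnorm G (diff G (X n) g)" for n
    using B(2)[of "diff G (X n) g"] X[of n] g R
    by (simp add: G.in_simps M.in_simps bounded_ops_mem flip: bounded_ops_diff[OF R assms(2)])
  have "(\<lambda>n. B * hnorm G (diff G (X n) g)) \<longlonglongrightarrow> 0"
    using tendsto_mult_left[OF lim, of B] by simp
  with always_eventually[OF allI[OF bd]] show ?thesis by (rule Lim_null_comparison)
qed

lemma op_eqI_ip:
  assumes "inner_product_space K" "S \<in> bounded_ops H K" "T \<in> bounded_ops H K"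
    and "\<And>x y. \<lbrakk>x \<in> pts H; y \<in> pts K\<rbrakk> \<Longrightarrow> ip K y (S x) = ip K y (T x)"
  shows "S = T"
  using assms by (intro op_eqI[of S H K T] inner_product_space.vec_eqI[of K]) (auto simp: bounded_ops_mem)

lemma op_id_in [simp]:
  assumes "inner_product_space H" shows "op_id H \<in> bounded_ops H H"
proof -
  interpret inner_product_space H by fact
  show ?thesis by (rule bounded_opsI[where B=1]) (auto simp: op_id_def in_simps)
qed

lemma op_comp_in:
  assumes "T \<in> bounded_ops H K" "S \<in> bounded_ops K L" "inner_product_space H" "inner_product_space K"
  shows "(S \<circ>\<^bsub>H\<^esub> T) \<in> bounded_ops H L"
proof -
  interpret H: inner_product_space H by fact
  interpret K: inner_product_space K by fact
  obtain B where B: "B \<ge> 0" "\<And>x. x \<in> pts H \<Longrightarrow> hnorm K (T x) \<le> B * hnorm H x"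
    using bounded_ops_bound[OF assms(1) H.semi_inner_product_space_axioms] by metis
  obtain C where C: "C \<ge> 0" "\<And>x. x \<in> pts K \<Longrightarrow> hnorm L (S x) \<le> C * hnorm K x"
    using bounded_ops_bound[OF assms(2) K.semi_inner_product_space_axioms] by metis
  note mem = bounded_ops_mem[OF assms(1)] bounded_ops_mem[OF assms(2)]
  show ?thesis
  proof (rule bounded_opsI[where B="C * B"])
    show "(S \<circ>\<^bsub>H\<^esub> T) \<in> pts H \<rightarrow>\<^sub>E pts L"
      using mem by (auto simp: op_comp_def compose_def)
    show "hnorm L ((S \<circ>\<^bsub>H\<^esub> T) x) \<le> C * B * hnorm H x" if "x \<in> pts H" for x
    proof -
      have "hnorm L (S (T x)) \<le> C * hnorm K (T x)" using C mem that by simp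
      also have "\<dots> \<le> C * (B * hnorm H x)" using B C that by (simp add: mult_left_mono)
      finally show ?thesis using that by (simp add: mult.assoc)
    qed
  qed (auto simp: H.in_simps mem bounded_ops_add[OF assms(1)] bounded_ops_add[OF assms(2)]
      bounded_ops_scl[OF assms(1)] bounded_ops_scl[OF assms(2)])
qed

lemma op_scl_in:
  assumes "T \<in> bounded_ops H K" "inner_product_space H" "inner_product_space K"
  shows "op_scl H K c T \<in> bounded_ops H K"
proof -
  interpret H: inner_product_space H by fact
  interpret K: inner_product_space K by fact
  obtain B where B: "B \<ge> 0" "\<And>x. x \<in> pts H \<Longrightarrow> hnorm K (T x) \<le> B * hnorm H x"
    using bounded_ops_bound[OF assms(1) H.semi_inner_product_space_axioms] by metis
  note mem = bounded_ops_mem[OF assms(1)]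
  show ?thesis
  proof (rule bounded_opsI[where B="cmod c * B"])
    show "hnorm K (op_scl H K c T x) \<le> cmod c * B * hnorm H x" if "x \<in> pts H" for x
      using B(2)[OF that] that mem by (simp add: K.hnorm_scl mult_left_mono mult.assoc)
  qed (auto simp: op_scl_def mem H.in_simps K.in_simps K.scl_add_right K.scl_scl mult.commute
      bounded_ops_add[OF assms(1)] bounded_ops_scl[OF assms(1)])
qed

lemma op_add_in:
  assumes S: "S \<in> bounded_ops H K" and T: "T \<in> bounded_ops H K"
    and "inner_product_space H" "inner_product_space K"
  shows "op_add H K S T \<in> bounded_ops H K"
proof -
  interpret H: inner_product_space H by fact
  interpret K: inner_product_space K by fact
  obtain B where B: "B \<ge> 0" "\<And>x. x \<in> pts H \<Longrightarrow> hnorm K (T x) \<le> B * hnorm H x"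
    using bounded_ops_bound[OF T H.semi_inner_product_space_axioms] by metis
  obtain C where C: "C \<ge> 0" "\<And>x. x \<in> pts H \<Longrightarrow> hnorm K (S x) \<le> C * hnorm H x"
    using bounded_ops_bound[OF S H.semi_inner_product_space_axioms] by metis
  note mem = bounded_ops_mem[OF S] bounded_ops_mem[OF T]
  show ?thesis
  proof (rule bounded_opsI[where B="C + B"])
    show "hnorm K (op_add H K S T x) \<le> (C + B) * hnorm H x" if "x \<in> pts H" for x
      using B(2)[OF that] C(2)[OF that] that K.hnorm_triangle[of "S x" "T x"] mem
      by (simp add: algebra_simps)
    show "op_add H K S T (add H x y) = add K (op_add H K S T x) (op_add H K S T y)"
      if "x \<in> pts H" "y \<in> pts H" for x y
      by (rule K.vec_eqI) (use that mem in \<open>simp_all add: H.in_simps K.in_simps K.ip_simps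
        bounded_ops_add[OF S] bounded_ops_add[OF T]\<close>)
    show "op_add H K S T (scl H c x) = scl K c (op_add H K S T x)" if "x \<in> pts H" for x c
      by (rule K.vec_eqI) (use that mem in \<open>simp_all add: H.in_simps K.in_simps K.ip_simps
        bounded_ops_scl[OF S] bounded_ops_scl[OF T] algebra_simps\<close>)
  qed (auto simp: op_add_def mem H.in_simps K.in_simps)
qed


section \<open>Riesz representation and adjoints\<close>

text \<open>The representing vector is the minimiser of \<open>\<parallel>x\<parallel>\<^sup>2 - 2 Re (f x)\<close>: by the parallelogram law
  minimising sequences are Cauchy, and at the minimum the first variation vanishes.  This avoids
  orthogonal projections onto the kernel of \<open>f\<close>.\<close>

lemma (in hilbert_space) riesz_representation:
  fixes f :: "'v \<Rightarrow> complex"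
  assumes f_add: "\<And>x y. \<lbrakk>x \<in> pts H; y \<in> pts H\<rbrakk> \<Longrightarrow> f (add H x y) = f x + f y"
    and f_scl: "\<And>c x. x \<in> pts H \<Longrightarrow> f (scl H c x) = c * f x"
    and f_bound: "\<And>x. x \<in> pts H \<Longrightarrow> cmod (f x) \<le> B * hnorm H x"
  obtains y where "y \<in> pts H" "\<And>x. x \<in> pts H \<Longrightarrow> f x = ip H y x"
proof -
  define J where "J x = (hnorm H x)\<^sup>2 - 2 * Re (f x)" for x
  have f_diff: "f (diff H x y) = f x - f y" if "x \<in> pts H" "y \<in> pts H" for x y
    using that by (simp add: diff_def f_add f_scl in_simps)
  have J_lower: "J x \<ge> - B\<^sup>2" if "x \<in> pts H" for x
  proof -
    have "Re (f x) \<le> B * hnorm H x" using f_bound[OF that] complex_Re_le_cmod order_trans by blast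
    moreover have "0 \<le> (hnorm H x - B)\<^sup>2" by simp
    ultimately show ?thesis by (simp add: J_def power2_diff algebra_simps)
  qed
  define m where "m = (INF x\<in>pts H. J x)"
  have bdd: "bdd_below (J ` pts H)" using J_lower by (auto intro!: bdd_belowI[where m="- B\<^sup>2"])
  have m_le: "m \<le> J x" if "x \<in> pts H" for x
    unfolding m_def using bdd that by (rule cINF_lower)
  have "\<exists>x\<in>pts H. J x < m + 1 / Suc n" for n
  proof (rule ccontr)
    assume "\<not> ?thesis"
    hence "m + 1 / Suc n \<le> m"
      unfolding m_def[symmetric] using zero_in
      by (subst (2) m_def) (intro cINF_greatest, auto simp: not_less)
    thus False by simp
  qed
  then obtain X where X: "\<And>n. X n \<in> pts H" "\<And>n. J (X n) < m + 1 / Suc n" by metis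
  have par: "(hnorm H (diff H x y))\<^sup>2 \<le> 2 * (J x - m) + 2 * (J y - m)"
    if "x \<in> pts H" "y \<in> pts H" for x y
  proof -
    \<comment> \<open>the parallelogram law compares \<open>J x\<close> and \<open>J y\<close> with the value of \<open>J\<close> at the midpoint\<close>
    let ?h = "scl H (1/2) (add H x y)"
    have "(hnorm H ?h)\<^sup>2 = (hnorm H (add H x y))\<^sup>2 / 4"
      using that by (simp add: hnorm_scl in_simps power_mult_distrib power_divide)
    moreover have "Re (f ?h) = (Re (f x) + Re (f y)) / 2"
      using that by (simp add: f_add f_scl in_simps add_divide_distrib)
    moreover have "m \<le> J ?h" using that by (intro m_le) (simp add: in_simps)
    ultimately show ?thesis using parallelogram[OF that] unfolding J_def by simp
  qed
  have cau: "\<exists>N. \<forall>m\<ge>N. \<forall>n\<ge>N. hnorm H (diff H (X m) (X n)) < e" if "e > 0" for e :: real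
  proof -
    obtain N where N: "1 / real (Suc N) < e\<^sup>2 / 4"
    proof (rule nat_approx_posE[of "e\<^sup>2 / 4"])
      show "0 < e\<^sup>2 / 4" using \<open>e > 0\<close> by simp
    qed
    have "hnorm H (diff H (X i) (X j)) < e" if ij: "i \<ge> N" "j \<ge> N" for i j
    proof -
      have s: "1 / real (Suc k) < e\<^sup>2 / 4" if "k \<ge> N" for k
        using N that by (smt (verit) frac_le of_nat_0_less_iff of_nat_mono Suc_le_mono zero_less_Suc)
      have "(hnorm H (diff H (X i) (X j)))\<^sup>2 < e\<^sup>2"
      proof -
        have "J (X i) - m < e\<^sup>2 / 4" "J (X j) - m < e\<^sup>2 / 4"
          using X(2)[of i] X(2)[of j] s[OF ij(1)] s[OF ij(2)] by (simp_all only: diff_less_eq)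
        thus ?thesis using par[OF X(1) X(1), of i j] by argo
      qed
      thus ?thesis using \<open>e > 0\<close> by (simp add: power2_less_imp_less)
    qed
    thus ?thesis by blast
  qed
  obtain y where y: "y \<in> pts H" and lim: "(\<lambda>n. hnorm H (diff H (X n) y)) \<longlonglongrightarrow> 0"
    using cauchy_convergent[OF X(1) cau] by blast
  have "(\<lambda>n. f (X n) - f y) \<longlonglongrightarrow> 0"
    using f_bound[of "diff H _ y"] X(1) y
    by (intro Lim_null_comparison[OF _ tendsto_mult_right_zero[OF lim, of B]])
       (auto simp: f_diff[symmetric] in_simps)
  hence flim: "(\<lambda>n. f (X n)) \<longlonglongrightarrow> f y" by (simp add: LIM_zero_iff)
  have Jy: "J y \<le> m"
  proof (rule LIMSEQ_le)
    show "(\<lambda>n. J (X n)) \<longlonglongrightarrow> J y"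
      unfolding J_def using hnorm_tendsto[OF X(1) y lim] flim by (intro tendsto_intros)
    have "(\<lambda>n. m + 1 / real (Suc n)) \<longlonglongrightarrow> m + 0"
      by (intro tendsto_intros LIMSEQ_Suc[OF lim_1_over_n])
    thus "(\<lambda>n. m + 1 / real (Suc n)) \<longlonglongrightarrow> m" by simp
    show "\<exists>N. \<forall>n\<ge>N. J (X n) \<le> m + 1 / real (Suc n)" using X(2) less_imp_le by blast
  qed
  have Re_eq: "Re (f z) = Re (ip H y z)" if z: "z \<in> pts H" for z
  proof (rule ccontr)
    assume ne: "Re (f z) \<noteq> Re (ip H y z)"
    define b where "b = Re (ip H y z) - Re (f z)"
    define q where "q = (hnorm H z)\<^sup>2"
    have var: "0 \<le> t\<^sup>2 * q + 2 * t * b" for t :: real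
    proof -
      let ?w = "add H y (scl H t z)"
      have "(hnorm H ?w)\<^sup>2 = (hnorm H y)\<^sup>2 + t\<^sup>2 * q + 2 * t * Re (ip H y z)"
        using y z Re_ip_commute[OF y z]
        by (simp add: hnorm_sq in_simps ip_simps q_def) (simp add: power2_eq_square algebra_simps)
      moreover have "Re (f ?w) = Re (f y) + t * Re (f z)" using y z by (simp add: f_add f_scl in_simps)
      moreover have "J y \<le> J ?w" using Jy m_le[of ?w] y z by (simp add: in_simps)
      ultimately show ?thesis by (simp add: J_def b_def algebra_simps)
    qed
    have q0: "q \<ge> 0" by (simp add: q_def)
    \<comment> \<open>near the minimum of the quadratic in \<open>t\<close>; the added \<open>1\<close> covers \<open>z = 0\<close>\<close>
    have "0 \<le> (- b / (q + 1))\<^sup>2 * q + 2 * (- b / (q + 1)) * b" by (rule var)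
    also have "\<dots> = - (b\<^sup>2 * (q + 2)) / (q + 1)\<^sup>2"
      using q0 by (simp add: divide_simps power2_eq_square) (simp add: algebra_simps)
    also have "\<dots> < 0" using q0 ne by (simp add: b_def divide_neg_pos)
    finally show False by simp
  qed
  have "f x = ip H y x" if x: "x \<in> pts H" for x
  proof (rule complex_eqI)
    show "Re (f x) = Re (ip H y x)" by (rule Re_eq[OF x])
    show "Im (f x) = Im (ip H y x)"
      using Re_eq[of "scl H \<i> x"] x y by (simp add: in_simps f_scl ip_simps)
  qed
  thus thesis using that y by blast
qed

lemma adj_eqI:
  assumes "inner_product_space H" "S \<in> bounded_ops K H"
    and "\<And>x y. \<lbrakk>x \<in> pts H; y \<in> pts K\<rbrakk> \<Longrightarrow> ip H x (S y) = ip K (T x) y"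
  shows "adj H K T = S"
  unfolding adj_def
proof (rule the_equality)
  fix S' assume "S' \<in> bounded_ops K H \<and> (\<forall>x\<in>pts H. \<forall>y\<in>pts K. ip H x (S' y) = ip K (T x) y)"
  thus "S' = S" using assms by (intro op_eqI_ip[of H S' K S]) auto
qed (use assms in auto)

lemma adj_exists:
  assumes "hilbert_space H" "inner_product_space K" and T: "T \<in> bounded_ops H K"
  shows "\<exists>S\<in>bounded_ops K H. \<forall>x\<in>pts H. \<forall>y\<in>pts K. ip H x (S y) = ip K (T x) y"
proof -
  interpret H: hilbert_space H by fact
  interpret K: inner_product_space K by fact
  obtain B where B: "B \<ge> 0" "\<And>x. x \<in> pts H \<Longrightarrow> hnorm K (T x) \<le> B * hnorm H x"
    using bounded_ops_bound[OF T H.semi_inner_product_space_axioms] by metis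
  note mem = bounded_ops_mem[OF T]
  have "\<exists>s\<in>pts H. \<forall>x\<in>pts H. ip K y (T x) = ip H s x" if y: "y \<in> pts K" for y
  proof (rule H.riesz_representation[of "\<lambda>x. ip K y (T x)" "hnorm K y * B"])
    show "cmod (ip K y (T x)) \<le> hnorm K y * B * hnorm H x" if "x \<in> pts H" for x
    proof -
      have "cmod (ip K y (T x)) \<le> hnorm K y * hnorm K (T x)"
        using K.cauchy_schwarz[of y "T x"] y that mem by simp
      also have "\<dots> \<le> hnorm K y * (B * hnorm H x)"
        using B(2)[OF that] y by (intro mult_left_mono) auto
      finally show ?thesis by (simp add: mult.assoc)
    qed
  qed (use y in \<open>auto simp: bounded_ops_add[OF T] bounded_ops_scl[OF T] mem K.ip_simps\<close>)
  then obtain s where s: "\<And>y. y \<in> pts K \<Longrightarrow> s y \<in> pts H"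
    "\<And>x y. \<lbrakk>y \<in> pts K; x \<in> pts H\<rbrakk> \<Longrightarrow> ip K y (T x) = ip H (s y) x" by metis
  have ips: "ip H x (s y) = ip K (T x) y" if "x \<in> pts H" "y \<in> pts K" for x y
    using s(2)[of y x] H.ip_cnj[of "s y" x] K.ip_cnj[of y "T x"] that s(1) mem by simp
  define S where "S = restrict s (pts K)"
  have S: "S y = s y" if "y \<in> pts K" for y using that by (simp add: S_def)
  have "S \<in> bounded_ops K H"
  proof (rule bounded_opsI[where B=B])
    show "S \<in> pts K \<rightarrow>\<^sub>E pts H" using s(1) by (auto simp: S_def)
    show "S (add K x y) = add H (S x) (S y)" if "x \<in> pts K" "y \<in> pts K" for x y
      by (rule H.vec_eqI) (use that in \<open>auto simp: S s(1) K.in_simps H.in_simps H.ip_simps K.ip_simps ips mem\<close>)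
    show "S (scl K c x) = scl H c (S x)" if "x \<in> pts K" for x c
      by (rule H.vec_eqI) (use that in \<open>auto simp: S s(1) K.in_simps H.in_simps H.ip_simps K.ip_simps ips mem\<close>)
    show "hnorm H (S y) \<le> B * hnorm K y" if y: "y \<in> pts K" for y
    proof (cases "hnorm H (s y) = 0")
      case False
      have "(hnorm H (s y))\<^sup>2 = Re (ip K (T (s y)) y)" using y by (simp add: H.hnorm_sq s(1) ips)
      also have "\<dots> \<le> hnorm K (T (s y)) * hnorm K y"
        using K.cauchy_schwarz[of "T (s y)" y] y mem s(1) complex_Re_le_cmod order_trans by blast
      also have "\<dots> \<le> B * hnorm H (s y) * hnorm K y"
        using B(2)[of "s y"] s(1) y by (intro mult_right_mono) auto
      finally have "hnorm H (s y) * hnorm H (s y) \<le> (B * hnorm K y) * hnorm H (s y)"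
        by (simp add: power2_eq_square algebra_simps)
      thus ?thesis using False H.hnorm_ge_0[OF s(1)[OF y]] S[OF y]
        by (simp add: mult_le_cancel_right)
    qed (use y B S in simp)
  qed
  moreover have "\<forall>x\<in>pts H. \<forall>y\<in>pts K. ip H x (S y) = ip K (T x) y" using ips S by simp
  ultimately show ?thesis by blast
qed

lemma adj_in:
  assumes "hilbert_space H" "inner_product_space K" "T \<in> bounded_ops H K"
  shows "adj H K T \<in> bounded_ops K H"
  using adj_exists[OF assms] adj_eqI[of H _ K T] assms(1)
  by (metis hilbert_space.axioms(1))

lemma ip_adj:
  assumes "hilbert_space H" "inner_product_space K" "T \<in> bounded_ops H K" "x \<in> pts H" "y \<in> pts K"
  shows "ip H x (adj H K T y) = ip K (T x) y"
  using adj_exists[OF assms(1-3)] adj_eqI[of H _ K T] assms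
  by (metis hilbert_space.axioms(1))

lemma ip_adj_left:
  assumes "hilbert_space H" "inner_product_space K" "T \<in> bounded_ops H K" "x \<in> pts H" "y \<in> pts K"
  shows "ip H (adj H K T y) x = ip K y (T x)"
proof -
  interpret H: hilbert_space H by fact
  interpret K: inner_product_space K by fact
  have "adj H K T y \<in> pts H" using assms by (meson adj_in bounded_ops_mem)
  thus ?thesis
    using H.ip_cnj[of x "adj H K T y"] K.ip_cnj[of "T x" y] ip_adj[OF assms] assms(3-5)
    by (simp add: bounded_ops_mem)
qed

lemma adj_adj:
  assumes "hilbert_space H" "hilbert_space K" "T \<in> bounded_ops H K"
  shows "adj K H (adj H K T) = T"
  by (rule adj_eqI) (use assms in \<open>auto simp: ip_adj_left hilbert_space.axioms(1)\<close>)

lemma adj_comp: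
  assumes "hilbert_space H" "hilbert_space K" "inner_product_space L"
    and T: "T \<in> bounded_ops H K" and S: "S \<in> bounded_ops K L"
  shows "adj H L (S \<circ>\<^bsub>H\<^esub> T) = (adj H K T \<circ>\<^bsub>L\<^esub> adj K L S)"
proof (rule adj_eqI)
  have ips: "inner_product_space H" "inner_product_space K" using assms by (simp_all add: hilbert_space.axioms(1))
  show "inner_product_space H" by (rule ips)
  show "(adj H K T \<circ>\<^bsub>L\<^esub> adj K L S) \<in> bounded_ops L H"
    using assms ips by (intro op_comp_in[of _ L K]) (auto intro: adj_in)
  show "ip H x ((adj H K T \<circ>\<^bsub>L\<^esub> adj K L S) y) = ip L ((S \<circ>\<^bsub>H\<^esub> T) x) y" if "x \<in> pts H" "y \<in> pts L" for x y
    using that assms ips by (simp add: ip_adj bounded_ops_mem[OF adj_in] bounded_ops_mem[OF T])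
qed

lemma adj_bound:
  assumes "hilbert_space H" "inner_product_space K" and T: "T \<in> bounded_ops H K"
    and B: "B \<ge> 0" "\<And>x. x \<in> pts H \<Longrightarrow> hnorm K (T x) \<le> B * hnorm H x" and y: "y \<in> pts K"
  shows "hnorm H (adj H K T y) \<le> B * hnorm K y"
proof -
  interpret H: hilbert_space H by fact
  interpret K: inner_product_space K by fact
  let ?s = "adj H K T y"
  have s: "?s \<in> pts H" using assms by (meson adj_in bounded_ops_mem)
  have "(hnorm H ?s)\<^sup>2 = Re (ip K (T ?s) y)" using assms s by (simp add: H.hnorm_sq ip_adj)
  also have "\<dots> \<le> hnorm K (T ?s) * hnorm K y"
    using K.cauchy_schwarz[of "T ?s" y] y bounded_ops_mem[OF T s] complex_Re_le_cmod order_trans by blast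
  also have "\<dots> \<le> B * hnorm H ?s * hnorm K y"
    using B(2)[OF s] y by (intro mult_right_mono) auto
  finally have "hnorm H ?s * hnorm H ?s \<le> (B * hnorm K y) * hnorm H ?s"
    by (simp add: power2_eq_square algebra_simps)
  thus ?thesis using H.hnorm_ge_0[OF s] mult_nonneg_nonneg[OF B(1) K.hnorm_ge_0[OF y]]
    by (cases "hnorm H ?s = 0") (simp_all add: mult_le_cancel_right)
qed

lemma adj_id:
  assumes "inner_product_space H" shows "adj H H (op_id H) = op_id H"
  by (rule adj_eqI) (use assms in auto)

text \<open>By polarisation, the definition of an isometry by norms gives its preservation of inner products,
  hence \<open>V\<^sup>* V = 1\<close>.\<close>

lemma isometry_ip:
  assumes "inner_product_space H" "inner_product_space K" and V: "isometry H K V"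
    and "x \<in> pts H" "y \<in> pts H"
  shows "ip K (V x) (V y) = ip H x y"
proof -
  interpret H: inner_product_space H by fact
  interpret K: inner_product_space K by fact
  have Vb: "V \<in> bounded_ops H K" and n: "\<And>x. x \<in> pts H \<Longrightarrow> hnorm K (V x) = hnorm H x"
    using V by (auto simp: isometry_def)
  note mem = bounded_ops_mem[OF Vb]
  have re: "Re (ip K (V x) (V y)) = Re (ip H x y)" if "x \<in> pts H" "y \<in> pts H" for x y
  proof -
    have "(hnorm K (V (add H x y)))\<^sup>2 = (hnorm H (add H x y))\<^sup>2" using n that by (simp add: H.in_simps)
    hence "(hnorm K (V x))\<^sup>2 + (hnorm K (V y))\<^sup>2 + 2 * Re (ip K (V x) (V y))
       = (hnorm H x)\<^sup>2 + (hnorm H y)\<^sup>2 + 2 * Re (ip H x y)"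
      using that mem H.Re_ip_commute[of x y] K.Re_ip_commute[of "V x" "V y"]
      by (simp add: bounded_ops_add[OF Vb] H.hnorm_sq K.hnorm_sq H.in_simps K.in_simps H.ip_simps K.ip_simps)
    thus ?thesis using n that by simp
  qed
  show ?thesis
  proof (rule complex_eqI)
    show "Re (ip K (V x) (V y)) = Re (ip H x y)" using re assms by simp
    show "Im (ip K (V x) (V y)) = Im (ip H x y)"
      using re[of x "scl H \<i> y"] assms mem
      by (simp add: H.in_simps bounded_ops_scl[OF Vb] H.ip_simps K.ip_simps)
  qed
qed

lemma isometry_adj_comp:
  assumes "hilbert_space H" "inner_product_space K" "isometry H K V" "x \<in> pts H"
  shows "adj H K V (V x) = x"
proof (rule inner_product_space.vec_eqI)
  have V: "V \<in> bounded_ops H K" using assms by (simp add: isometry_def)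
  show "inner_product_space H" using assms by (simp add: hilbert_space.axioms(1))
  show "adj H K V (V x) \<in> pts H" using assms V by (meson adj_in bounded_ops_mem)
  show "ip H z (adj H K V (V x)) = ip H z x" if "z \<in> pts H" for z
    using assms V that \<open>inner_product_space H\<close> by (simp add: ip_adj isometry_ip bounded_ops_mem)
qed fact


section \<open>Norm-closed sets of operators\<close>

text \<open>Norm approximation is expressed by pointwise estimates with a uniform constant; the operator
  norm itself appears only in the proof that this agrees with closedness in the metric topology.\<close>

definition norm_limit :: "'v hspace \<Rightarrow> 'w hspace \<Rightarrow> ('v \<Rightarrow> 'w) set \<Rightarrow> ('v \<Rightarrow> 'w) \<Rightarrow> bool" where
  "norm_limit H K A T \<longleftrightarrow> (\<forall>e>0. \<exists>S\<in>A. \<forall>x\<in>pts H. hnorm K (diff K (T x) (S x)) \<le> e * hnorm H x)"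

lemma opnorm_upper:
  assumes "inner_product_space H" and T: "T \<in> bounded_ops H K" and x: "x \<in> pts H" "hnorm H x \<le> 1"
  shows "hnorm K (T x) \<le> opnorm H K T"
  unfolding opnorm_def
proof (rule cSUP_upper)
  interpret H: inner_product_space H by fact
  obtain B where B: "B \<ge> 0" "\<And>x. x \<in> pts H \<Longrightarrow> hnorm K (T x) \<le> B * hnorm H x"
    using bounded_ops_bound[OF T H.semi_inner_product_space_axioms] by metis
  show "bdd_above ((\<lambda>x. hnorm K (T x)) ` {x \<in> pts H. hnorm H x \<le> 1})"
  proof (rule bdd_aboveI2)
    show "hnorm K (T x) \<le> B" if "x \<in> {x \<in> pts H. hnorm H x \<le> 1}" for x
      using B(1) B(2)[of x] that mult_left_mono[of "hnorm H x" 1 B] by auto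
  qed
qed (use x in simp)

lemma opnorm_nonneg:
  assumes "inner_product_space H" "inner_product_space K" and T: "T \<in> bounded_ops H K"
  shows "0 \<le> opnorm H K T"
proof -
  interpret H: inner_product_space H by fact
  interpret K: inner_product_space K by fact
  have "hnorm K (T (zero H)) \<le> opnorm H K T"
    using H.zero_in by (intro opnorm_upper[OF assms(1) T]) (simp_all add: H.hnorm_zero)
  thus ?thesis using K.hnorm_ge_0[OF bounded_ops_mem[OF T H.zero_in]] by linarith
qed

lemma opnorm_bound:
  assumes "inner_product_space H" "inner_product_space K" and T: "T \<in> bounded_ops H K" and x: "x \<in> pts H"
  shows "hnorm K (T x) \<le> opnorm H K T * hnorm H x"
proof -
  interpret H: inner_product_space H by fact
  interpret K: inner_product_space K by fact
  note mem = bounded_ops_mem[OF T]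
  show ?thesis
  proof (cases "hnorm H x = 0")
    case True
    obtain B where "\<And>x. x \<in> pts H \<Longrightarrow> hnorm K (T x) \<le> B * hnorm H x"
      using bounded_ops_bound[OF T H.semi_inner_product_space_axioms] by metis
    from this[OF x] show ?thesis using True by simp
  next
    case False
    define r where "r = hnorm H x"
    have r: "r > 0" using False H.hnorm_ge_0[OF x] by (simp add: r_def)
    let ?u = "scl H (complex_of_real (1 / r)) x"
    have "hnorm H ?u = 1" using x r by (simp add: H.hnorm_scl norm_divide flip: r_def)
    hence "hnorm K (T ?u) \<le> opnorm H K T"
      using x by (intro opnorm_upper[OF assms(1) T]) (simp_all add: H.in_simps)
    moreover have "hnorm K (T ?u) = hnorm K (T x) / r"
      using x mem r by (simp add: bounded_ops_scl[OF T] K.hnorm_scl norm_divide)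
    ultimately show ?thesis using r by (simp add: r_def field_simps)
  qed
qed

lemma opnorm_leI:
  assumes "inner_product_space H" "B \<ge> 0" "\<And>x. x \<in> pts H \<Longrightarrow> hnorm K (T x) \<le> B * hnorm H x"
  shows "opnorm H K T \<le> B"
  unfolding opnorm_def
proof (rule cSUP_least)
  interpret H: inner_product_space H by fact
  show "{x \<in> pts H. hnorm H x \<le> 1} \<noteq> {}" using H.zero_in H.hnorm_zero by force
  show "hnorm K (T x) \<le> B" if "x \<in> {x \<in> pts H. hnorm H x \<le> 1}" for x
    using assms(2) assms(3)[of x] that mult_left_mono[of "hnorm H x" 1 B] by auto
qed

context inner_product_space
begin

lemma op_diff:
  assumes "S \<in> bounded_ops H H" "T \<in> bounded_ops H H"
  shows "op_add H H S (op_scl H H (-1) T) \<in> bounded_ops H H"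
    and "x \<in> pts H \<Longrightarrow> op_add H H S (op_scl H H (-1) T) x = diff H (S x) (T x)"
  using assms by (simp_all add: op_add_in op_scl_in inner_product_space_axioms diff_def)

lemma opdist_le_iff:
  assumes "S \<in> bounded_ops H H" "T \<in> bounded_ops H H" "e \<ge> 0"
  shows "opdist H S T \<le> e \<longleftrightarrow> (\<forall>x\<in>pts H. hnorm H (diff H (S x) (T x)) \<le> e * hnorm H x)"
proof
  assume "opdist H S T \<le> e"
  hence le: "opnorm H H (op_add H H S (op_scl H H (-1) T)) \<le> e" using assms by (simp add: opdist_def)
  show "\<forall>x\<in>pts H. hnorm H (diff H (S x) (T x)) \<le> e * hnorm H x"
  proof
    fix x assume x: "x \<in> pts H"
    have "hnorm H (diff H (S x) (T x)) \<le> opnorm H H (op_add H H S (op_scl H H (-1) T)) * hnorm H x"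
      using opnorm_bound[OF _ _ op_diff(1)[OF assms(1,2)] x] op_diff(2)[OF assms(1,2) x]
        inner_product_space_axioms by simp
    also have "\<dots> \<le> e * hnorm H x" using le x by (simp add: mult_right_mono)
    finally show "hnorm H (diff H (S x) (T x)) \<le> e * hnorm H x" .
  qed
next
  assume "\<forall>x\<in>pts H. hnorm H (diff H (S x) (T x)) \<le> e * hnorm H x"
  thus "opdist H S T \<le> e"
    unfolding opdist_def using assms op_diff(2)[OF assms(1,2)]
    by (auto intro!: opnorm_leI inner_product_space_axioms)
qed

lemma opdist_nonneg: "0 \<le> opdist H S T"
  by (auto simp: opdist_def intro!: opnorm_nonneg inner_product_space_axioms op_diff)

lemma metric_space_opdist: "Metric_space (bounded_ops H H) (opdist H)"
proof
  show "0 \<le> opdist H S T" for S T by (rule opdist_nonneg)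
  have le: "opdist H S T \<le> opdist H T S" for S T
  proof (cases "S \<in> bounded_ops H H \<and> T \<in> bounded_ops H H")
    case True
    have "\<forall>x\<in>pts H. hnorm H (diff H (T x) (S x)) \<le> opdist H T S * hnorm H x"
      using opdist_le_iff[of T S "opdist H T S"] True opdist_nonneg by simp
    thus ?thesis using True opdist_nonneg
      by (subst opdist_le_iff) (auto simp: hnorm_diff_commute bounded_ops_mem)
  qed (auto simp: opdist_def)
  show "opdist H S T = opdist H T S" for S T by (rule antisym) (rule le)+
  show "opdist H S T = 0 \<longleftrightarrow> S = T" if ST: "S \<in> bounded_ops H H" "T \<in> bounded_ops H H" for S T
  proof -
    have "opdist H S T = 0 \<longleftrightarrow> opdist H S T \<le> 0" using opdist_nonneg[of S T] by auto
    also have "\<dots> \<longleftrightarrow> (\<forall>x\<in>pts H. hnorm H (diff H (S x) (T x)) \<le> 0)"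
      using opdist_le_iff[OF ST, of 0] by simp
    also have "\<dots> \<longleftrightarrow> (\<forall>x\<in>pts H. S x = T x)"
    proof (intro ball_cong refl)
      fix x assume "x \<in> pts H"
      hence m: "S x \<in> pts H" "T x \<in> pts H" using ST by (auto simp: bounded_ops_mem)
      show "hnorm H (diff H (S x) (T x)) \<le> 0 \<longleftrightarrow> S x = T x"
        using hnorm_diff_eq_0[OF m] hnorm_ge_0[OF diff_in[OF m]] by linarith
    qed
    also have "\<dots> \<longleftrightarrow> S = T" using op_eqI[OF ST] by auto
    finally show ?thesis .
  qed
  show "opdist H S U \<le> opdist H S T + opdist H T U"
    if ST: "S \<in> bounded_ops H H" "T \<in> bounded_ops H H" "U \<in> bounded_ops H H" for S T U
  proof -
    have "hnorm H (diff H (S x) (U x)) \<le> (opdist H S T + opdist H T U) * hnorm H x" if x: "x \<in> pts H" for x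
    proof -
      have "hnorm H (diff H (S x) (T x)) \<le> opdist H S T * hnorm H x"
        "hnorm H (diff H (T x) (U x)) \<le> opdist H T U * hnorm H x"
        using opdist_le_iff[of S T "opdist H S T"] opdist_le_iff[of T U "opdist H T U"] ST x opdist_nonneg by auto
      thus ?thesis using hnorm_diff_triangle[of "S x" "T x" "U x"] ST x
        by (simp add: bounded_ops_mem algebra_simps)
    qed
    thus ?thesis using ST opdist_nonneg by (subst opdist_le_iff) auto
  qed
qed

lemma closed_ops_iff:
  assumes "A \<subseteq> bounded_ops H H"
  shows "closedin (Metric_space.mtopology (bounded_ops H H) (opdist H)) A \<longleftrightarrow>
    (\<forall>T\<in>bounded_ops H H. norm_limit H H A T \<longrightarrow> T \<in> A)"
proof -
  interpret M: Metric_space "bounded_ops H H" "opdist H" by (rule metric_space_opdist)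
  have "norm_limit H H A T \<longleftrightarrow> (\<forall>r>0. \<not> disjnt A (M.mball T r))" if T: "T \<in> bounded_ops H H" for T
  proof -
    have "norm_limit H H A T \<longleftrightarrow> (\<forall>e>0. \<exists>S\<in>A. opdist H T S \<le> e)"
      unfolding norm_limit_def using assms T
      by (intro all_cong imp_cong bex_cong refl opdist_le_iff[symmetric]) (auto simp: subset_eq)
    also have "\<dots> \<longleftrightarrow> (\<forall>e>0. \<exists>S\<in>A. opdist H T S < e)"
      by (meson dense less_imp_le order_le_less_trans)
    also have "\<dots> \<longleftrightarrow> (\<forall>r>0. \<not> disjnt A (M.mball T r))"
      using assms T by (simp add: disjnt_iff) blast
    finally show ?thesis .
  qed
  thus ?thesis using assms by (auto simp: M.closedin_metric)
qed

end

section \<open>Algebra of bounded operators\<close>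

lemma op_comp_assoc:
  assumes "T \<in> bounded_ops H K"
  shows "((R \<circ>\<^bsub>K\<^esub> S) \<circ>\<^bsub>H\<^esub> T) = (R \<circ>\<^bsub>H\<^esub> (S \<circ>\<^bsub>H\<^esub> T))"
  using bounded_ops_mem[OF assms] by (auto simp: op_comp_def compose_def fun_eq_iff restrict_def)

lemma op_id_comp: "T \<in> bounded_ops H K \<Longrightarrow> (op_id K \<circ>\<^bsub>H\<^esub> T) = T"
  using bounded_ops_PiE[of T H K]
  by (auto simp: op_comp_def op_id_def compose_def fun_eq_iff restrict_def PiE_iff extensional_def)

lemma op_comp_id: "T \<in> bounded_ops H K \<Longrightarrow> (T \<circ>\<^bsub>H\<^esub> op_id H) = T"
  using bounded_ops_PiE[of T H K]
  by (auto simp: op_comp_def op_id_def compose_def fun_eq_iff restrict_def PiE_iff extensional_def)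

lemma op_comp_add_right:
  assumes "C \<in> bounded_ops K L" "S \<in> bounded_ops H K" "T \<in> bounded_ops H K"
  shows "(C \<circ>\<^bsub>H\<^esub> op_add H K S T) = op_add H L (C \<circ>\<^bsub>H\<^esub> S) (C \<circ>\<^bsub>H\<^esub> T)"
  using assms
  by (auto simp: op_comp_def op_add_def compose_def fun_eq_iff restrict_def bounded_ops_add bounded_ops_mem)

lemma op_comp_scl_right:
  assumes "C \<in> bounded_ops K L" "T \<in> bounded_ops H K"
  shows "(C \<circ>\<^bsub>H\<^esub> op_scl H K c T) = op_scl H L c (C \<circ>\<^bsub>H\<^esub> T)"
  using assms
  by (auto simp: op_comp_def op_scl_def compose_def fun_eq_iff restrict_def bounded_ops_scl bounded_ops_mem)

lemma op_comp_add_left: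
  assumes "T \<in> bounded_ops H K"
  shows "(op_add K L S S' \<circ>\<^bsub>H\<^esub> T) = op_add H L (S \<circ>\<^bsub>H\<^esub> T) (S' \<circ>\<^bsub>H\<^esub> T)"
  using bounded_ops_mem[OF assms]
  by (auto simp: op_comp_def op_add_def compose_def fun_eq_iff restrict_def)

lemma op_comp_scl_left:
  assumes "T \<in> bounded_ops H K"
  shows "(op_scl K L c S \<circ>\<^bsub>H\<^esub> T) = op_scl H L c (S \<circ>\<^bsub>H\<^esub> T)"
  using bounded_ops_mem[OF assms]
  by (auto simp: op_comp_def op_scl_def compose_def fun_eq_iff restrict_def)

lemma adj_add:
  assumes "hilbert_space H" "hilbert_space K" "S \<in> bounded_ops H K" "T \<in> bounded_ops H K"
  shows "adj H K (op_add H K S T) = op_add K H (adj H K S) (adj H K T)"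
proof -
  interpret H: hilbert_space H by fact
  interpret K: hilbert_space K by fact
  note ips = H.inner_product_space_axioms K.inner_product_space_axioms
  have a: "adj H K S \<in> bounded_ops K H" "adj H K T \<in> bounded_ops K H" using assms ips by (auto intro: adj_in)
  show ?thesis
    by (rule adj_eqI[OF ips(1) op_add_in[OF a ips(2,1)]])
       (use assms ips a in \<open>simp add: ip_adj H.ip_simps K.ip_simps bounded_ops_mem\<close>)
qed

lemma adj_scl:
  assumes "hilbert_space H" "hilbert_space K" "T \<in> bounded_ops H K"
  shows "adj H K (op_scl H K c T) = op_scl K H (cnj c) (adj H K T)"
proof -
  interpret H: hilbert_space H by fact
  interpret K: hilbert_space K by fact
  note ips = H.inner_product_space_axioms K.inner_product_space_axioms
  have a: "adj H K T \<in> bounded_ops K H" using assms ips by (auto intro: adj_in)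
  show ?thesis
    by (rule adj_eqI[OF ips(1) op_scl_in[OF a ips(2,1)]])
       (use assms ips a in \<open>simp add: ip_adj H.ip_simps K.ip_simps bounded_ops_mem\<close>)
qed

lemma norm_limit_mono: "\<lbrakk>norm_limit H K A T; A \<subseteq> B\<rbrakk> \<Longrightarrow> norm_limit H K B T"
  unfolding norm_limit_def by blast

lemma norm_limit_comp_left:
  assumes "inner_product_space H" "inner_product_space K" and C: "C \<in> bounded_ops K L"
    and A: "A \<subseteq> bounded_ops H K" and T: "T \<in> bounded_ops H K" and lim: "norm_limit H K A T"
  shows "norm_limit H L ((\<lambda>S. C \<circ>\<^bsub>H\<^esub> S) ` A) (C \<circ>\<^bsub>H\<^esub> T)"
  unfolding norm_limit_def
proof (intro allI impI)
  interpret H: inner_product_space H by fact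
  interpret K: inner_product_space K by fact
  fix e :: real assume e: "e > 0"
  obtain B where B: "B \<ge> 0" "\<And>x. x \<in> pts K \<Longrightarrow> hnorm L (C x) \<le> B * hnorm K x"
    using bounded_ops_bound[OF C K.semi_inner_product_space_axioms] by metis
  have "e / (B + 1) > 0" using B e by simp
  then obtain S where S: "S \<in> A" "\<And>x. x \<in> pts H \<Longrightarrow> hnorm K (diff K (T x) (S x)) \<le> e / (B + 1) * hnorm H x"
    using lim unfolding norm_limit_def by meson
  have Sb: "S \<in> bounded_ops H K" using S A by blast
  have "hnorm L (diff L ((C \<circ>\<^bsub>H\<^esub> T) x) ((C \<circ>\<^bsub>H\<^esub> S) x)) \<le> e * hnorm H x" if x: "x \<in> pts H" for x
  proof -
    have m: "T x \<in> pts K" "S x \<in> pts K" using T Sb x by (auto simp: bounded_ops_mem)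
    have "hnorm L (diff L (C (T x)) (C (S x))) = hnorm L (C (diff K (T x) (S x)))"
      using bounded_ops_diff[OF C K.inner_product_space_axioms m] by simp
    also have "\<dots> \<le> B * hnorm K (diff K (T x) (S x))" using B(2) m by (simp add: K.diff_in)
    also have "\<dots> \<le> (B + 1) * (e / (B + 1) * hnorm H x)"
      using S(2)[OF x] B(1) m by (intro mult_mono) (auto simp: K.diff_in)
    also have "\<dots> = e * hnorm H x" using B(1) by simp
    finally show ?thesis using x by simp
  qed
  thus "\<exists>S\<in>(\<lambda>S. C \<circ>\<^bsub>H\<^esub> S) ` A. \<forall>x\<in>pts H. hnorm L (diff L ((C \<circ>\<^bsub>H\<^esub> T) x) (S x)) \<le> e * hnorm H x"
    using S(1) by blast
qed

lemma norm_limit_comp_right: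
  assumes "inner_product_space H" and C: "C \<in> bounded_ops H K" and lim: "norm_limit K L A T"
  shows "norm_limit H L ((\<lambda>S. S \<circ>\<^bsub>H\<^esub> C) ` A) (T \<circ>\<^bsub>H\<^esub> C)"
  unfolding norm_limit_def
proof (intro allI impI)
  interpret H: inner_product_space H by fact
  fix e :: real assume e: "e > 0"
  obtain B where B: "B \<ge> 0" "\<And>x. x \<in> pts H \<Longrightarrow> hnorm K (C x) \<le> B * hnorm H x"
    using bounded_ops_bound[OF C H.semi_inner_product_space_axioms] by metis
  have e': "e / (B + 1) > 0" using B e by simp
  then obtain S where S: "S \<in> A" "\<And>x. x \<in> pts K \<Longrightarrow> hnorm L (diff L (T x) (S x)) \<le> e / (B + 1) * hnorm K x"
    using lim unfolding norm_limit_def by meson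
  have "hnorm L (diff L ((T \<circ>\<^bsub>H\<^esub> C) x) ((S \<circ>\<^bsub>H\<^esub> C) x)) \<le> e * hnorm H x" if x: "x \<in> pts H" for x
  proof -
    have "hnorm L (diff L (T (C x)) (S (C x))) \<le> e / (B + 1) * hnorm K (C x)"
      using S(2)[of "C x"] C x by (simp add: bounded_ops_mem)
    also have "\<dots> \<le> e / (B + 1) * ((B + 1) * hnorm H x)"
      using B(2)[OF x] e' H.hnorm_ge_0[OF x] by (intro mult_left_mono) (auto simp: algebra_simps)
    also have "\<dots> = e * hnorm H x" using B(1) by simp
    finally show ?thesis using x by simp
  qed
  thus "\<exists>S\<in>(\<lambda>S. S \<circ>\<^bsub>H\<^esub> C) ` A. \<forall>x\<in>pts H. hnorm L (diff L ((T \<circ>\<^bsub>H\<^esub> C) x) (S x)) \<le> e * hnorm H x"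
    using S(1) by blast
qed

lemma norm_limit_adj:
  assumes "hilbert_space H" and A: "A \<subseteq> bounded_ops H H" and T: "T \<in> bounded_ops H H"
    and lim: "norm_limit H H A T"
  shows "norm_limit H H (adj H H ` A) (adj H H T)"
  unfolding norm_limit_def
proof (intro allI impI)
  interpret H: hilbert_space H by fact
  note ips = H.inner_product_space_axioms
  fix e :: real assume e: "e > 0"
  then obtain S where S: "S \<in> A" "\<And>x. x \<in> pts H \<Longrightarrow> hnorm H (diff H (T x) (S x)) \<le> e * hnorm H x"
    using lim unfolding norm_limit_def by meson
  have Sb: "S \<in> bounded_ops H H" using S A by blast
  let ?D = "op_add H H T (op_scl H H (-1) S)"
  have D: "?D \<in> bounded_ops H H" using Sb T by (rule H.op_diff(1)[rotated])
  have "hnorm H (diff H (adj H H T y) (adj H H S y)) \<le> e * hnorm H y" if y: "y \<in> pts H" for y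
  proof -
    have "adj H H ?D y = diff H (adj H H T y) (adj H H S y)"
      using y by (simp add: adj_add adj_scl T Sb assms(1) op_scl_in ips diff_def)
    moreover have "hnorm H (adj H H ?D y) \<le> e * hnorm H y"
      by (rule adj_bound[OF assms(1) ips D _ _ y]) (use e S(2) T Sb in \<open>auto simp: diff_def\<close>)
    ultimately show ?thesis by simp
  qed
  thus "\<exists>S\<in>adj H H ` A. \<forall>x\<in>pts H. hnorm H (diff H (adj H H T x) (S x)) \<le> e * hnorm H x"
    using S(1) by blast
qed

lemma unital_cstar_algebraI:
  assumes "inner_product_space H" "A \<subseteq> bounded_ops H H" "op_id H \<in> A"
    and "\<And>a b. \<lbrakk>a \<in> A; b \<in> A\<rbrakk> \<Longrightarrow> op_add H H a b \<in> A"
    and "\<And>c a. a \<in> A \<Longrightarrow> op_scl H H c a \<in> A"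
    and "\<And>a b. \<lbrakk>a \<in> A; b \<in> A\<rbrakk> \<Longrightarrow> (a \<circ>\<^bsub>H\<^esub> b) \<in> A"
    and "\<And>a. a \<in> A \<Longrightarrow> adj H H a \<in> A"
    and "\<And>T. \<lbrakk>T \<in> bounded_ops H H; norm_limit H H A T\<rbrakk> \<Longrightarrow> T \<in> A"
  shows "unital_cstar_algebra H A"
  using assms by (simp add: unital_cstar_algebra_def inner_product_space.closed_ops_iff)

lemma unital_cstar_algebraD:
  assumes "unital_cstar_algebra H A"
  shows "a \<in> A \<Longrightarrow> a \<in> bounded_ops H H" "op_id H \<in> A"
    and "\<lbrakk>a \<in> A; b \<in> A\<rbrakk> \<Longrightarrow> op_add H H a b \<in> A"
    and "a \<in> A \<Longrightarrow> op_scl H H c a \<in> A"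
    and "\<lbrakk>a \<in> A; b \<in> A\<rbrakk> \<Longrightarrow> (a \<circ>\<^bsub>H\<^esub> b) \<in> A"
    and "a \<in> A \<Longrightarrow> adj H H a \<in> A"
    and "\<lbrakk>inner_product_space H; T \<in> bounded_ops H H; norm_limit H H A T\<rbrakk> \<Longrightarrow> T \<in> A"
  using assms by (auto simp: unital_cstar_algebra_def inner_product_space.closed_ops_iff)


section \<open>A C*-algebra on the space of a unitary dilation\<close>

locale unitary_dilation =
  fixes K :: "'v hspace" and V :: "'v op" and G :: "'w hspace" and U :: "'w op" and Z :: "'v \<Rightarrow> 'w"
    and R :: "'v op set"
  assumes K: "hilbert_space K" and G: "hilbert_space G"
    and V: "isometry K K V" and Z: "isometry K G Z" and U: "unitary G U"
    and intertwine: "x \<in> pts K \<Longrightarrow> U (Z x) = Z (V x)"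
    and R: "unital_cstar_algebra K R"
    and covariant: "r \<in> R \<Longrightarrow> (adj K K V \<circ>\<^bsub>K\<^esub> (r \<circ>\<^bsub>K\<^esub> V)) \<in> R"
begin

sublocale K: hilbert_space K by (rule K)
sublocale G: hilbert_space G by (rule G)

lemmas ips [simp] = K.inner_product_space_axioms G.inner_product_space_axioms K G

lemma V_in [simp]: "V \<in> bounded_ops K K" and Z_in [simp]: "Z \<in> bounded_ops K G"
  and U_in [simp]: "U \<in> bounded_ops G G"
  using V Z U by (auto simp: isometry_def unitary_def)

lemma adj_in_dil [simp]:
  "T \<in> bounded_ops K K \<Longrightarrow> adj K K T \<in> bounded_ops K K"
  "X \<in> bounded_ops G G \<Longrightarrow> adj G G X \<in> bounded_ops G G"
  "S \<in> bounded_ops K G \<Longrightarrow> adj K G S \<in> bounded_ops G K"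
  by (auto intro: adj_in)

lemma comp_in_dil [simp]:
  "\<lbrakk>X \<in> bounded_ops G G; B \<in> bounded_ops G K\<rbrakk> \<Longrightarrow> (B \<circ>\<^bsub>G\<^esub> X) \<in> bounded_ops G K"
  "\<lbrakk>T \<in> bounded_ops K K; S \<in> bounded_ops K K\<rbrakk> \<Longrightarrow> (S \<circ>\<^bsub>K\<^esub> T) \<in> bounded_ops K K"
  "\<lbrakk>X \<in> bounded_ops G G; Y \<in> bounded_ops G G\<rbrakk> \<Longrightarrow> (Y \<circ>\<^bsub>G\<^esub> X) \<in> bounded_ops G G"
  "\<lbrakk>A \<in> bounded_ops K G; X \<in> bounded_ops G G\<rbrakk> \<Longrightarrow> (X \<circ>\<^bsub>K\<^esub> A) \<in> bounded_ops K G"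
  "\<lbrakk>T \<in> bounded_ops K K; A \<in> bounded_ops K G\<rbrakk> \<Longrightarrow> (A \<circ>\<^bsub>K\<^esub> T) \<in> bounded_ops K G"
  "\<lbrakk>A \<in> bounded_ops K G; B \<in> bounded_ops G K\<rbrakk> \<Longrightarrow> (B \<circ>\<^bsub>K\<^esub> A) \<in> bounded_ops K K"
  "\<lbrakk>B \<in> bounded_ops G K; T \<in> bounded_ops K K\<rbrakk> \<Longrightarrow> (T \<circ>\<^bsub>G\<^esub> B) \<in> bounded_ops G K"
  "\<lbrakk>B \<in> bounded_ops G K; A \<in> bounded_ops K G\<rbrakk> \<Longrightarrow> (A \<circ>\<^bsub>G\<^esub> B) \<in> bounded_ops G G"
  by (auto intro: op_comp_in)

lemma R_in: "r \<in> R \<Longrightarrow> r \<in> bounded_ops K K"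
  by (rule unital_cstar_algebraD[OF R])

lemma adj_U_U [simp]: "g \<in> pts G \<Longrightarrow> adj G G U (U g) = g"
  using U op_comp_apply[of g G "adj G G U" U] by (simp add: unitary_def)

lemma U_adj_U [simp]: "g \<in> pts G \<Longrightarrow> U (adj G G U g) = g"
  using U op_comp_apply[of g G U "adj G G U"] by (simp add: unitary_def)

text \<open>The isometries \<open>U\<^sup>-\<^sup>n Z\<close>.  From \<open>U Z = Z V\<close> one gets \<open>U\<^sup>-\<^sup>n Z = U\<^sup>-\<^sup>n\<^sup>-\<^sup>1 Z V\<close>, so they exhibit copies of
  \<open>K\<close> in \<open>G\<close> that increase with \<open>n\<close>.\<close>

primrec lift :: "nat \<Rightarrow> 'v \<Rightarrow> 'w" where
  "lift 0 = Z"
| "lift (Suc n) = (adj G G U \<circ>\<^bsub>K\<^esub> lift n)"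

lemma lift_in [simp]: "lift n \<in> bounded_ops K G"
  by (induction n) auto

lemma lift_mem [simp]: "x \<in> pts K \<Longrightarrow> lift n x \<in> pts G"
  by (rule bounded_ops_mem[OF lift_in])

lemma lift_isometry: "isometry K G (lift n)"
proof (induction n)
  case (Suc n)
  have "hnorm G (adj G G U g) = hnorm G g" if "g \<in> pts G" for g
    using that ip_adj_left[OF G ips(2) U_in _ that, of "adj G G U g"]
    by (simp add: hnorm_def bounded_ops_mem[OF adj_in_dil(2)])
  thus ?case using Suc by (simp add: isometry_def del: lift.simps) (simp add: bounded_ops_mem)
qed (use Z in simp)

lemma adj_lift_lift [simp]: "x \<in> pts K \<Longrightarrow> adj K G (lift n) (lift n x) = x"
  by (rule isometry_adj_comp[OF K ips(2) lift_isometry])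

lemma lift_shift: "lift n = (lift (Suc n) \<circ>\<^bsub>K\<^esub> V)"
proof (induction n)
  case 0
  show ?case
  proof (rule op_eqI[of _ K G])
    fix x assume x: "x \<in> pts K"
    have Zx: "Z x \<in> pts G" and Vx: "V x \<in> pts K" using x by (simp_all only: bounded_ops_mem[OF Z_in] bounded_ops_mem[OF V_in])
    have "adj G G U (Z (V x)) = Z x" using adj_U_U[OF Zx] by (simp only: intertwine[OF x])
    thus "lift 0 x = (lift (Suc 0) \<circ>\<^bsub>K\<^esub> V) x"
      using x Vx by simp
  qed simp_all
next
  case (Suc n)
  have "lift (Suc n) = (adj G G U \<circ>\<^bsub>K\<^esub> (lift (Suc n) \<circ>\<^bsub>K\<^esub> V))"
    using arg_cong[OF Suc, of "\<lambda>X. adj G G U \<circ>\<^bsub>K\<^esub> X"] unfolding lift.simps .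
  also have "\<dots> = (lift (Suc (Suc n)) \<circ>\<^bsub>K\<^esub> V)"
    by (subst lift.simps(2)[of "Suc n"], subst op_comp_assoc[OF V_in]) simp
  finally show ?case .
qed

lemma adj_lift_shift: "adj K G (lift n) = (adj K K V \<circ>\<^bsub>G\<^esub> adj K G (lift (Suc n)))"
  by (subst lift_shift, rule adj_comp) (auto simp del: lift.simps)

text \<open>The operators \<open>r\<^sub>n V \<dots> r\<^sub>1 V r\<^sub>0\<close>.  Together with \<open>lift n\<close> they describe the operators obtained from
  \<open>Z\<close> by applying translates of elements of \<open>Z R Z*\<close>: by \<open>adj_lift_word\<close> below, passing from any level
  to any other one only changes the length of the word.\<close>

primrec words :: "nat \<Rightarrow> 'v op set" where
  "words 0 = R"
| "words (Suc n) = (\<lambda>(r, x). r \<circ>\<^bsub>K\<^esub> (V \<circ>\<^bsub>K\<^esub> x)) ` (R \<times> words n)"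

lemma words_in: "x \<in> words n \<Longrightarrow> x \<in> bounded_ops K K"
  by (induction n arbitrary: x) (auto simp: R_in)

lemma R_words:
  assumes "r \<in> R" "x \<in> words n" shows "(r \<circ>\<^bsub>K\<^esub> x) \<in> words n"
proof (cases n)
  case 0
  thus ?thesis using assms unital_cstar_algebraD(5)[OF R] by simp
next
  case (Suc m)
  then obtain s y where x: "x = (s \<circ>\<^bsub>K\<^esub> (V \<circ>\<^bsub>K\<^esub> y))" and s: "s \<in> R" and y: "y \<in> words m" using assms by auto
  have "(r \<circ>\<^bsub>K\<^esub> x) = ((r \<circ>\<^bsub>K\<^esub> s) \<circ>\<^bsub>K\<^esub> (V \<circ>\<^bsub>K\<^esub> y))"
    unfolding x by (rule op_comp_assoc[symmetric]) (use y words_in in auto)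
  thus ?thesis using Suc s y assms(1) unital_cstar_algebraD(5)[OF R] by auto
qed

lemma V_words:
  assumes "x \<in> words n" shows "(V \<circ>\<^bsub>K\<^esub> x) \<in> words (Suc n)"
proof -
  have "(V \<circ>\<^bsub>K\<^esub> x) = (op_id K \<circ>\<^bsub>K\<^esub> (V \<circ>\<^bsub>K\<^esub> x))" using words_in[OF assms] by (simp add: op_id_comp[of _ K K])
  thus ?thesis using assms unital_cstar_algebraD(2)[OF R] by force
qed

text \<open>The only place where covariance enters: \<open>V\<^sup>* r V\<close> is absorbed into the next letter.\<close>

lemma adj_V_words:
  assumes "x \<in> words (Suc n)" shows "(adj K K V \<circ>\<^bsub>K\<^esub> x) \<in> words n"
proof -
  obtain r y where x: "x = (r \<circ>\<^bsub>K\<^esub> (V \<circ>\<^bsub>K\<^esub> y))" and r: "r \<in> R" and y: "y \<in> words n" using assms by auto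
  have "(adj K K V \<circ>\<^bsub>K\<^esub> x) = ((adj K K V \<circ>\<^bsub>K\<^esub> (r \<circ>\<^bsub>K\<^esub> V)) \<circ>\<^bsub>K\<^esub> y)"
    unfolding x using words_in[OF y] R_in[OF r] by (simp add: op_comp_assoc[of _ K K])
  thus ?thesis using R_words[OF covariant[OF r] y] by simp
qed

lemma lift_words_raise: "x \<in> words m \<Longrightarrow> \<exists>y\<in>words (m + k). (lift m \<circ>\<^bsub>K\<^esub> x) = (lift (m + k) \<circ>\<^bsub>K\<^esub> y)"
proof (induction k)
  case (Suc k)
  then obtain y where y: "y \<in> words (m + k)" "(lift m \<circ>\<^bsub>K\<^esub> x) = (lift (m + k) \<circ>\<^bsub>K\<^esub> y)" by blast
  have "(lift (m + k) \<circ>\<^bsub>K\<^esub> y) = (lift (Suc (m + k)) \<circ>\<^bsub>K\<^esub> (V \<circ>\<^bsub>K\<^esub> y))"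
    by (subst lift_shift, rule op_comp_assoc[OF words_in[OF y(1)]])
  moreover have "(V \<circ>\<^bsub>K\<^esub> y) \<in> words (m + Suc k)" using V_words[OF y(1)] by simp
  ultimately show ?case using y(2) by (intro bexI[of _ "V \<circ>\<^bsub>K\<^esub> y"]) (simp_all del: lift.simps)
qed auto

text \<open>Going down one level multiplies by \<open>V\<^sup>*\<close>, which removes one letter.\<close>

lemma lift_words_lower:
  "x \<in> words (n + k) \<Longrightarrow> (adj K G (lift n) \<circ>\<^bsub>K\<^esub> (lift (n + k) \<circ>\<^bsub>K\<^esub> x)) \<in> words n"
proof (induction k arbitrary: n)
  case 0
  have "(adj K G (lift n) \<circ>\<^bsub>K\<^esub> (lift n \<circ>\<^bsub>K\<^esub> x)) = x"
    using 0 words_in[of x n] by (intro op_eqI[of _ K K]) (auto simp: bounded_ops_mem)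
  thus ?case using 0 by simp
next
  case (Suc k)
  have x: "x \<in> bounded_ops K K" using words_in Suc.prems by blast
  have eq: "n + Suc k = Suc n + k" by simp
  have "(adj K G (lift (Suc n)) \<circ>\<^bsub>K\<^esub> (lift (Suc n + k) \<circ>\<^bsub>K\<^esub> x)) \<in> words (Suc n)"
    using Suc.prems by (intro Suc.IH) (simp only: eq)
  from adj_V_words[OF this] show ?case unfolding eq
    by (subst adj_lift_shift) (use x in \<open>simp add: op_comp_assoc[of _ K G] del: lift.simps\<close>)
qed

lemma adj_lift_word:
  assumes "x \<in> words m" shows "(adj K G (lift n) \<circ>\<^bsub>K\<^esub> (lift m \<circ>\<^bsub>K\<^esub> x)) \<in> words n"
proof (cases "n \<le> m")
  case True
  thus ?thesis using lift_words_lower[of x n "m - n"] assms by simp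
next
  case False
  obtain y where y: "y \<in> words n" "(lift m \<circ>\<^bsub>K\<^esub> x) = (lift n \<circ>\<^bsub>K\<^esub> y)"
    using lift_words_raise[OF assms, of "n - m"] False by auto
  thus ?thesis using lift_words_lower[of y n 0] by simp
qed

text \<open>The operators \<open>T\<close> such that \<open>l\<^sup>* T \<in> R\<close> for all \<open>l = lift n \<circ> x\<close>.  Taking this largest candidate
  instead of the closed span of the operators \<open>l\<close> makes norm-closedness and the module property
  immediate.\<close>

definition corners :: "('v \<Rightarrow> 'w) set" where
  "corners = {T \<in> bounded_ops K G. \<forall>n. \<forall>x\<in>words n. (adj K K x \<circ>\<^bsub>K\<^esub> (adj K G (lift n) \<circ>\<^bsub>K\<^esub> T)) \<in> R}"

lemma cornersD:
  "T \<in> corners \<Longrightarrow> T \<in> bounded_ops K G"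
  "\<lbrakk>T \<in> corners; x \<in> words n\<rbrakk> \<Longrightarrow> (adj K K x \<circ>\<^bsub>K\<^esub> (adj K G (lift n) \<circ>\<^bsub>K\<^esub> T)) \<in> R"
  by (auto simp: corners_def)

lemma corners_add: "\<lbrakk>S \<in> corners; T \<in> corners\<rbrakk> \<Longrightarrow> op_add K G S T \<in> corners"
  unfolding corners_def
  by (auto simp: op_add_in op_comp_add_right[of _ G K] op_comp_add_right[of _ K K] words_in
      intro!: unital_cstar_algebraD(3)[OF R])

lemma corners_scl: "T \<in> corners \<Longrightarrow> op_scl K G c T \<in> corners"
  unfolding corners_def
  by (auto simp: op_scl_in op_comp_scl_right[of _ G K] op_comp_scl_right[of _ K K] words_in
      intro!: unital_cstar_algebraD(4)[OF R])

lemma corners_closed: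
  assumes T: "T \<in> bounded_ops K G" and lim: "norm_limit K G corners T"
  shows "T \<in> corners"
proof -
  have "(adj K K x \<circ>\<^bsub>K\<^esub> (adj K G (lift n) \<circ>\<^bsub>K\<^esub> T)) \<in> R" if x: "x \<in> words n" for x n
  proof -
    let ?l = "adj K G (lift n)"
    have sub: "corners \<subseteq> bounded_ops K G" using cornersD(1) by blast
    have "norm_limit K K ((\<lambda>S. ?l \<circ>\<^bsub>K\<^esub> S) ` corners) (?l \<circ>\<^bsub>K\<^esub> T)"
      by (rule norm_limit_comp_left[OF _ _ _ sub T lim]) auto
    hence "norm_limit K K ((\<lambda>S. adj K K x \<circ>\<^bsub>K\<^esub> S) ` (\<lambda>S. ?l \<circ>\<^bsub>K\<^esub> S) ` corners) (adj K K x \<circ>\<^bsub>K\<^esub> (?l \<circ>\<^bsub>K\<^esub> T))"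
      by (rule norm_limit_comp_left[rotated 5]) (use sub T words_in[OF x] in auto)
    hence "norm_limit K K R (adj K K x \<circ>\<^bsub>K\<^esub> (?l \<circ>\<^bsub>K\<^esub> T))"
      by (rule norm_limit_mono) (use x cornersD(2) in auto)
    thus ?thesis using T words_in[OF x] by (intro unital_cstar_algebraD(7)[OF R]) auto
  qed
  thus ?thesis using T by (simp add: corners_def)
qed

lemma Z_corners: "Z \<in> corners"
proof -
  have "(adj K K x \<circ>\<^bsub>K\<^esub> (adj K G (lift n) \<circ>\<^bsub>K\<^esub> Z)) \<in> R" if x: "x \<in> words n" for x n
  proof -
    let ?y = "adj K G Z \<circ>\<^bsub>K\<^esub> (lift n \<circ>\<^bsub>K\<^esub> x)"
    have y: "?y \<in> R" using adj_lift_word[OF x, of 0] by simp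
    have "adj K K ?y = (adj K K x \<circ>\<^bsub>K\<^esub> (adj K G (lift n) \<circ>\<^bsub>K\<^esub> Z))"
      using words_in[OF x] adj_comp[of K G K "lift n \<circ>\<^bsub>K\<^esub> x" "adj K G Z"] adj_comp[of K K G x "lift n"]
      by (simp add: adj_adj op_comp_assoc[of _ K G])
    thus ?thesis using unital_cstar_algebraD(6)[OF R y] by simp
  qed
  thus ?thesis by (simp add: corners_def)
qed

text \<open>For \<open>l = lift m \<circ> x\<close> one has \<open>l\<^sup>* g T = (g\<^sup>* l)\<^sup>* T\<close>, and \<open>g\<^sup>* l\<close> is again of the form \<open>lift n \<circ> z\<close>: the
  word \<open>x\<close> is first moved to level \<open>n\<close>, where it is multiplied by \<open>r\<^sup>*\<close>.\<close>

lemma lift_R_corners: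
  assumes r: "r \<in> R" and T: "T \<in> corners"
  shows "((lift n \<circ>\<^bsub>G\<^esub> (r \<circ>\<^bsub>G\<^esub> adj K G (lift n))) \<circ>\<^bsub>K\<^esub> T) \<in> corners" (is "(?g \<circ>\<^bsub>K\<^esub> T) \<in> _")
proof -
  note Tb = cornersD(1)[OF T] and rb = R_in[OF r]
  have "(adj K K x \<circ>\<^bsub>K\<^esub> (adj K G (lift m) \<circ>\<^bsub>K\<^esub> (?g \<circ>\<^bsub>K\<^esub> T))) \<in> R" if x: "x \<in> words m" for x m
  proof -
    note xb = words_in[OF x]
    let ?y = "adj K G (lift n) \<circ>\<^bsub>K\<^esub> (lift m \<circ>\<^bsub>K\<^esub> x)"
    let ?z = "adj K K r \<circ>\<^bsub>K\<^esub> ?y"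
    have z: "?z \<in> words n"
      by (intro R_words unital_cstar_algebraD(6)[OF R r] adj_lift_word x)
    have y: "adj K K ?y = (adj K K x \<circ>\<^bsub>K\<^esub> (adj K G (lift m) \<circ>\<^bsub>K\<^esub> lift n))"
      using xb adj_comp[of K G K "lift m \<circ>\<^bsub>K\<^esub> x" "adj K G (lift n)"] adj_comp[of K K G x "lift m"]
      by (simp add: adj_adj op_comp_assoc[of _ K G])
    have "adj K K ?z = (adj K K ?y \<circ>\<^bsub>K\<^esub> r)"
      using xb rb adj_comp[of K K K ?y "adj K K r"] by (simp add: adj_adj)
    hence "(adj K K ?z \<circ>\<^bsub>K\<^esub> (adj K G (lift n) \<circ>\<^bsub>K\<^esub> T)) = (adj K K x \<circ>\<^bsub>K\<^esub> (adj K G (lift m) \<circ>\<^bsub>K\<^esub> (?g \<circ>\<^bsub>K\<^esub> T)))"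
      unfolding y using xb rb Tb by (simp add: op_comp_assoc[of _ K K] op_comp_assoc[of _ K G])
    thus ?thesis using cornersD(2)[OF T z] by simp
  qed
  thus ?thesis using rb Tb by (simp add: corners_def)
qed

text \<open>The adjointable multipliers of \<open>corners\<close>.  They need not be stable under conjugation by \<open>U\<close>;
  \<open>dilation_algebra\<close> below consists of the operators all of whose conjugates are multipliers.\<close>

definition multipliers :: "'w op set" where
  "multipliers = {X \<in> bounded_ops G G. \<forall>T\<in>corners. (X \<circ>\<^bsub>K\<^esub> T) \<in> corners \<and> (adj G G X \<circ>\<^bsub>K\<^esub> T) \<in> corners}"

lemma multipliersD:
  "X \<in> multipliers \<Longrightarrow> X \<in> bounded_ops G G"
  "\<lbrakk>X \<in> multipliers; T \<in> corners\<rbrakk> \<Longrightarrow> (X \<circ>\<^bsub>K\<^esub> T) \<in> corners"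
  "\<lbrakk>X \<in> multipliers; T \<in> corners\<rbrakk> \<Longrightarrow> (adj G G X \<circ>\<^bsub>K\<^esub> T) \<in> corners"
  by (auto simp: multipliers_def)

lemma unital_cstar_algebra_multipliers: "unital_cstar_algebra G multipliers"
proof (rule unital_cstar_algebraI)
  show "multipliers \<subseteq> bounded_ops G G" using multipliersD(1) by blast
  show "op_id G \<in> multipliers"
    by (auto simp: multipliers_def adj_id op_id_comp[of _ K G] cornersD(1))
  show "op_add G G X Y \<in> multipliers" if "X \<in> multipliers" "Y \<in> multipliers" for X Y
    using that multipliersD(1)[OF that(1)] multipliersD(1)[OF that(2)] unfolding multipliers_def
    by (auto simp: op_add_in adj_add op_comp_add_left[of _ K G] cornersD(1) intro!: corners_add)
  show "op_scl G G c X \<in> multipliers" if "X \<in> multipliers" for X c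
    using that multipliersD(1)[OF that] unfolding multipliers_def
    by (auto simp: op_scl_in adj_scl op_comp_scl_left[of _ K G] cornersD(1) intro!: corners_scl)
  show "(X \<circ>\<^bsub>G\<^esub> Y) \<in> multipliers" if "X \<in> multipliers" "Y \<in> multipliers" for X Y
    using that multipliersD(1)[OF that(1)] multipliersD(1)[OF that(2)] unfolding multipliers_def
    by (auto simp: adj_comp[of G G G] op_comp_assoc[of _ K G] cornersD(1))
  show "adj G G X \<in> multipliers" if "X \<in> multipliers" for X
    using that multipliersD(1)[OF that] unfolding multipliers_def by (auto simp: adj_adj)
  show "X \<in> multipliers" if X: "X \<in> bounded_ops G G" and lim: "norm_limit G G multipliers X" for X
  proof -
    have sub: "multipliers \<subseteq> bounded_ops G G" using multipliersD(1) by blast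
    have "(X \<circ>\<^bsub>K\<^esub> T) \<in> corners \<and> (adj G G X \<circ>\<^bsub>K\<^esub> T) \<in> corners" if T: "T \<in> corners" for T
    proof
      note Tb = cornersD(1)[OF T]
      have "norm_limit K G ((\<lambda>S. S \<circ>\<^bsub>K\<^esub> T) ` multipliers) (X \<circ>\<^bsub>K\<^esub> T)"
        by (rule norm_limit_comp_right[OF _ Tb lim]) simp
      hence "norm_limit K G corners (X \<circ>\<^bsub>K\<^esub> T)"
        by (rule norm_limit_mono) (use T multipliersD(2) in auto)
      thus "(X \<circ>\<^bsub>K\<^esub> T) \<in> corners" using X Tb by (intro corners_closed) auto
      have "norm_limit K G ((\<lambda>S. S \<circ>\<^bsub>K\<^esub> T) ` adj G G ` multipliers) (adj G G X \<circ>\<^bsub>K\<^esub> T)"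
        by (rule norm_limit_comp_right[OF _ Tb norm_limit_adj[OF G sub X lim]]) simp
      hence "norm_limit K G corners (adj G G X \<circ>\<^bsub>K\<^esub> T)"
        by (rule norm_limit_mono) (use T multipliersD(3) in auto)
      thus "(adj G G X \<circ>\<^bsub>K\<^esub> T) \<in> corners" using X Tb by (intro corners_closed) auto
    qed
    thus ?thesis using X by (simp add: multipliers_def)
  qed
qed simp

definition endo :: "'w op \<Rightarrow> 'w op" where
  "endo X = (adj G G U \<circ>\<^bsub>G\<^esub> (X \<circ>\<^bsub>G\<^esub> U))"

lemma endo_in [simp]: "X \<in> bounded_ops G G \<Longrightarrow> endo X \<in> bounded_ops G G"
  by (simp add: endo_def)

lemma endo_id: "endo (op_id G) = op_id G"
  using U by (simp add: endo_def op_id_comp[of _ G G] unitary_def)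

lemma endo_add: "\<lbrakk>X \<in> bounded_ops G G; Y \<in> bounded_ops G G\<rbrakk> \<Longrightarrow> endo (op_add G G X Y) = op_add G G (endo X) (endo Y)"
  by (simp add: endo_def op_comp_add_left[of _ G G] op_comp_add_right[of _ G G])

lemma endo_scl: "X \<in> bounded_ops G G \<Longrightarrow> endo (op_scl G G c X) = op_scl G G c (endo X)"
  by (simp add: endo_def op_comp_scl_left[of _ G G] op_comp_scl_right[of _ G G])

lemma endo_comp:
  assumes "X \<in> bounded_ops G G" "Y \<in> bounded_ops G G" shows "endo (X \<circ>\<^bsub>G\<^esub> Y) = (endo X \<circ>\<^bsub>G\<^esub> endo Y)"
  by (rule op_eqI[of _ G G]) (use assms in \<open>auto simp: endo_def bounded_ops_mem[of _ G G]\<close>)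

lemma endo_adj: "X \<in> bounded_ops G G \<Longrightarrow> endo (adj G G X) = adj G G (endo X)"
  by (simp add: endo_def adj_comp[of G G G] adj_adj op_comp_assoc[of _ G G])

lemma endo_norm_limit:
  assumes "A \<subseteq> bounded_ops G G" "X \<in> bounded_ops G G" "norm_limit G G A X"
  shows "norm_limit G G (endo ` A) (endo X)"
proof -
  have "norm_limit G G ((\<lambda>S. S \<circ>\<^bsub>G\<^esub> U) ` A) (X \<circ>\<^bsub>G\<^esub> U)"
    by (rule norm_limit_comp_right[OF _ _ assms(3)]) auto
  hence "norm_limit G G ((\<lambda>S. adj G G U \<circ>\<^bsub>G\<^esub> S) ` (\<lambda>S. S \<circ>\<^bsub>G\<^esub> U) ` A) (adj G G U \<circ>\<^bsub>G\<^esub> (X \<circ>\<^bsub>G\<^esub> U))"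
    by (rule norm_limit_comp_left[rotated 5]) (use assms in auto)
  thus ?thesis by (simp add: endo_def image_image)
qed

lemma endo_pow:
  shows endo_pow_in: "X \<in> bounded_ops G G \<Longrightarrow> (endo ^^ n) X \<in> bounded_ops G G"
    and endo_pow_id: "(endo ^^ n) (op_id G) = op_id G"
    and endo_pow_add: "\<lbrakk>X \<in> bounded_ops G G; Y \<in> bounded_ops G G\<rbrakk>
      \<Longrightarrow> (endo ^^ n) (op_add G G X Y) = op_add G G ((endo ^^ n) X) ((endo ^^ n) Y)"
    and endo_pow_scl: "X \<in> bounded_ops G G \<Longrightarrow> (endo ^^ n) (op_scl G G c X) = op_scl G G c ((endo ^^ n) X)"
    and endo_pow_comp: "\<lbrakk>X \<in> bounded_ops G G; Y \<in> bounded_ops G G\<rbrakk>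
      \<Longrightarrow> (endo ^^ n) (X \<circ>\<^bsub>G\<^esub> Y) = ((endo ^^ n) X \<circ>\<^bsub>G\<^esub> (endo ^^ n) Y)"
    and endo_pow_adj: "X \<in> bounded_ops G G \<Longrightarrow> (endo ^^ n) (adj G G X) = adj G G ((endo ^^ n) X)"
proof -
  show m: "X \<in> bounded_ops G G \<Longrightarrow> (endo ^^ n) X \<in> bounded_ops G G" for X n
    by (induction n) auto
  show "(endo ^^ n) (op_id G) = op_id G" by (induction n) (auto simp: endo_id)
  show "\<lbrakk>X \<in> bounded_ops G G; Y \<in> bounded_ops G G\<rbrakk>
      \<Longrightarrow> (endo ^^ n) (op_add G G X Y) = op_add G G ((endo ^^ n) X) ((endo ^^ n) Y)"
    by (induction n) (auto simp: endo_add m)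
  show "X \<in> bounded_ops G G \<Longrightarrow> (endo ^^ n) (op_scl G G c X) = op_scl G G c ((endo ^^ n) X)"
    by (induction n) (auto simp: endo_scl m)
  show "\<lbrakk>X \<in> bounded_ops G G; Y \<in> bounded_ops G G\<rbrakk>
      \<Longrightarrow> (endo ^^ n) (X \<circ>\<^bsub>G\<^esub> Y) = ((endo ^^ n) X \<circ>\<^bsub>G\<^esub> (endo ^^ n) Y)"
    by (induction n) (auto simp: endo_comp m)
  show "X \<in> bounded_ops G G \<Longrightarrow> (endo ^^ n) (adj G G X) = adj G G ((endo ^^ n) X)"
    by (induction n) (auto simp: endo_adj m)
qed

lemma endo_pow_norm_limit:
  assumes "A \<subseteq> bounded_ops G G" "X \<in> bounded_ops G G" "norm_limit G G A X"
  shows "norm_limit G G ((endo ^^ n) ` A) ((endo ^^ n) X)"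
proof (induction n)
  case (Suc n)
  have "norm_limit G G (endo ` (endo ^^ n) ` A) (endo ((endo ^^ n) X))"
    using assms(1,2) Suc by (intro endo_norm_limit) (auto intro: endo_pow_in)
  thus ?case by (simp add: image_image)
qed (use assms in simp)

definition dilation_algebra :: "'w op set" where
  "dilation_algebra = {X \<in> bounded_ops G G. \<forall>n. (endo ^^ n) X \<in> multipliers}"

lemma dilation_algebraD: "X \<in> dilation_algebra \<Longrightarrow> X \<in> bounded_ops G G"
  by (simp add: dilation_algebra_def)

theorem unital_cstar_algebra_dilation_algebra: "unital_cstar_algebra G dilation_algebra"
proof (rule unital_cstar_algebraI)
  note M = unital_cstar_algebraD[OF unital_cstar_algebra_multipliers]
  show sub: "dilation_algebra \<subseteq> bounded_ops G G" using dilation_algebraD by blast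
  show "op_id G \<in> dilation_algebra" by (simp add: dilation_algebra_def endo_pow_id M(2))
  show "op_add G G X Y \<in> dilation_algebra" if "X \<in> dilation_algebra" "Y \<in> dilation_algebra" for X Y
    using that M(3) by (simp add: dilation_algebra_def op_add_in endo_pow_add)
  show "op_scl G G c X \<in> dilation_algebra" if "X \<in> dilation_algebra" for X c
    using that M(4) by (simp add: dilation_algebra_def op_scl_in endo_pow_scl)
  show "(X \<circ>\<^bsub>G\<^esub> Y) \<in> dilation_algebra" if "X \<in> dilation_algebra" "Y \<in> dilation_algebra" for X Y
    using that M(5) by (simp add: dilation_algebra_def endo_pow_comp)
  show "adj G G X \<in> dilation_algebra" if "X \<in> dilation_algebra" for X
    using that M(6) by (simp add: dilation_algebra_def endo_pow_adj)
  show "X \<in> dilation_algebra" if X: "X \<in> bounded_ops G G" and lim: "norm_limit G G dilation_algebra X" for X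
  proof -
    have "(endo ^^ n) X \<in> multipliers" for n
    proof (rule M(7))
      show "norm_limit G G multipliers ((endo ^^ n) X)"
        by (rule norm_limit_mono[OF endo_pow_norm_limit[OF sub X lim]]) (auto simp: dilation_algebra_def)
    qed (use X in \<open>auto intro: endo_pow_in\<close>)
    thus ?thesis using X by (simp add: dilation_algebra_def)
  qed
qed simp

lemma endo_dilation_algebra: "X \<in> dilation_algebra \<Longrightarrow> endo X \<in> dilation_algebra"
proof -
  assume X: "X \<in> dilation_algebra"
  have "(endo ^^ n) (endo X) = (endo ^^ Suc n) X" for n by (simp add: funpow_swap1)
  moreover have "(endo ^^ Suc n) X \<in> multipliers" for n using X unfolding dilation_algebra_def by blast
  ultimately show "endo X \<in> dilation_algebra" using dilation_algebraD[OF X] unfolding dilation_algebra_def by simp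
qed

lemma star_hom_endo: "star_hom G dilation_algebra G dilation_algebra endo"
  using dilation_algebraD
  by (auto simp: star_hom_def endo_dilation_algebra endo_add endo_scl endo_comp endo_adj)

lemma endo_pow_corner:
  assumes r: "r \<in> bounded_ops K K"
  shows "(endo ^^ n) (Z \<circ>\<^bsub>G\<^esub> (r \<circ>\<^bsub>G\<^esub> adj K G Z)) = (lift n \<circ>\<^bsub>G\<^esub> (r \<circ>\<^bsub>G\<^esub> adj K G (lift n)))"
proof (induction n)
  case (Suc n)
  have "adj K G (lift (Suc n)) = (adj K G (lift n) \<circ>\<^bsub>G\<^esub> U)"
    using adj_comp[of K G G "lift n" "adj G G U"] by (simp add: adj_adj)
  thus ?case using Suc r
    by (simp add: endo_def op_comp_assoc[of _ G G] op_comp_assoc[of _ G K])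
qed simp

theorem corner_in_dilation_algebra:
  assumes r: "r \<in> R"
  shows "(Z \<circ>\<^bsub>G\<^esub> (r \<circ>\<^bsub>G\<^esub> adj K G Z)) \<in> dilation_algebra"
proof -
  have rb: "r \<in> bounded_ops K K" by (rule R_in[OF r])
  have "(lift n \<circ>\<^bsub>G\<^esub> (r \<circ>\<^bsub>G\<^esub> adj K G (lift n))) \<in> multipliers" for n
  proof -
    have "adj G G (lift n \<circ>\<^bsub>G\<^esub> (r \<circ>\<^bsub>G\<^esub> adj K G (lift n))) = (lift n \<circ>\<^bsub>G\<^esub> (adj K K r \<circ>\<^bsub>G\<^esub> adj K G (lift n)))"
      using rb adj_comp[of G K G "r \<circ>\<^bsub>G\<^esub> adj K G (lift n)" "lift n"] adj_comp[of G K K "adj K G (lift n)" r]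
      by (simp add: adj_adj op_comp_assoc[of _ G K])
    thus ?thesis unfolding multipliers_def
      using lift_R_corners[OF r] lift_R_corners[OF unital_cstar_algebraD(6)[OF R r]] rb by simp
  qed
  thus ?thesis using rb endo_pow_corner[OF rb] by (simp add: dilation_algebra_def)
qed

text \<open>A multiplier maps \<open>Z\<close> into \<open>corners\<close>, and \<open>Z\<close> itself is one of the operators \<open>l\<close>.\<close>

theorem compression_in_R:
  assumes X: "X \<in> dilation_algebra"
  shows "(adj K G Z \<circ>\<^bsub>K\<^esub> (X \<circ>\<^bsub>K\<^esub> Z)) \<in> R"
proof -
  have "(endo ^^ 0) X \<in> multipliers" using X unfolding dilation_algebra_def by blast
  hence "(X \<circ>\<^bsub>K\<^esub> Z) \<in> corners" using Z_corners multipliersD(2) by simp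
  from cornersD(2)[OF this, of "op_id K" 0]
  have "(op_id K \<circ>\<^bsub>K\<^esub> (adj K G Z \<circ>\<^bsub>K\<^esub> (X \<circ>\<^bsub>K\<^esub> Z))) \<in> R"
    by (simp add: unital_cstar_algebraD(2)[OF R] adj_id)
  thus ?thesis using dilation_algebraD[OF X] by (simp add: op_id_comp[of _ K K])
qed

lemma adj_intertwine: "(adj K G Z \<circ>\<^bsub>G\<^esub> adj G G U) = (adj K K V \<circ>\<^bsub>G\<^esub> adj K G Z)"
proof -
  have "(U \<circ>\<^bsub>K\<^esub> Z) = (Z \<circ>\<^bsub>K\<^esub> V)"
    by (rule op_eqI[of _ K G]) (simp_all add: intertwine)
  thus ?thesis using adj_comp[OF K G ips(2) Z_in U_in] adj_comp[OF K K ips(2) V_in Z_in] by simp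
qed

lemma compression_intertwine:
  assumes X: "X \<in> bounded_ops G G"
  shows "(adj K G Z \<circ>\<^bsub>K\<^esub> (adj G G U \<circ>\<^bsub>K\<^esub> (X \<circ>\<^bsub>K\<^esub> (U \<circ>\<^bsub>K\<^esub> Z)))) =
    (adj K K V \<circ>\<^bsub>K\<^esub> (adj K G Z \<circ>\<^bsub>K\<^esub> (X \<circ>\<^bsub>K\<^esub> (Z \<circ>\<^bsub>K\<^esub> V))))"
proof (rule op_eqI[of _ K K])
  fix x assume x: "x \<in> pts K"
  have m: "V x \<in> pts K" "Z x \<in> pts G" "Z (V x) \<in> pts G" "X (Z (V x)) \<in> pts G"
    using x X by (auto simp: bounded_ops_mem[OF V_in] bounded_ops_mem[OF Z_in] bounded_ops_mem[of X G G])
  have "adj K G Z (adj G G U (X (Z (V x)))) = adj K K V (adj K G Z (X (Z (V x))))"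
    using fun_cong[OF adj_intertwine, of "X (Z (V x))"] m by simp
  thus "(adj K G Z \<circ>\<^bsub>K\<^esub> (adj G G U \<circ>\<^bsub>K\<^esub> (X \<circ>\<^bsub>K\<^esub> (U \<circ>\<^bsub>K\<^esub> Z)))) x =
    (adj K K V \<circ>\<^bsub>K\<^esub> (adj K G Z \<circ>\<^bsub>K\<^esub> (X \<circ>\<^bsub>K\<^esub> (Z \<circ>\<^bsub>K\<^esub> V)))) x"
    using x m by (simp add: intertwine)
qed (use X in simp_all)

lemma compression_endo:
  assumes X: "X \<in> bounded_ops G G"
  shows "(adj K G Z \<circ>\<^bsub>K\<^esub> (endo X \<circ>\<^bsub>K\<^esub> Z)) = (adj K K V \<circ>\<^bsub>K\<^esub> ((adj K G Z \<circ>\<^bsub>K\<^esub> (X \<circ>\<^bsub>K\<^esub> Z)) \<circ>\<^bsub>K\<^esub> V))"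
  using compression_intertwine[OF X] X
  by (simp add: endo_def op_comp_assoc[of _ K G] op_comp_assoc[of _ K K])

lemma compression_corner:
  assumes r: "r \<in> bounded_ops K K"
  shows "(adj K G Z \<circ>\<^bsub>K\<^esub> ((Z \<circ>\<^bsub>G\<^esub> (r \<circ>\<^bsub>G\<^esub> adj K G Z)) \<circ>\<^bsub>K\<^esub> Z)) = r"
proof (rule op_eqI[of _ K K])
  fix x assume x: "x \<in> pts K"
  have "adj K G Z (Z y) = y" if "y \<in> pts K" for y using adj_lift_lift[OF that, of 0] by simp
  thus "(adj K G Z \<circ>\<^bsub>K\<^esub> ((Z \<circ>\<^bsub>G\<^esub> (r \<circ>\<^bsub>G\<^esub> adj K G Z)) \<circ>\<^bsub>K\<^esub> Z)) x = r x"
    using x r by (simp add: bounded_ops_mem[OF Z_in] bounded_ops_mem[OF r])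
qed (use r in simp_all)

end

section \<open>Completion\<close>

text \<open>In the presence of an inner product that separates points, the vector space laws are
  consequences of the sesquilinearity of the inner product.\<close>

lemma inner_product_spaceI:
  assumes "semi_inner_product_space H"
    and sep: "\<And>x y. \<lbrakk>x \<in> pts H; y \<in> pts H; \<And>z. z \<in> pts H \<Longrightarrow> ip H z x = ip H z y\<rbrakk> \<Longrightarrow> x = y"
  shows "inner_product_space H"
proof -
  interpret semi_inner_product_space H by fact
  show ?thesis
  proof
    show "ip H y x = cnj (ip H x y)" if "x \<in> pts H" "y \<in> pts H" for x y
      using that by (rule ip_cnj)
    show "x = zero H" if x: "x \<in> pts H" and "ip H x x = 0" for x
    proof (rule sep)
      have "hnorm H x = 0" using that by (simp add: hnorm_def)
      thus "ip H z x = ip H z (zero H)" if "z \<in> pts H" for z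
        using that x by (simp add: ip_zero ip_zero_of_hnorm)
    qed (use x in_simps in auto)
  qed (auto intro!: sep simp: in_simps ip_simps ip_pos algebra_simps)
qed

context semi_inner_product_space
begin

lemma cauchy_seqs_in: "s \<in> cauchy_seqs S \<Longrightarrow> s n \<in> pts S"
  by (simp add: cauchy_seqs_def)

lemma cauchy_seqsI:
  assumes "\<And>n. s n \<in> pts S" "\<And>e. e > 0 \<Longrightarrow> \<exists>N. \<forall>m\<ge>N. \<forall>n\<ge>N. hnorm S (diff S (s m) (s n)) < e"
  shows "s \<in> cauchy_seqs S"
  using assms by (simp add: cauchy_seqs_def)

lemma cauchy_seqsD:
  assumes "s \<in> cauchy_seqs S" "e > 0"
  obtains N where "\<And>m n. \<lbrakk>m \<ge> N; n \<ge> N\<rbrakk> \<Longrightarrow> hnorm S (diff S (s m) (s n)) < e"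
  using assms unfolding cauchy_seqs_def by blast

lemma cauchy_const: "a \<in> pts S \<Longrightarrow> (\<lambda>_. a) \<in> cauchy_seqs S"
  by (rule cauchy_seqsI) (simp_all add: hnorm_diff_self)

lemma hnorm_diff_add:
  assumes "a \<in> pts S" "b \<in> pts S" "a' \<in> pts S" "b' \<in> pts S"
  shows "hnorm S (diff S (add S a b) (add S a' b')) \<le> hnorm S (diff S a a') + hnorm S (diff S b b')"
proof -
  have "hnorm S (diff S (add S a b) (add S a' b')) = hnorm S (add S (diff S a a') (diff S b b'))"
    by (rule hnorm_eq_of_ip) (use assms in \<open>simp_all add: in_simps ip_simps\<close>)
  thus ?thesis using hnorm_triangle[of "diff S a a'" "diff S b b'"] assms by (simp add: in_simps)
qed

lemma hnorm_diff_scl: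
  assumes "a \<in> pts S" "b \<in> pts S"
  shows "hnorm S (diff S (scl S c a) (scl S c b)) = cmod c * hnorm S (diff S a b)"
proof -
  have "hnorm S (diff S (scl S c a) (scl S c b)) = hnorm S (scl S c (diff S a b))"
    by (rule hnorm_eq_of_ip) (use assms in \<open>simp_all add: in_simps ip_simps algebra_simps\<close>)
  thus ?thesis using assms by (simp add: in_simps hnorm_scl)
qed

lemma cauchy_add:
  assumes s: "s \<in> cauchy_seqs S" and t: "t \<in> cauchy_seqs S"
  shows "(\<lambda>n. add S (s n) (t n)) \<in> cauchy_seqs S"
proof (rule cauchy_seqsI)
  note m = cauchy_seqs_in[OF s] cauchy_seqs_in[OF t]
  show "add S (s n) (t n) \<in> pts S" for n using m by (simp add: in_simps)
  fix e :: real assume e: "e > 0"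
  obtain M where M: "\<And>m n. \<lbrakk>m \<ge> M; n \<ge> M\<rbrakk> \<Longrightarrow> hnorm S (diff S (s m) (s n)) < e / 2"
    using cauchy_seqsD[OF s half_gt_zero[OF e]] by blast
  obtain N where N: "\<And>m n. \<lbrakk>m \<ge> N; n \<ge> N\<rbrakk> \<Longrightarrow> hnorm S (diff S (t m) (t n)) < e / 2"
    using cauchy_seqsD[OF t half_gt_zero[OF e]] by blast
  have "hnorm S (diff S (add S (s m) (t m)) (add S (s n) (t n))) < e" if "m \<ge> max M N" "n \<ge> max M N" for m n
    using M[of m n] N[of m n] that hnorm_diff_add[of "s m" "t m" "s n" "t n"] m by simp
  thus "\<exists>N. \<forall>m\<ge>N. \<forall>n\<ge>N. hnorm S (diff S (add S (s m) (t m)) (add S (s n) (t n))) < e" by blast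
qed

lemma cauchy_scl:
  assumes s: "s \<in> cauchy_seqs S"
  shows "(\<lambda>n. scl S c (s n)) \<in> cauchy_seqs S"
proof (rule cauchy_seqsI)
  note m = cauchy_seqs_in[OF s]
  show "scl S c (s n) \<in> pts S" for n using m by (simp add: in_simps)
  fix e :: real assume e: "e > 0"
  have c: "cmod c + 1 > 0" by (simp add: add_nonneg_pos)
  hence "e / (cmod c + 1) > 0" using e by simp
  then obtain N where N: "\<And>m n. \<lbrakk>m \<ge> N; n \<ge> N\<rbrakk> \<Longrightarrow> hnorm S (diff S (s m) (s n)) < e / (cmod c + 1)"
    using cauchy_seqsD[OF s] by blast
  have "hnorm S (diff S (scl S c (s m)) (scl S c (s n))) < e" if "m \<ge> N" "n \<ge> N" for m n
  proof -
    have "hnorm S (diff S (scl S c (s m)) (scl S c (s n))) = cmod c * hnorm S (diff S (s m) (s n))"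
      using m by (simp add: hnorm_diff_scl)
    also have "\<dots> \<le> (cmod c + 1) * hnorm S (diff S (s m) (s n))"
      using m by (intro mult_right_mono) (simp_all add: in_simps)
    also have "\<dots> < e" using N[OF that] c by (simp add: field_simps)
    finally show ?thesis .
  qed
  thus "\<exists>N. \<forall>m\<ge>N. \<forall>n\<ge>N. hnorm S (diff S (scl S c (s m)) (scl S c (s n))) < e" by blast
qed

text \<open>The relation by which \<open>cauchy_rep\<close> selects representatives.\<close>

definition null_close :: "(nat \<Rightarrow> 'v) \<Rightarrow> (nat \<Rightarrow> 'v) \<Rightarrow> bool" where
  "null_close s t \<longleftrightarrow> (\<lambda>n. hnorm S (diff S (s n) (t n))) \<longlonglongrightarrow> 0"

lemma null_close_refl: "s \<in> cauchy_seqs S \<Longrightarrow> null_close s s"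
  by (simp add: null_close_def cauchy_seqs_in hnorm_diff_self)

lemma null_close_sym:
  assumes "s \<in> cauchy_seqs S" "t \<in> cauchy_seqs S" "null_close s t" shows "null_close t s"
  using assms unfolding null_close_def
  by (subst hnorm_diff_commute) (auto simp: cauchy_seqs_in)

lemma null_close_trans:
  assumes "s \<in> cauchy_seqs S" "t \<in> cauchy_seqs S" "u \<in> cauchy_seqs S" "null_close s t" "null_close t u"
  shows "null_close s u"
proof -
  have lim: "(\<lambda>n. hnorm S (diff S (s n) (t n)) + hnorm S (diff S (t n) (u n))) \<longlonglongrightarrow> 0"
    using tendsto_add[OF assms(4,5)[unfolded null_close_def]] by simp
  have bd: "norm (hnorm S (diff S (s n) (u n))) \<le> hnorm S (diff S (s n) (t n)) + hnorm S (diff S (t n) (u n))" for n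
    using hnorm_diff_triangle[of "s n" "t n" "u n"] assms(1-3) by (simp add: cauchy_seqs_in in_simps)
  show ?thesis unfolding null_close_def
    using always_eventually[OF allI[OF bd]] lim by (rule Lim_null_comparison)
qed

lemma cauchy_rep:
  assumes "s \<in> cauchy_seqs S"
  shows cauchy_rep_in: "cauchy_rep S s \<in> cauchy_seqs S" and cauchy_rep_close: "null_close s (cauchy_rep S s)"
proof -
  have "s \<in> cauchy_seqs S \<and> (\<lambda>n. hnorm S (diff S (s n) (s n))) \<longlonglongrightarrow> 0"
    using assms null_close_refl by (simp add: null_close_def)
  from someI[of "\<lambda>t. t \<in> cauchy_seqs S \<and> (\<lambda>n. hnorm S (diff S (s n) (t n))) \<longlonglongrightarrow> 0", OF this]
  show "cauchy_rep S s \<in> cauchy_seqs S" "null_close s (cauchy_rep S s)"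
    unfolding cauchy_rep_def null_close_def by blast+
qed

lemma cauchy_rep_eq:
  assumes "s \<in> cauchy_seqs S" "t \<in> cauchy_seqs S" "null_close s t"
  shows "cauchy_rep S s = cauchy_rep S t"
proof -
  have "(u \<in> cauchy_seqs S \<and> null_close s u) = (u \<in> cauchy_seqs S \<and> null_close t u)" for u
    using null_close_trans[OF assms(1,2) _ assms(3)] null_close_trans[OF assms(2,1) _ null_close_sym[OF assms]]
    by blast
  hence "(\<lambda>u. u \<in> cauchy_seqs S \<and> null_close s u) = (\<lambda>u. u \<in> cauchy_seqs S \<and> null_close t u)" by (rule ext)
  thus ?thesis unfolding cauchy_rep_def null_close_def by (rule arg_cong)
qed

lemma hnorm_convergent:
  assumes s: "s \<in> cauchy_seqs S" shows "convergent (\<lambda>n. hnorm S (s n))"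
proof (rule real_Cauchy_convergent, rule CauchyI)
  note m = cauchy_seqs_in[OF s]
  fix e :: real assume "e > 0"
  then obtain N where N: "\<And>m n. \<lbrakk>m \<ge> N; n \<ge> N\<rbrakk> \<Longrightarrow> hnorm S (diff S (s m) (s n)) < e"
    using cauchy_seqsD[OF s] by blast
  have "norm (hnorm S (s m) - hnorm S (s n)) < e" if "m \<ge> N" "n \<ge> N" for m n
    using N[of m n] N[of n m] that hnorm_triangle_diff[OF m m, of m n] hnorm_triangle_diff[OF m m, of n m] by simp
  thus "\<exists>M. \<forall>m\<ge>M. \<forall>n\<ge>M. norm (hnorm S (s m) - hnorm S (s n)) < e" by blast
qed

lemma hnorm_bounded:
  assumes "s \<in> cauchy_seqs S" obtains B where "B > 0" "\<And>n. hnorm S (s n) \<le> B"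
proof -
  obtain B where "B > 0" "\<forall>n. norm (hnorm S (s n)) \<le> B"
    using convergent_imp_Bseq[OF hnorm_convergent[OF assms]] unfolding Bseq_def by blast
  hence "hnorm S (s n) \<le> B" for n by (simp add: abs_le_iff)
  thus thesis using that[of B] \<open>B > 0\<close> by blast
qed

lemma ip_convergent:
  assumes s: "s \<in> cauchy_seqs S" and t: "t \<in> cauchy_seqs S"
  shows "(\<lambda>n. ip S (s n) (t n)) \<longlonglongrightarrow> lim (\<lambda>n. ip S (s n) (t n))"
proof -
  note m = cauchy_seqs_in[OF s] cauchy_seqs_in[OF t]
  obtain B where B: "B > 0" "\<And>n. hnorm S (s n) \<le> B" using hnorm_bounded[OF s] by blast
  obtain C where C: "C > 0" "\<And>n. hnorm S (t n) \<le> C" using hnorm_bounded[OF t] by blast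
  have "Cauchy (\<lambda>n. ip S (s n) (t n))"
  proof (rule CauchyI)
    fix e :: real assume e: "e > 0"
    have "e / (2 * C) > 0" "e / (2 * B) > 0" using e B C by simp_all
    note pos = this
    obtain M where M: "\<And>m n. \<lbrakk>m \<ge> M; n \<ge> M\<rbrakk> \<Longrightarrow> hnorm S (diff S (s m) (s n)) < e / (2 * C)"
      using cauchy_seqsD[OF s pos(1)] by blast
    obtain N where N: "\<And>m n. \<lbrakk>m \<ge> N; n \<ge> N\<rbrakk> \<Longrightarrow> hnorm S (diff S (t m) (t n)) < e / (2 * B)"
      using cauchy_seqsD[OF t pos(2)] by blast
    have "norm (ip S (s i) (t i) - ip S (s j) (t j)) < e" if "i \<ge> max M N" "j \<ge> max M N" for i j
    proof -
      have "norm (ip S (s i) (t i) - ip S (s j) (t j)) \<le>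
          hnorm S (diff S (s i) (s j)) * hnorm S (t i) + hnorm S (s j) * hnorm S (diff S (t i) (t j))"
        using m by (intro ip_diff_bound) auto
      also have "\<dots> \<le> hnorm S (diff S (s i) (s j)) * C + B * hnorm S (diff S (t i) (t j))"
        using m B C by (intro add_mono mult_mono) (auto simp: in_simps less_imp_le)
      also have "\<dots> < e / (2 * C) * C + B * (e / (2 * B))"
        using M[of i j] N[of i j] that B C by (intro add_strict_mono mult_strict_right_mono mult_strict_left_mono) auto
      also have "\<dots> = e" using B C by simp
      finally show ?thesis .
    qed
    thus "\<exists>M. \<forall>m\<ge>M. \<forall>n\<ge>M. norm (ip S (s m) (t m) - ip S (s n) (t n)) < e" by blast
  qed
  thus ?thesis by (simp add: Cauchy_convergent_iff convergent_LIMSEQ_iff)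
qed

lemma lim_ip_cong:
  assumes s: "s \<in> cauchy_seqs S" and s': "s' \<in> cauchy_seqs S" and ss: "null_close s s'"
    and t: "t \<in> cauchy_seqs S" and t': "t' \<in> cauchy_seqs S" and tt: "null_close t t'"
  shows "lim (\<lambda>n. ip S (s n) (t n)) = lim (\<lambda>n. ip S (s' n) (t' n))"
proof -
  note m = cauchy_seqs_in[OF s] cauchy_seqs_in[OF t] cauchy_seqs_in[OF s'] cauchy_seqs_in[OF t']
  let ?g = "\<lambda>n. hnorm S (diff S (s n) (s' n)) * hnorm S (t n) + hnorm S (s' n) * hnorm S (diff S (t n) (t' n))"
  obtain a where a: "(\<lambda>n. hnorm S (t n)) \<longlonglongrightarrow> a" using hnorm_convergent[OF t] by (auto simp: convergent_def)
  obtain b where b: "(\<lambda>n. hnorm S (s' n)) \<longlonglongrightarrow> b" using hnorm_convergent[OF s'] by (auto simp: convergent_def)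
  have "?g \<longlonglongrightarrow> 0 * a + b * 0"
    using a b ss tt unfolding null_close_def by (intro tendsto_intros)
  hence g: "?g \<longlonglongrightarrow> 0" by simp
  have bd: "cmod (ip S (s n) (t n) - ip S (s' n) (t' n)) \<le> ?g n" for n
    using m by (intro ip_diff_bound) auto
  have "(\<lambda>n. ip S (s n) (t n) - ip S (s' n) (t' n)) \<longlonglongrightarrow> 0"
    using always_eventually[OF allI[OF bd]] g by (rule Lim_null_comparison)
  moreover have "(\<lambda>n. ip S (s n) (t n) - ip S (s' n) (t' n)) \<longlonglongrightarrow>
      lim (\<lambda>n. ip S (s n) (t n)) - lim (\<lambda>n. ip S (s' n) (t' n))"
    by (rule tendsto_diff[OF ip_convergent[OF s t] ip_convergent[OF s' t']])
  ultimately show ?thesis using LIMSEQ_unique by force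
qed

lemma completion_ip_rep:
  assumes "s \<in> cauchy_seqs S" "t \<in> cauchy_seqs S"
  shows "ip (completion S) (cauchy_rep S s) (cauchy_rep S t) = lim (\<lambda>n. ip S (s n) (t n))"
proof -
  have "lim (\<lambda>n. ip S (s n) (t n)) = lim (\<lambda>n. ip S (cauchy_rep S s n) (cauchy_rep S t n))"
    by (rule lim_ip_cong) (use assms in \<open>auto intro: cauchy_rep_in cauchy_rep_close\<close>)
  thus ?thesis by (simp add: completion_def)
qed

lemma completion_pts: "x \<in> pts (completion S) \<longleftrightarrow> x \<in> cauchy_seqs S \<and> cauchy_rep S x = x"
proof
  assume "x \<in> pts (completion S)"
  then obtain s where s: "s \<in> cauchy_seqs S" "x = cauchy_rep S s" by (auto simp: completion_def)
  have "cauchy_rep S (cauchy_rep S s) = cauchy_rep S s"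
    by (rule cauchy_rep_eq[symmetric, OF s(1) cauchy_rep_in cauchy_rep_close]) (fact s)+
  thus "x \<in> cauchy_seqs S \<and> cauchy_rep S x = x" using cauchy_rep_in[OF s(1)] s(2) by simp
next
  assume x: "x \<in> cauchy_seqs S \<and> cauchy_rep S x = x"
  hence "cauchy_rep S x \<in> cauchy_rep S ` cauchy_seqs S" by blast
  hence "cauchy_rep S x \<in> pts (completion S)" by (simp add: completion_def)
  thus "x \<in> pts (completion S)" using x by simp
qed

lemma rep_in_completion: "s \<in> cauchy_seqs S \<Longrightarrow> cauchy_rep S s \<in> pts (completion S)"
  by (simp add: completion_def)

lemma completion_ip_rep_right:
  assumes "x \<in> pts (completion S)" "t \<in> cauchy_seqs S"
  shows "(\<lambda>n. ip S (x n) (t n)) \<longlonglongrightarrow> ip (completion S) x (cauchy_rep S t)"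
  using completion_ip_rep[of x t] assms ip_convergent[of x t] by (simp add: completion_pts)

lemma completion_ip:
  assumes "x \<in> pts (completion S)" "y \<in> pts (completion S)"
  shows "(\<lambda>n. ip S (x n) (y n)) \<longlonglongrightarrow> ip (completion S) x y"
  using completion_ip_rep_right[of x y] assms by (simp add: completion_pts)

lemma inner_product_space_completion: "inner_product_space (completion S)"
proof (rule inner_product_spaceI)
  let ?C = "completion S"
  have C: "x \<in> cauchy_seqs S" if "x \<in> pts ?C" for x using that by (simp add: completion_pts)
  show "semi_inner_product_space ?C"
  proof
    show "zero ?C \<in> pts ?C" using rep_in_completion[OF cauchy_const[OF zero_in]] by (simp add: completion_def)
    show "add ?C x y \<in> pts ?C" if "x \<in> pts ?C" "y \<in> pts ?C" for x y
      using rep_in_completion[OF cauchy_add[OF C C, OF that]] by (simp add: completion_def)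
    show "scl ?C c x \<in> pts ?C" if "x \<in> pts ?C" for x c
      using rep_in_completion[OF cauchy_scl[OF C, OF that]] by (simp add: completion_def)
    show "ip ?C y x = cnj (ip ?C x y)" if "x \<in> pts ?C" "y \<in> pts ?C" for x y
    proof -
      have "(\<lambda>n. ip S (y n) (x n)) = (\<lambda>n. cnj (ip S (x n) (y n)))"
        by (intro ext ip_cnj cauchy_seqs_in C that)
      hence "(\<lambda>n. ip S (y n) (x n)) \<longlonglongrightarrow> cnj (ip ?C x y)"
        using tendsto_cnj[OF completion_ip[OF that]] by simp
      thus ?thesis by (rule LIMSEQ_unique[OF completion_ip[OF that(2,1)]])
    qed
    show "ip ?C x (add ?C y z) = ip ?C x y + ip ?C x z"
      if "x \<in> pts ?C" "y \<in> pts ?C" "z \<in> pts ?C" for x y z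
    proof -
      have eq: "(\<lambda>n. ip S (x n) (add S (y n) (z n))) = (\<lambda>n. ip S (x n) (y n) + ip S (x n) (z n))"
        using C[OF that(1)] C[OF that(2)] C[OF that(3)] by (simp add: ip_add cauchy_seqs_in)
      have l: "(\<lambda>n. ip S (x n) (add S (y n) (z n))) \<longlonglongrightarrow> ip ?C x (add ?C y z)"
        using completion_ip_rep_right[OF that(1) cauchy_add[OF C[OF that(2)] C[OF that(3)]]]
        by (simp add: completion_def)
      show ?thesis
        by (rule LIMSEQ_unique[OF l], unfold eq,
            rule tendsto_add[OF completion_ip[OF that(1,2)] completion_ip[OF that(1,3)]])
    qed
    show "ip ?C x (scl ?C c y) = c * ip ?C x y" if "x \<in> pts ?C" "y \<in> pts ?C" for x y c
    proof -
      have eq: "(\<lambda>n. ip S (x n) (scl S c (y n))) = (\<lambda>n. c * ip S (x n) (y n))"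
        using C[OF that(1)] C[OF that(2)] by (simp add: ip_scl cauchy_seqs_in)
      have l: "(\<lambda>n. ip S (x n) (scl S c (y n))) \<longlonglongrightarrow> ip ?C x (scl ?C c y)"
        using completion_ip_rep_right[OF that(1) cauchy_scl[OF C[OF that(2)]]] by (simp add: completion_def)
      show ?thesis
        by (rule LIMSEQ_unique[OF l], unfold eq, rule tendsto_mult_left[OF completion_ip[OF that]])
    qed
    show "ip ?C x (zero ?C) = 0" if "x \<in> pts ?C" for x
    proof -
      have "(\<lambda>n. ip S (x n) (zero S)) = (\<lambda>n. 0)"
        using C[OF that] by (simp add: ip_zero cauchy_seqs_in)
      moreover have "(\<lambda>n. ip S (x n) (zero S)) \<longlonglongrightarrow> ip ?C x (zero ?C)"
        using completion_ip_rep_right[OF that cauchy_const[OF zero_in]] by (simp add: completion_def)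
      ultimately show ?thesis by (simp add: tendsto_const_iff)
    qed
    show "0 \<le> Re (ip ?C x x)" if "x \<in> pts ?C" for x
      by (rule LIMSEQ_le_const[OF tendsto_Re[OF completion_ip[OF that that]]])
         (use C[OF that] in \<open>auto simp: ip_pos cauchy_seqs_in\<close>)
  qed
  fix x y assume x: "x \<in> pts ?C" and y: "y \<in> pts ?C" and eq: "\<And>z. z \<in> pts ?C \<Longrightarrow> ip ?C z x = ip ?C z y"
  let ?d = "\<lambda>n. diff S (x n) (y n)"
  have d: "?d \<in> cauchy_seqs S" unfolding diff_def by (intro cauchy_add cauchy_scl C x y)
  note m = cauchy_seqs_in[OF C[OF x]] cauchy_seqs_in[OF C[OF y]] cauchy_seqs_in[OF d]
  have "(\<lambda>n. ip S (?d n) (x n)) \<longlonglongrightarrow> ip ?C (cauchy_rep S ?d) x"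
    "(\<lambda>n. ip S (?d n) (y n)) \<longlonglongrightarrow> ip ?C (cauchy_rep S ?d) y"
    using completion_ip_rep[OF d C[OF x]] ip_convergent[OF d C[OF x]]
      completion_ip_rep[OF d C[OF y]] ip_convergent[OF d C[OF y]] x y by (simp_all add: completion_pts)
  from tendsto_diff[OF this] have "(\<lambda>n. ip S (?d n) (x n) - ip S (?d n) (y n)) \<longlonglongrightarrow> 0"
    using eq[OF rep_in_completion[OF d]] by simp
  hence "(\<lambda>n. ip S (?d n) (?d n)) \<longlonglongrightarrow> 0" using m by (simp add: ip_diff)
  from tendsto_Re[OF this] have "(\<lambda>n. (hnorm S (?d n))\<^sup>2) \<longlonglongrightarrow> 0" using m by (simp add: hnorm_sq)
  hence "(\<lambda>n. sqrt ((hnorm S (?d n))\<^sup>2)) \<longlonglongrightarrow> sqrt 0" by (rule tendsto_real_sqrt)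
  hence "null_close x y" using m by (simp add: null_close_def)
  thus "x = y" using cauchy_rep_eq[OF C[OF x] C[OF y]] x y by (simp add: completion_pts)
qed

lemma completion_dist:
  assumes s: "s \<in> cauchy_seqs S" and t: "t \<in> cauchy_seqs S"
  shows "(\<lambda>n. hnorm S (diff S (s n) (t n))) \<longlonglongrightarrow>
    hnorm (completion S) (diff (completion S) (cauchy_rep S s) (cauchy_rep S t))"
proof -
  let ?C = "completion S"
  interpret C: inner_product_space ?C by (rule inner_product_space_completion)
  note m = cauchy_seqs_in[OF s] cauchy_seqs_in[OF t]
  note r = rep_in_completion[OF s] rep_in_completion[OF t]
  have l: "(\<lambda>n. ip S (u n) (v n)) \<longlonglongrightarrow> ip ?C (cauchy_rep S u) (cauchy_rep S v)"
    if "u \<in> cauchy_seqs S" "v \<in> cauchy_seqs S" for u v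
    using that ip_convergent[OF that] completion_ip_rep[OF that] by simp
  let ?s = "cauchy_rep S s" and ?t = "cauchy_rep S t"
  have "(\<lambda>n. ip S (s n) (s n) - ip S (t n) (s n) - (ip S (s n) (t n) - ip S (t n) (t n))) \<longlonglongrightarrow>
      ip ?C ?s ?s - ip ?C ?t ?s - (ip ?C ?s ?t - ip ?C ?t ?t)"
    by (intro tendsto_diff l s t)
  hence "(\<lambda>n. ip S (diff S (s n) (t n)) (diff S (s n) (t n))) \<longlonglongrightarrow> ip ?C (diff ?C ?s ?t) (diff ?C ?s ?t)"
    using m r by (simp add: ip_simps in_simps C.ip_simps C.in_simps)
  from tendsto_real_sqrt[OF tendsto_Re[OF this]] show ?thesis unfolding hnorm_def .
qed

lemma emb_in: "a \<in> pts S \<Longrightarrow> completion_emb S a \<in> pts (completion S)"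
  unfolding completion_emb_def by (intro rep_in_completion cauchy_const)

lemma emb_ip: "\<lbrakk>a \<in> pts S; b \<in> pts S\<rbrakk> \<Longrightarrow> ip (completion S) (completion_emb S a) (completion_emb S b) = ip S a b"
  unfolding completion_emb_def by (subst completion_ip_rep) (auto intro: cauchy_const)

lemma emb_dist_le:
  assumes s: "s \<in> cauchy_seqs S" and a: "a \<in> pts S" and le: "\<And>n. n \<ge> N \<Longrightarrow> hnorm S (diff S (s n) a) \<le> e"
  shows "hnorm (completion S) (diff (completion S) (cauchy_rep S s) (completion_emb S a)) \<le> e"
  unfolding completion_emb_def
  by (rule LIMSEQ_le_const2[OF completion_dist[OF s cauchy_const[OF a]]]) (use le in blast)

lemma emb_dense:
  assumes g: "g \<in> pts (completion S)" and e: "e > 0"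
  shows "\<exists>a\<in>pts S. hnorm (completion S) (diff (completion S) g (completion_emb S a)) < e"
proof -
  have gC: "g \<in> cauchy_seqs S" "cauchy_rep S g = g" using g by (simp_all add: completion_pts)
  obtain N where N: "\<And>m n. \<lbrakk>m \<ge> N; n \<ge> N\<rbrakk> \<Longrightarrow> hnorm S (diff S (g m) (g n)) < e / 2"
    using cauchy_seqsD[OF gC(1) half_gt_zero[OF e]] by blast
  have "hnorm (completion S) (diff (completion S) (cauchy_rep S g) (completion_emb S (g N))) \<le> e / 2"
    by (rule emb_dist_le[OF gC(1) cauchy_seqs_in[OF gC(1)], where N=N]) (rule less_imp_le[OF N], simp_all)
  hence "hnorm (completion S) (diff (completion S) g (completion_emb S (g N))) \<le> e / 2"
    unfolding gC(2) .
  thus ?thesis using e cauchy_seqs_in[OF gC(1)] by (intro bexI[of _ "g N"]) auto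
qed

text \<open>A Cauchy sequence \<open>X\<close> in the completion is followed up to \<open>1 / (k + 1)\<close> by embedded vectors \<open>y k\<close>;
  the sequence \<open>y\<close> itself represents the limit.\<close>

theorem hilbert_space_completion: "hilbert_space (completion S)"
proof (rule hilbert_spaceI[OF inner_product_space_completion])
  let ?C = "completion S" and ?j = "completion_emb S"
  interpret C: inner_product_space ?C by (rule inner_product_space_completion)
  fix X :: "nat \<Rightarrow> nat \<Rightarrow> 'v" assume X: "\<And>n. X n \<in> pts ?C"
    and cau: "\<And>e. e > 0 \<Longrightarrow> \<exists>N. \<forall>m\<ge>N. \<forall>n\<ge>N. hnorm ?C (diff ?C (X m) (X n)) < e"
  have "\<exists>a\<in>pts S. hnorm ?C (diff ?C (X k) (?j a)) < 1 / real (Suc k)" for k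
    by (rule emb_dense[OF X]) simp
  then obtain y where y: "\<And>k. y k \<in> pts S" and yX: "\<And>k. hnorm ?C (diff ?C (X k) (?j (y k))) < 1 / real (Suc k)"
    by metis
  have jy: "?j (y k) \<in> pts ?C" for k by (rule emb_in[OF y])
  have iso: "hnorm S (diff S (y i) (y k)) = hnorm ?C (diff ?C (?j (y i)) (?j (y k)))" for i k
    using y jy by (simp add: hnorm_def C.ip_simps C.in_simps ip_simps in_simps emb_ip)
  have small: "\<exists>N. \<forall>k\<ge>N. 1 / real (Suc k) < e" if "e > 0" for e
  proof -
    obtain N where N: "1 / real (Suc N) < e" using nat_approx_posE[OF \<open>e > 0\<close>] by blast
    have "1 / real (Suc k) < e" if "k \<ge> N" for k
    proof -
      have "1 / real (Suc k) \<le> 1 / real (Suc N)" using that by (intro divide_left_mono) auto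
      thus ?thesis using N by simp
    qed
    thus ?thesis by blast
  qed
  have yC: "y \<in> cauchy_seqs S"
  proof (rule cauchy_seqsI[OF y])
    fix e :: real assume e: "e > 0"
    have e3: "e / 3 > 0" using e by simp
    obtain M where M: "\<And>m n. \<lbrakk>m \<ge> M; n \<ge> M\<rbrakk> \<Longrightarrow> hnorm ?C (diff ?C (X m) (X n)) < e / 3"
      using cau[OF e3] by blast
    obtain N where N: "\<And>k. k \<ge> N \<Longrightarrow> 1 / real (Suc k) < e / 3" using small[OF e3] by blast
    have "hnorm S (diff S (y i) (y k)) < e" if "i \<ge> max M N" "k \<ge> max M N" for i k
    proof -
      have "hnorm ?C (diff ?C (?j (y i)) (?j (y k))) \<le> hnorm ?C (diff ?C (?j (y i)) (X i))
          + (hnorm ?C (diff ?C (X i) (X k)) + hnorm ?C (diff ?C (X k) (?j (y k))))"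
        using C.hnorm_diff_triangle[OF jy[of i] X[of i] jy[of k]] C.hnorm_diff_triangle[OF X[of i] X[of k] jy[of k]] by linarith
      thus ?thesis using M[of i k] N[of i] N[of k] yX[of i] yX[of k] C.hnorm_diff_commute[OF jy X, of i i] that
        unfolding iso by auto
    qed
    thus "\<exists>N. \<forall>m\<ge>N. \<forall>n\<ge>N. hnorm S (diff S (y m) (y n)) < e" by blast
  qed
  let ?x = "cauchy_rep S y"
  have x: "?x \<in> pts ?C" by (rule rep_in_completion[OF yC])
  have "(\<lambda>k. hnorm ?C (diff ?C (X k) ?x)) \<longlonglongrightarrow> 0"
  proof (rule LIMSEQ_I)
    fix e :: real assume e: "e > 0"
    obtain M where M: "\<And>m n. \<lbrakk>m \<ge> M; n \<ge> M\<rbrakk> \<Longrightarrow> hnorm S (diff S (y m) (y n)) < e / 2"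
      using cauchy_seqsD[OF yC half_gt_zero[OF e]] by blast
    obtain N where N: "\<And>k. k \<ge> N \<Longrightarrow> 1 / real (Suc k) < e / 2"
      using small[OF half_gt_zero[OF e]] by blast
    have "hnorm ?C (diff ?C (X k) ?x) < e" if "k \<ge> max M N" for k
    proof -
      have "hnorm ?C (diff ?C ?x (?j (y k))) \<le> e / 2"
        by (rule emb_dist_le[OF yC y, where N=M]) (rule less_imp_le[OF M], use that in simp_all)
      thus ?thesis using C.hnorm_diff_triangle[OF X jy x, of k k] yX[of k] N[of k] that
          C.hnorm_diff_commute[OF x jy, of k] by auto
    qed
    thus "\<exists>N. \<forall>n\<ge>N. norm (hnorm ?C (diff ?C (X n) ?x) - 0) < e"
      using X x by (intro exI[of _ "max M N"]) (simp add: C.in_simps)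
  qed
  thus "\<exists>x\<in>pts ?C. (\<lambda>n. hnorm ?C (diff ?C (X n) x)) \<longlonglongrightarrow> 0" using x by blast
qed

end

lemma transport_simps:
  assumes "inj f"
  shows "pts (transport f H) = f ` pts H" "zero (transport f H) = f (zero H)"
    "add (transport f H) (f x) (f y) = f (add H x y)" "scl (transport f H) c (f x) = f (scl H c x)"
    "ip (transport f H) (f x) (f y) = ip H x y" "diff (transport f H) (f x) (f y) = f (diff H x y)"
    "hnorm (transport f H) (f x) = hnorm H x"
proof -
  have i: "inv f (f x) = x" for x by (rule inv_f_f[OF assms])
  show "pts (transport f H) = f ` pts H" "zero (transport f H) = f (zero H)"
    "add (transport f H) (f x) (f y) = f (add H x y)" "scl (transport f H) c (f x) = f (scl H c x)"
    "ip (transport f H) (f x) (f y) = ip H x y" "diff (transport f H) (f x) (f y) = f (diff H x y)"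
    "hnorm (transport f H) (f x) = hnorm H x"
    unfolding diff_def hnorm_def by (simp_all add: transport_def i)
qed

lemma hilbert_space_transport:
  assumes "hilbert_space H" and f: "inj f"
  shows "hilbert_space (transport f H)"
proof (rule hilbert_spaceI)
  interpret hilbert_space H by fact
  note t = transport_simps[OF f]
  show "inner_product_space (transport f H)"
  proof (rule inner_product_spaceI)
    show "semi_inner_product_space (transport f H)"
    proof
      show "ip (transport f H) y x = cnj (ip (transport f H) x y)"
        if xy: "x \<in> pts (transport f H)" "y \<in> pts (transport f H)" for x y
      proof -
        obtain a b where ab: "x = f a" "y = f b" "a \<in> pts H" "b \<in> pts H" using xy unfolding t by blast
        show ?thesis unfolding ab t by (rule ip_cnj[OF ab(3,4)])
      qed
    qed (auto simp: t in_simps ip_simps ip_pos)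
    fix x y assume "x \<in> pts (transport f H)" "y \<in> pts (transport f H)"
      and eq: "\<And>z. z \<in> pts (transport f H) \<Longrightarrow> ip (transport f H) z x = ip (transport f H) z y"
    then obtain a b where ab: "x = f a" "y = f b" "a \<in> pts H" "b \<in> pts H" by (auto simp: t)
    have "ip H z a = ip H z b" if "z \<in> pts H" for z
      using eq[of "f z"] that unfolding ab t by blast
    hence "a = b" by (rule vec_eqI[OF ab(3,4)])
    thus "x = y" using ab by simp
  qed
  fix X :: "nat \<Rightarrow> _" assume X: "\<And>n. X n \<in> pts (transport f H)"
    and cau: "\<And>e. e > 0 \<Longrightarrow> \<exists>N. \<forall>m\<ge>N. \<forall>n\<ge>N. hnorm (transport f H) (diff (transport f H) (X m) (X n)) < e"
  have "\<forall>n. \<exists>a\<in>pts H. X n = f a" using X by (auto simp: t)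
  then obtain Y where Y: "\<And>n. Y n \<in> pts H" and XY: "X = (\<lambda>n. f (Y n))" by metis
  obtain y where "y \<in> pts H" "(\<lambda>n. hnorm H (diff H (Y n) y)) \<longlonglongrightarrow> 0"
    by (rule cauchy_convergent[of Y]) (use Y cau in \<open>auto simp: XY t\<close>)
  thus "\<exists>x\<in>pts (transport f H). (\<lambda>n. hnorm (transport f H) (diff (transport f H) (X n) x)) \<longlonglongrightarrow> 0"
    by (intro bexI[of _ "f y"]) (auto simp: XY t)
qed


section \<open>Extension of operators from a dense set\<close>

text \<open>The Stinespring spaces are only used through this interface, which hides the choice of
  representatives and the relabelling.\<close>

locale dense_embedding = semi_inner_product_space S + G: hilbert_space G
  for S :: "'s hspace" and G :: "'g hspace" +
  fixes j :: "'s \<Rightarrow> 'g"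
  assumes j_in: "a \<in> pts S \<Longrightarrow> j a \<in> pts G"
    and j_ip: "\<lbrakk>a \<in> pts S; b \<in> pts S\<rbrakk> \<Longrightarrow> ip G (j a) (j b) = ip S a b"
    and j_dense: "\<lbrakk>g \<in> pts G; e > 0\<rbrakk> \<Longrightarrow> \<exists>a\<in>pts S. hnorm G (diff G g (j a)) < e"
begin

lemma eqI_j:
  assumes "x \<in> pts G" "y \<in> pts G" "\<And>a. a \<in> pts S \<Longrightarrow> ip G (j a) x = ip G (j a) y"
  shows "x = y"
  by (rule G.vec_eqI_dense[where D="j ` pts S"]) (use assms j_in j_dense in auto)

lemma j_add: "\<lbrakk>a \<in> pts S; b \<in> pts S\<rbrakk> \<Longrightarrow> j (add S a b) = add G (j a) (j b)"
  by (rule eqI_j) (simp_all add: j_in in_simps G.in_simps ip_simps G.ip_simps j_ip)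

lemma j_scl: "a \<in> pts S \<Longrightarrow> j (scl S c a) = scl G c (j a)"
  by (rule eqI_j) (simp_all add: j_in in_simps G.in_simps ip_simps G.ip_simps j_ip)

lemma j_zero: "j (zero S) = zero G"
  by (rule eqI_j) (simp_all add: j_in in_simps G.in_simps ip_simps G.ip_simps j_ip)

lemma j_hnorm: "a \<in> pts S \<Longrightarrow> hnorm G (j a) = hnorm S a"
  by (simp add: hnorm_def j_ip)

lemma j_dist: "\<lbrakk>a \<in> pts S; b \<in> pts S\<rbrakk> \<Longrightarrow> hnorm G (diff G (j a) (j b)) = hnorm S (diff S a b)"
  by (simp add: hnorm_def j_ip j_in in_simps G.in_simps ip_simps G.ip_simps)

lemma j_approx:
  assumes "g \<in> pts G"
  obtains a where "\<And>n. a n \<in> pts S" "(\<lambda>n. hnorm G (diff G (j (a n)) g)) \<longlonglongrightarrow> 0"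
proof -
  have "\<exists>a\<in>pts S. hnorm G (diff G g (j a)) < 1 / real (Suc n)" for n by (rule j_dense[OF assms]) simp
  then obtain a where a: "\<And>n. a n \<in> pts S" "\<And>n. hnorm G (diff G g (j (a n))) < 1 / real (Suc n)" by metis
  have "(\<lambda>n. hnorm G (diff G (j (a n)) g)) \<longlonglongrightarrow> 0"
  proof (rule Lim_null_comparison)
    show "\<forall>\<^sub>F n in sequentially. norm (hnorm G (diff G (j (a n)) g)) \<le> 1 / real (Suc n)"
      using a assms G.hnorm_diff_commute[of g] by (intro always_eventually) (auto simp: j_in G.in_simps less_imp_le)
    show "(\<lambda>n. 1 / real (Suc n)) \<longlonglongrightarrow> 0" by (rule LIMSEQ_Suc[OF lim_1_over_n])
  qed
  thus thesis using that a(1) by blast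
qed

lemma op_eqI_j:
  assumes T: "T \<in> bounded_ops G M" and T': "T' \<in> bounded_ops G M" and M: "inner_product_space M"
    and eq: "\<And>a. a \<in> pts S \<Longrightarrow> T (j a) = T' (j a)"
  shows "T = T'"
proof (rule op_eqI[OF T T'])
  interpret M: inner_product_space M by fact
  fix g assume g: "g \<in> pts G"
  obtain a where a: "\<And>n. a n \<in> pts S" "(\<lambda>n. hnorm G (diff G (j (a n)) g)) \<longlonglongrightarrow> 0"
    using j_approx[OF g] by blast
  have lim: "(\<lambda>n. ip M z (R (j (a n)))) \<longlonglongrightarrow> ip M z (R g)"
    if R: "R \<in> bounded_ops G M" and z: "z \<in> pts M" for R z
  proof -
    have "(\<lambda>n. hnorm M (diff M (R (j (a n))) (R g))) \<longlonglongrightarrow> 0"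
      using a g by (intro bounded_ops_tendsto[OF R G.inner_product_space_axioms M]) (simp_all add: j_in)
    thus ?thesis using M.ip_tendsto[of "\<lambda>_. z" z "\<lambda>n. R (j (a n))" "R g"] z R g a(1)
      by (simp add: bounded_ops_mem j_in M.hnorm_diff_self)
  qed
  show "T g = T' g"
  proof (rule M.vec_eqI)
    show "ip M z (T g) = ip M z (T' g)" if z: "z \<in> pts M" for z
      using lim[OF T z] lim[OF T' z] eq[OF a(1)] LIMSEQ_unique by simp
  qed (use bounded_ops_mem[OF T g] bounded_ops_mem[OF T' g] in simp_all)
qed

text \<open>The image of \<open>g\<close> is characterised by its distances to the vectors \<open>t a\<close>, so that the construction
  does not refer to a choice of approximating sequences.\<close>

theorem extension:
  assumes "hilbert_space M" and t_in: "\<And>a. a \<in> pts S \<Longrightarrow> t a \<in> pts M"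
    and t_add: "\<And>a b. \<lbrakk>a \<in> pts S; b \<in> pts S\<rbrakk> \<Longrightarrow> t (add S a b) = add M (t a) (t b)"
    and t_scl: "\<And>c a. a \<in> pts S \<Longrightarrow> t (scl S c a) = scl M c (t a)"
    and t_bound: "\<And>a. a \<in> pts S \<Longrightarrow> hnorm M (t a) \<le> B * hnorm S a"
  obtains T where "T \<in> bounded_ops G M" "\<And>a. a \<in> pts S \<Longrightarrow> T (j a) = t a"
    "\<And>g. g \<in> pts G \<Longrightarrow> hnorm M (T g) \<le> B * hnorm G g"
proof -
  interpret M: hilbert_space M by fact
  have t_diff: "t (diff S a b) = diff M (t a) (t b)" if "a \<in> pts S" "b \<in> pts S" for a b
    using that by (simp add: diff_def t_add t_scl in_simps)
  have t_dist: "hnorm M (diff M (t a) (t b)) \<le> B * hnorm G (diff G (j a) (j b))"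
    if "a \<in> pts S" "b \<in> pts S" for a b
    using t_bound[of "diff S a b"] that by (simp add: in_simps t_diff j_dist)
  have "\<exists>m\<in>pts M. \<forall>a\<in>pts S. hnorm M (diff M m (t a)) \<le> B * hnorm G (diff G g (j a))" if g: "g \<in> pts G" for g
  proof -
    obtain X where X: "\<And>n. X n \<in> pts S" "(\<lambda>n. hnorm G (diff G (j (X n)) g)) \<longlonglongrightarrow> 0"
      using j_approx[OF g] by blast
    note jX = j_in[OF X(1)] and tX = t_in[OF X(1)]
    obtain m where m: "m \<in> pts M" "(\<lambda>n. hnorm M (diff M (t (X n)) m)) \<longlonglongrightarrow> 0"
    proof (rule M.cauchy_convergent[of "\<lambda>n. t (X n)"])
      fix e :: real assume e: "e > 0"
      have "e / (2 * \<bar>B\<bar> + 1) > 0" using e by simp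
      from LIMSEQ_D[OF X(2) this]
      obtain N where N': "\<forall>n\<ge>N. norm (hnorm G (diff G (j (X n)) g) - 0) < e / (2 * \<bar>B\<bar> + 1)" by blast
      have N: "hnorm G (diff G (j (X n)) g) < e / (2 * \<bar>B\<bar> + 1)" if "n \<ge> N" for n
        using N'[rule_format, OF that] jX[of n] g by (simp add: G.in_simps)
      have "hnorm M (diff M (t (X i)) (t (X k))) < e" if "i \<ge> N" "k \<ge> N" for i k
      proof -
        let ?d = "hnorm G (diff G (j (X i)) (j (X k)))"
        have "?d < 2 * (e / (2 * \<bar>B\<bar> + 1))"
          using G.hnorm_diff_triangle[OF jX g jX, of i k] N[OF that(1)] N[OF that(2)]
            G.hnorm_diff_commute[OF jX g, of k] by simp
        hence "\<bar>B\<bar> * ?d \<le> \<bar>B\<bar> * (2 * (e / (2 * \<bar>B\<bar> + 1)))" by (intro mult_left_mono) auto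
        also have "\<dots> < e" using e by (simp add: field_simps)
        finally have "\<bar>B\<bar> * ?d < e" .
        moreover have "B * ?d \<le> \<bar>B\<bar> * ?d" using jX by (intro mult_right_mono) (auto simp: G.in_simps)
        ultimately show ?thesis using t_dist[OF X(1) X(1), of i k] by linarith
      qed
      thus "\<exists>N. \<forall>m\<ge>N. \<forall>n\<ge>N. hnorm M (diff M (t (X m)) (t (X n))) < e" by blast
    qed (use tX in auto)
    have "hnorm M (diff M m (t a)) \<le> B * hnorm G (diff G g (j a))" if a: "a \<in> pts S" for a
    proof (rule LIMSEQ_le)
      have "(\<lambda>n. hnorm M (diff M (diff M (t (X n)) (t a)) (diff M m (t a)))) = (\<lambda>n. hnorm M (diff M (t (X n)) m))"
        using tX t_in[OF a] m(1) by (intro ext M.hnorm_eq_of_ip) (auto simp: M.in_simps M.ip_simps)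
      thus "(\<lambda>n. hnorm M (diff M (t (X n)) (t a))) \<longlonglongrightarrow> hnorm M (diff M m (t a))"
        using m tX t_in[OF a] by (intro M.hnorm_tendsto) (auto simp: M.in_simps)
      have "(\<lambda>n. hnorm G (diff G (diff G (j (X n)) (j a)) (diff G g (j a)))) = (\<lambda>n. hnorm G (diff G (j (X n)) g))"
        using jX j_in[OF a] g by (intro ext G.hnorm_eq_of_ip) (auto simp: G.in_simps G.ip_simps)
      thus "(\<lambda>n. B * hnorm G (diff G (j (X n)) (j a))) \<longlonglongrightarrow> B * hnorm G (diff G g (j a))"
        using X jX j_in[OF a] g by (intro tendsto_mult_left G.hnorm_tendsto) (auto simp: G.in_simps)
      show "\<exists>N. \<forall>n\<ge>N. hnorm M (diff M (t (X n)) (t a)) \<le> B * hnorm G (diff G (j (X n)) (j a))"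
        using t_dist[OF X(1) a] by blast
    qed
    thus ?thesis using m(1) by blast
  qed
  then obtain T0 where T0: "\<And>g. g \<in> pts G \<Longrightarrow> T0 g \<in> pts M"
    "\<And>g a. \<lbrakk>g \<in> pts G; a \<in> pts S\<rbrakk> \<Longrightarrow> hnorm M (diff M (T0 g) (t a)) \<le> B * hnorm G (diff G g (j a))" by metis
  have T0_j: "T0 (j a) = t a" if "a \<in> pts S" for a
  proof -
    have "hnorm M (diff M (T0 (j a)) (t a)) \<le> 0"
      using T0(2)[OF j_in[OF that] that] that by (simp add: j_in G.hnorm_diff_self)
    moreover have "0 \<le> hnorm M (diff M (T0 (j a)) (t a))"
      using T0(1) j_in t_in that by (simp add: M.in_simps)
    ultimately show ?thesis using M.hnorm_diff_eq_0 T0(1) j_in t_in that by (metis antisym)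
  qed
  have T0_lim: "(\<lambda>n. hnorm M (diff M (t (a n)) (T0 g))) \<longlonglongrightarrow> 0"
    if "g \<in> pts G" "\<And>n. a n \<in> pts S" "(\<lambda>n. hnorm G (diff G (j (a n)) g)) \<longlonglongrightarrow> 0" for a g
  proof (rule Lim_null_comparison)
    show "(\<lambda>n. B * hnorm G (diff G (j (a n)) g)) \<longlonglongrightarrow> 0"
      using tendsto_mult_left[OF that(3), of B] by simp
    have "norm (hnorm M (diff M (t (a n)) (T0 g))) \<le> B * hnorm G (diff G (j (a n)) g)" for n
      using T0(2)[OF that(1,2), of n] T0(1)[OF that(1)] t_in[OF that(2), of n] j_in[OF that(2), of n] that(1)
        M.hnorm_diff_commute[of "t (a n)" "T0 g"] G.hnorm_diff_commute[of "j (a n)" g]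
      by (simp add: M.in_simps)
    thus "\<forall>\<^sub>F n in sequentially. norm (hnorm M (diff M (t (a n)) (T0 g))) \<le> B * hnorm G (diff G (j (a n)) g)"
      by (intro always_eventually allI)
  qed
  have T0_ip: "(\<lambda>n. ip M z (t (a n))) \<longlonglongrightarrow> ip M z (T0 g)"
    if "g \<in> pts G" "\<And>n. a n \<in> pts S" "(\<lambda>n. hnorm G (diff G (j (a n)) g)) \<longlonglongrightarrow> 0" "z \<in> pts M" for a g z
    using M.ip_tendsto[of "\<lambda>_. z" z "\<lambda>n. t (a n)" "T0 g"] T0_lim[OF that(1-3)] that T0(1)
    by (simp add: t_in M.hnorm_diff_self)
  define T where "T = restrict T0 (pts G)"
  have T: "T g = T0 g" if "g \<in> pts G" for g using that by (simp add: T_def)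
  have bound: "hnorm M (T0 g) \<le> B * hnorm G g" if g: "g \<in> pts G" for g
  proof -
    obtain a where a: "\<And>n. a n \<in> pts S" "(\<lambda>n. hnorm G (diff G (j (a n)) g)) \<longlonglongrightarrow> 0"
      using j_approx[OF g] by blast
    have 1: "(\<lambda>n. hnorm M (t (a n))) \<longlonglongrightarrow> hnorm M (T0 g)"
      by (rule M.hnorm_tendsto) (use T0 a g T0_lim t_in in auto)
    have 2: "(\<lambda>n. B * hnorm G (j (a n))) \<longlonglongrightarrow> B * hnorm G g"
      by (intro tendsto_mult_left G.hnorm_tendsto) (use a g j_in in auto)
    show ?thesis by (rule LIMSEQ_le[OF 1 2]) (use t_bound a in \<open>auto simp: j_hnorm\<close>)
  qed
  have "T \<in> bounded_ops G M"
  proof (rule bounded_opsI[where B=B])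
    show "T \<in> pts G \<rightarrow>\<^sub>E pts M" using T0(1) by (auto simp: T_def)
    show "hnorm M (T g) \<le> B * hnorm G g" if "g \<in> pts G" for g using bound that by (simp add: T)
    show "T (add G g h) = add M (T g) (T h)" if g: "g \<in> pts G" and h: "h \<in> pts G" for g h
    proof -
      obtain a where a: "\<And>n. a n \<in> pts S" "(\<lambda>n. hnorm G (diff G (j (a n)) g)) \<longlonglongrightarrow> 0"
        using j_approx[OF g] by blast
      obtain b where b: "\<And>n. b n \<in> pts S" "(\<lambda>n. hnorm G (diff G (j (b n)) h)) \<longlonglongrightarrow> 0"
        using j_approx[OF h] by blast
      have bd: "norm (hnorm G (diff G (j (add S (a n) (b n))) (add G g h)))
          \<le> hnorm G (diff G (j (a n)) g) + hnorm G (diff G (j (b n)) h)" for n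
        using G.hnorm_diff_add[of "j (a n)" "j (b n)" g h] a(1) b(1) g h by (simp add: j_add j_in G.in_simps)
      have ab: "(\<lambda>n. hnorm G (diff G (j (add S (a n) (b n))) (add G g h))) \<longlonglongrightarrow> 0"
        using tendsto_add[OF a(2) b(2)] by (intro Lim_null_comparison[OF always_eventually[OF allI[OF bd]]]) simp
      have "T0 (add G g h) = add M (T0 g) (T0 h)"
      proof (rule M.vec_eqI)
        show "ip M z (T0 (add G g h)) = ip M z (add M (T0 g) (T0 h))" if z: "z \<in> pts M" for z
        proof (rule LIMSEQ_unique)
          show "(\<lambda>n. ip M z (t (add S (a n) (b n)))) \<longlonglongrightarrow> ip M z (T0 (add G g h))"
            by (rule T0_ip[OF _ _ ab z]) (use a b g h in \<open>auto simp: in_simps G.in_simps\<close>)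
          have "(\<lambda>n. ip M z (t (a n)) + ip M z (t (b n))) \<longlonglongrightarrow> ip M z (T0 g) + ip M z (T0 h)"
            by (intro tendsto_add T0_ip[OF g a z] T0_ip[OF h b z])
          thus "(\<lambda>n. ip M z (t (add S (a n) (b n)))) \<longlonglongrightarrow> ip M z (add M (T0 g) (T0 h))"
            using a(1) b(1) z g h by (simp add: t_add t_in T0(1) M.ip_simps)
        qed
      qed (use g h T0(1) in \<open>auto simp: G.in_simps M.in_simps\<close>)
      thus ?thesis using g h by (simp add: T G.in_simps)
    qed
    show "T (scl G c g) = scl M c (T g)" if g: "g \<in> pts G" for g c
    proof -
      obtain a where a: "\<And>n. a n \<in> pts S" "(\<lambda>n. hnorm G (diff G (j (a n)) g)) \<longlonglongrightarrow> 0"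
        using j_approx[OF g] by blast
      have "(\<lambda>n. hnorm G (diff G (j (scl S c (a n))) (scl G c g))) = (\<lambda>n. cmod c * hnorm G (diff G (j (a n)) g))"
        using a(1) g by (simp add: j_scl j_in G.hnorm_diff_scl)
      hence ca: "(\<lambda>n. hnorm G (diff G (j (scl S c (a n))) (scl G c g))) \<longlonglongrightarrow> 0"
        using tendsto_mult_left[OF a(2), of "cmod c"] by simp
      have "T0 (scl G c g) = scl M c (T0 g)"
      proof (rule M.vec_eqI)
        show "ip M z (T0 (scl G c g)) = ip M z (scl M c (T0 g))" if z: "z \<in> pts M" for z
        proof (rule LIMSEQ_unique)
          show "(\<lambda>n. ip M z (t (scl S c (a n)))) \<longlonglongrightarrow> ip M z (T0 (scl G c g))"
            by (rule T0_ip[OF _ _ ca z]) (use a g in \<open>auto simp: in_simps G.in_simps\<close>)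
          have "(\<lambda>n. c * ip M z (t (a n))) \<longlonglongrightarrow> c * ip M z (T0 g)"
            by (intro tendsto_mult_left T0_ip[OF g a z])
          thus "(\<lambda>n. ip M z (t (scl S c (a n)))) \<longlonglongrightarrow> ip M z (scl M c (T0 g))"
            using a(1) z g by (simp add: t_scl t_in T0(1) M.ip_simps)
        qed
      qed (use g T0(1) in \<open>auto simp: G.in_simps M.in_simps\<close>)
      thus ?thesis using g by (simp add: T G.in_simps)
    qed
  qed
  thus thesis using that T0_j bound by (simp add: T j_in)
qed

end

lemma (in semi_inner_product_space) dense_embedding_completion:
  assumes "inj f"
  shows "dense_embedding S (transport f (completion S)) (\<lambda>a. f (completion_emb S a))"
proof -
  note t = transport_simps[OF assms]
  let ?G = "transport f (completion S)"
  show ?thesis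
  proof (intro dense_embedding.intro dense_embedding_axioms.intro)
    show "semi_inner_product_space S" by (rule semi_inner_product_space_axioms)
    show "hilbert_space ?G" by (rule hilbert_space_transport[OF hilbert_space_completion assms])
    show "f (completion_emb S a) \<in> pts ?G" if "a \<in> pts S" for a
      unfolding t using emb_in[OF that] by (rule imageI)
    show "ip ?G (f (completion_emb S a)) (f (completion_emb S b)) = ip S a b" if "a \<in> pts S" "b \<in> pts S" for a b
      unfolding t using that by (rule emb_ip)
    fix g and e :: real assume "g \<in> pts ?G" "e > 0"
    then obtain x where x: "g = f x" "x \<in> pts (completion S)" unfolding t by blast
    show "\<exists>a\<in>pts S. hnorm ?G (diff ?G g (f (completion_emb S a))) < e"
      unfolding x(1) t using x(2) \<open>e > 0\<close> by (rule emb_dense)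
  qed
qed

section \<open>The Stinespring dilation\<close>

lemma (in inner_product_space) finite_vector_sum:
  assumes "finite P" "\<And>p. p \<in> P \<Longrightarrow> v p \<in> pts H"
  shows "\<exists>s\<in>pts H. \<forall>z\<in>pts H. ip H z s = (\<Sum>p\<in>P. ip H z (v p))"
  using assms
proof (induction P rule: finite_induct)
  case empty
  show ?case using zero_in by (intro bexI[of _ "zero H"]) (auto simp: ip_simps)
next
  case (insert p P)
  then obtain s where s: "s \<in> pts H" "\<forall>z\<in>pts H. ip H z s = (\<Sum>p\<in>P. ip H z (v p))" by auto
  show ?case
    by (rule bexI[of _ "add H (v p) s"]) (use insert s in \<open>auto simp: ip_simps in_simps\<close>)
qed

lemma sum_nth_concat:
  fixes f :: "nat \<times> 'p \<Rightarrow> 'c :: comm_monoid_add" and u :: "nat \<Rightarrow> 'p list" and n :: nat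
  defines "W \<equiv> concat (map (\<lambda>i. map (Pair i) (u i)) [0..<n])"
  shows "(\<Sum>p<length W. f (W ! p)) = (\<Sum>i<n. \<Sum>p\<leftarrow>u i. f (i, p))"
proof -
  have "(\<Sum>p<length W. f (W ! p)) = sum_list (map f W)"
    by (simp add: sum_list_sum_nth atLeast0LessThan)
  also have "\<dots> = sum_list (map (\<lambda>i. \<Sum>p\<leftarrow>u i. f (i, p)) [0..<n])"
    unfolding W_def by (induction n) (simp_all add: o_def)
  also have "\<dots> = (\<Sum>i<n. \<Sum>p\<leftarrow>u i. f (i, p))"
    by (simp add: interv_sum_list_conv_sum_set_nat atLeast0LessThan)
  finally show ?thesis .
qed

lemma star_homD:
  assumes "star_hom H A K B \<rho>"
  shows "a \<in> A \<Longrightarrow> \<rho> a \<in> B"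
    and "\<lbrakk>a \<in> A; b \<in> A\<rbrakk> \<Longrightarrow> \<rho> (op_add H H a b) = op_add K K (\<rho> a) (\<rho> b)"
    and "a \<in> A \<Longrightarrow> \<rho> (op_scl H H c a) = op_scl K K c (\<rho> a)"
    and "\<lbrakk>a \<in> A; b \<in> A\<rbrakk> \<Longrightarrow> \<rho> (a \<circ>\<^bsub>H\<^esub> b) = (\<rho> a \<circ>\<^bsub>K\<^esub> \<rho> b)"
    and "a \<in> A \<Longrightarrow> \<rho> (adj H H a) = adj K K (\<rho> a)"
  using assms by (auto simp: star_hom_def)

locale stinespring =
  fixes H :: "'h hspace" and A :: "'h op set" and K :: "('h op, 'h) tower hspace"
    and \<Psi> :: "'h op \<Rightarrow> ('h op, 'h) tower op"
  assumes H: "hilbert_space H" and A: "unital_cstar_algebra H A" and K: "hilbert_space K"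
    and cp: "completely_positive H A K \<Psi>" and unital: "unital H K \<Psi>"
begin

sublocale H: hilbert_space H by (rule H)
sublocale K: hilbert_space K by (rule K)

lemmas ips [simp] = H.inner_product_space_axioms K.inner_product_space_axioms H K

lemmas A_in = unital_cstar_algebraD(1)[OF A]
lemmas A_closed = unital_cstar_algebraD(2-6)[OF A]

lemma A_mem: "\<lbrakk>a \<in> A; x \<in> pts H\<rbrakk> \<Longrightarrow> a x \<in> pts H"
  by (rule bounded_ops_mem[OF A_in])

lemma \<Psi>_in: "a \<in> A \<Longrightarrow> \<Psi> a \<in> bounded_ops K K"
  and \<Psi>_add: "\<lbrakk>a \<in> A; b \<in> A\<rbrakk> \<Longrightarrow> \<Psi> (op_add H H a b) = op_add K K (\<Psi> a) (\<Psi> b)"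
  and \<Psi>_scl: "a \<in> A \<Longrightarrow> \<Psi> (op_scl H H c a) = op_scl K K c (\<Psi> a)"
  and \<Psi>_pos: "\<lbrakk>\<And>i j. \<lbrakk>i < n; j < n\<rbrakk> \<Longrightarrow> m i j \<in> A; positive_matrix H n m\<rbrakk> \<Longrightarrow> positive_matrix K n (\<lambda>i j. \<Psi> (m i j))"
  using cp by (auto simp: completely_positive_def)

lemma \<Psi>_mem: "\<lbrakk>a \<in> A; x \<in> pts K\<rbrakk> \<Longrightarrow> \<Psi> a x \<in> pts K"
  by (rule bounded_ops_mem[OF \<Psi>_in])

text \<open>The matrix \<open>(x\<^sub>p\<^sup>* a\<^sub>i\<^sub>j x\<^sub>q)\<close> obtained from a positive matrix \<open>(a\<^sub>i\<^sub>j)\<close> is again positive.  Hence this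
  one application of complete positivity yields the positivity of the semi-inner product, the
  contractivity of the representation and the complete positivity of the representation; square roots
  in matrix algebras are avoided.\<close>

lemma cp_conjugate:
  assumes a: "\<And>i j. \<lbrakk>i < n; j < n\<rbrakk> \<Longrightarrow> a i j \<in> A" and pos: "positive_matrix H n a"
    and u: "\<And>i. i < n \<Longrightarrow> u i \<in> lists (A \<times> pts K)"
  shows "(\<Sum>i<n. \<Sum>j<n. \<Sum>p\<leftarrow>u i. \<Sum>q\<leftarrow>u j.
      ip K (snd p) (\<Psi> (adj H H (fst p) \<circ>\<^bsub>H\<^esub> (a i j \<circ>\<^bsub>H\<^esub> fst q)) (snd q))) \<in> \<real>\<^sub>\<ge>\<^sub>0"
proof -
  \<comment> \<open>all tensor factors of all \<open>u i\<close> in one list, labelled by their row\<close>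
  define W where "W = concat (map (\<lambda>i. map (Pair i) (u i)) [0..<n])"
  define N where "N = length W"
  define lev x \<xi> where "lev p = fst (W ! p)" and "x p = fst (snd (W ! p))" and "\<xi> p = snd (snd (W ! p))" for p
  have W: "lev p < n \<and> x p \<in> A \<and> \<xi> p \<in> pts K" if "p < N" for p
  proof -
    have "W ! p \<in> set W" using that by (simp add: N_def)
    then obtain i q where "W ! p = (i, q)" "i < n" "q \<in> set (u i)" by (auto simp: W_def)
    thus ?thesis using u[of i] by (auto simp: lev_def x_def \<xi>_def in_lists_conv_set mem_Times_iff)
  qed
  define b where "b p q = (adj H H (x p) \<circ>\<^bsub>H\<^esub> (a (lev p) (lev q) \<circ>\<^bsub>H\<^esub> x q))" for p q
  have bA: "b p q \<in> A" if "p < N" "q < N" for p q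
    unfolding b_def using W[OF that(1)] W[OF that(2)] a by (intro A_closed) auto
  have "positive_matrix H N b"
    unfolding positive_matrix_def
  proof (intro allI impI)
    fix \<zeta> assume \<zeta>: "\<forall>p<N. \<zeta> p \<in> pts H"
    define w where "w p = x p (\<zeta> p)" for p
    have w: "w p \<in> pts H" if "p < N" for p using W[OF that] \<zeta> that by (simp add: w_def A_mem)
    have "\<exists>s\<in>pts H. \<forall>z\<in>pts H. ip H z s = (\<Sum>p\<in>{p\<in>{..<N}. lev p = i}. ip H z (w p))" for i
      by (rule H.finite_vector_sum) (use w in auto)
    then obtain s where s: "\<And>i. s i \<in> pts H"
      "\<And>i z. z \<in> pts H \<Longrightarrow> ip H z (s i) = (\<Sum>p\<in>{p\<in>{..<N}. lev p = i}. ip H z (w p))" by metis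
    have s': "ip H (s i) z = (\<Sum>p\<in>{p\<in>{..<N}. lev p = i}. ip H (w p) z)" if "z \<in> pts H" for i z
    proof -
      have "ip H (s i) z = cnj (ip H z (s i))" by (rule H.ip_cnj[OF that s(1)])
      also have "\<dots> = (\<Sum>p\<in>{p\<in>{..<N}. lev p = i}. cnj (ip H z (w p)))" by (simp add: s(2)[OF that])
      also have "\<dots> = (\<Sum>p\<in>{p\<in>{..<N}. lev p = i}. ip H (w p) z)"
        by (intro sum.cong refl H.ip_cnj[symmetric] that w) auto
      finally show ?thesis .
    qed
    have block: "ip H (s i) (a i j (s j)) =
        (\<Sum>p\<in>{p\<in>{..<N}. lev p = i}. \<Sum>q\<in>{q\<in>{..<N}. lev q = j}. ip H (w p) (a i j (w q)))"
      if "i < n" "j < n" for i j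
    proof -
      note ab = A_in[OF a[OF that]]
      have "ip H (s i) (a i j (s j)) = ip H (adj H H (a i j) (s i)) (s j)"
        using s ab by (simp add: ip_adj_left)
      also have "\<dots> = (\<Sum>q\<in>{q\<in>{..<N}. lev q = j}. ip H (adj H H (a i j) (s i)) (w q))"
        by (rule s(2), rule bounded_ops_mem[OF adj_in[OF H _ ab]]) (use s in auto)
      also have "\<dots> = (\<Sum>q\<in>{q\<in>{..<N}. lev q = j}. ip H (s i) (a i j (w q)))"
        using s ab w by (intro sum.cong refl) (simp add: ip_adj_left)
      also have "\<dots> = (\<Sum>q\<in>{q\<in>{..<N}. lev q = j}. \<Sum>p\<in>{p\<in>{..<N}. lev p = i}. ip H (w p) (a i j (w q)))"
        using ab w by (intro sum.cong refl s') (simp add: bounded_ops_mem)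
      finally show ?thesis by (subst (asm) sum.swap)
    qed
    have entry: "ip H (\<zeta> p) (b p q (\<zeta> q)) = ip H (w p) (a (lev p) (lev q) (w q))" if "p < N" "q < N" for p q
    proof -
      have ab: "a (lev p) (lev q) (w q) \<in> pts H" using W[OF that(1)] W[OF that(2)] w[OF that(2)] a by (simp add: A_mem)
      have "b p q (\<zeta> q) = adj H H (x p) (a (lev p) (lev q) (w q))"
        using \<zeta> that by (simp add: b_def w_def)
      thus ?thesis using W[OF that(1)] \<zeta> that ab by (simp add: ip_adj A_in w_def)
    qed
    have grp: "(\<Sum>i<n. \<Sum>p\<in>{p\<in>{..<N}. lev p = i}. f i p) = (\<Sum>p<N. f (lev p) p)" for f :: "nat \<Rightarrow> nat \<Rightarrow> complex"
    proof -
      have "(\<Sum>i<n. \<Sum>p\<in>{p\<in>{..<N}. lev p = i}. f i p) = (\<Sum>i<n. \<Sum>p\<in>{p\<in>{..<N}. lev p = i}. f (lev p) p)"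
        by (intro sum.cong) auto
      also have "\<dots> = (\<Sum>p<N. f (lev p) p)"
        by (rule sum.group) (use W in auto)
      finally show ?thesis .
    qed
    have "(\<Sum>i<n. \<Sum>j<n. ip H (s i) (a i j (s j))) =
        (\<Sum>i<n. \<Sum>j<n. \<Sum>p\<in>{p\<in>{..<N}. lev p = i}. \<Sum>q\<in>{q\<in>{..<N}. lev q = j}. ip H (w p) (a i j (w q)))"
      by (intro sum.cong refl block) auto
    also have "\<dots> = (\<Sum>i<n. \<Sum>p\<in>{p\<in>{..<N}. lev p = i}. \<Sum>j<n. \<Sum>q\<in>{q\<in>{..<N}. lev q = j}. ip H (w p) (a i j (w q)))"
      by (intro sum.cong refl sum.swap)
    also have "\<dots> = (\<Sum>p<N. \<Sum>q<N. ip H (w p) (a (lev p) (lev q) (w q)))"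
      by (simp only: grp)
    also have "\<dots> = (\<Sum>p<N. \<Sum>q<N. ip H (\<zeta> p) (b p q (\<zeta> q)))"
      by (intro sum.cong refl) (simp add: entry)
    finally have "(\<Sum>p<N. \<Sum>q<N. ip H (\<zeta> p) (b p q (\<zeta> q))) = (\<Sum>i<n. \<Sum>j<n. ip H (s i) (a i j (s j)))" by simp
    thus "(\<Sum>p<N. \<Sum>q<N. ip H (\<zeta> p) (b p q (\<zeta> q))) \<in> \<real>\<^sub>\<ge>\<^sub>0"
      using pos s(1) unfolding positive_matrix_def by simp
  qed
  hence "positive_matrix K N (\<lambda>p q. \<Psi> (b p q))" using bA by (intro \<Psi>_pos)
  hence "(\<Sum>p<N. \<Sum>q<N. ip K (\<xi> p) (\<Psi> (b p q) (\<xi> q))) \<in> \<real>\<^sub>\<ge>\<^sub>0"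
    using W unfolding positive_matrix_def by simp
  also have "(\<Sum>p<N. \<Sum>q<N. ip K (\<xi> p) (\<Psi> (b p q) (\<xi> q))) =
     (\<Sum>i<n. \<Sum>p\<leftarrow>u i. \<Sum>j<n. \<Sum>q\<leftarrow>u j.
      ip K (snd p) (\<Psi> (adj H H (fst p) \<circ>\<^bsub>H\<^esub> (a i j \<circ>\<^bsub>H\<^esub> fst q)) (snd q)))"
  proof -
    define F where "F P Q = ip K (snd (snd P)) (\<Psi> (adj H H (fst (snd P)) \<circ>\<^bsub>H\<^esub> (a (fst P) (fst Q) \<circ>\<^bsub>H\<^esub> fst (snd Q))) (snd (snd Q)))"
      for P Q :: "nat \<times> ('h op \<times> ('h op, 'h) tower)"
    have "(\<Sum>p<N. \<Sum>q<N. ip K (\<xi> p) (\<Psi> (b p q) (\<xi> q))) = (\<Sum>p<length W. \<Sum>q<length W. F (W ! p) (W ! q))"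
      by (simp add: F_def N_def b_def x_def \<xi>_def lev_def)
    also have "\<dots> = (\<Sum>i<n. \<Sum>p\<leftarrow>u i. \<Sum>q<length W. F (i, p) (W ! q))"
      unfolding W_def by (rule sum_nth_concat)
    also have "\<dots> = (\<Sum>i<n. \<Sum>p\<leftarrow>u i. \<Sum>j<n. \<Sum>q\<leftarrow>u j. F (i, p) (j, q))"
      unfolding W_def by (simp only: sum_nth_concat)
    finally show ?thesis by (simp add: F_def)
  qed
  also have "\<dots> = (\<Sum>i<n. \<Sum>j<n. \<Sum>p\<leftarrow>u i. \<Sum>q\<leftarrow>u j.
      ip K (snd p) (\<Psi> (adj H H (fst p) \<circ>\<^bsub>H\<^esub> (a i j \<circ>\<^bsub>H\<^esub> fst q)) (snd q)))"
  proof (intro sum.cong refl)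
    fix i
    have "(\<Sum>p\<leftarrow>l. \<Sum>j<n. f p j) = (\<Sum>j<n. \<Sum>p\<leftarrow>l. f p j)" for l and f :: "_ \<Rightarrow> nat \<Rightarrow> complex"
      by (induction l) (simp_all add: sum.distrib)
    thus "(\<Sum>p\<leftarrow>u i. \<Sum>j<n. \<Sum>q\<leftarrow>u j. ip K (snd p) (\<Psi> (adj H H (fst p) \<circ>\<^bsub>H\<^esub> (a i j \<circ>\<^bsub>H\<^esub> fst q)) (snd q))) =
       (\<Sum>j<n. \<Sum>p\<leftarrow>u i. \<Sum>q\<leftarrow>u j. ip K (snd p) (\<Psi> (adj H H (fst p) \<circ>\<^bsub>H\<^esub> (a i j \<circ>\<^bsub>H\<^esub> fst q)) (snd q)))" .
  qed
  finally show ?thesis .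
qed

abbreviation "ts \<equiv> tensor_space H A K \<Psi>"

definition form :: "'h op \<times> ('h op, 'h) tower \<Rightarrow> 'h op \<times> ('h op, 'h) tower \<Rightarrow> complex" where
  "form p q = ip K (snd p) (\<Psi> (adj H H (fst p) \<circ>\<^bsub>H\<^esub> fst q) (snd q))"

text \<open>The left action \<open>a (x \<otimes> \<xi>) = a x \<otimes> \<xi>\<close>.\<close>

definition act :: "'h op \<Rightarrow> ('h op \<times> ('h op, 'h) tower) list \<Rightarrow> ('h op \<times> ('h op, 'h) tower) list" where
  "act a = map (\<lambda>p. (a \<circ>\<^bsub>H\<^esub> fst p, snd p))"

lemma ts_pts: "pts ts = lists (A \<times> pts K)" and ts_add: "add ts u v = u @ v" and ts_zero: "zero ts = []"
  and ts_scl: "scl ts c u = map (\<lambda>p. (fst p, scl K c (snd p))) u"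
  and ts_ip: "ip ts u v = (\<Sum>p\<leftarrow>u. \<Sum>q\<leftarrow>v. form p q)"
  by (simp_all add: tensor_space_def form_def split_def)

lemma sum_list_cong: "(\<And>p. p \<in> set u \<Longrightarrow> f p = g p) \<Longrightarrow> (\<Sum>p\<leftarrow>u. f p) = (\<Sum>p\<leftarrow>u. g p)"
  for f :: "'p \<Rightarrow> complex"
  by (simp cong: map_cong)

lemma ts_mem: "\<lbrakk>u \<in> pts ts; p \<in> set u\<rbrakk> \<Longrightarrow> fst p \<in> A \<and> snd p \<in> pts K"
  by (auto simp: ts_pts in_lists_conv_set mem_Times_iff)

lemma act_in: "\<lbrakk>a \<in> A; u \<in> pts ts\<rbrakk> \<Longrightarrow> act a u \<in> pts ts"
  by (auto simp: act_def ts_pts in_lists_conv_set mem_Times_iff intro!: A_closed)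

lemma cp_conjugate_ts:
  assumes a: "\<And>i j. \<lbrakk>i < n; j < n\<rbrakk> \<Longrightarrow> a i j \<in> A" and pos: "positive_matrix H n a"
    and u: "\<And>i. i < n \<Longrightarrow> u i \<in> pts ts"
  shows "(\<Sum>i<n. \<Sum>j<n. ip ts (u i) (act (a i j) (u j))) \<in> \<real>\<^sub>\<ge>\<^sub>0"
proof -
  have u': "u i \<in> lists (A \<times> pts K)" if "i < n" for i using u[OF that] unfolding ts_pts .
  have "ip ts (u i) (act (a i j) (u j)) = (\<Sum>p\<leftarrow>u i. \<Sum>q\<leftarrow>u j.
      ip K (snd p) (\<Psi> (adj H H (fst p) \<circ>\<^bsub>H\<^esub> (a i j \<circ>\<^bsub>H\<^esub> fst q)) (snd q)))" for i j
    by (simp add: ts_ip act_def form_def o_def)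
  thus ?thesis using cp_conjugate[OF a pos u'] by simp
qed

lemma act_id: "u \<in> pts ts \<Longrightarrow> act (op_id H) u = u"
  unfolding act_def using ts_mem by (intro map_idI) (auto simp: op_id_comp[OF A_in])

lemma positive_matrix_1: "positive_matrix H' (Suc 0) m \<longleftrightarrow> (\<forall>x\<in>pts H'. ip H' x (m 0 0 x) \<in> \<real>\<^sub>\<ge>\<^sub>0)"
proof -
  have "(\<forall>\<xi> :: nat \<Rightarrow> _. \<xi> 0 \<in> pts H' \<longrightarrow> ip H' (\<xi> 0) (m 0 0 (\<xi> 0)) \<in> \<real>\<^sub>\<ge>\<^sub>0) \<longleftrightarrow>
      (\<forall>x\<in>pts H'. ip H' x (m 0 0 x) \<in> \<real>\<^sub>\<ge>\<^sub>0)" (is "?L \<longleftrightarrow> ?R")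
  proof
    assume L: ?L
    show ?R using spec[OF L, of "\<lambda>_. _"] by blast
  qed blast
  thus ?thesis by (simp add: positive_matrix_def)
qed

lemma ts_nonneg: "u \<in> pts ts \<Longrightarrow> ip ts u u \<in> \<real>\<^sub>\<ge>\<^sub>0"
  using cp_conjugate_ts[of "Suc 0" "\<lambda>_ _. op_id H" "\<lambda>_. u"]
  by (auto simp: A_closed positive_matrix_1 act_id H.ip_self complex_nonneg_Reals_iff)

lemma ts_ip_add_right: "ip ts u (v @ w) = ip ts u v + ip ts u w"
  by (simp add: ts_ip sum_list_addf)

lemma ts_ip_add_left: "ip ts (u @ v) w = ip ts u w + ip ts v w"
  by (simp add: ts_ip)

lemma A_adj_comp: "\<lbrakk>a \<in> A; b \<in> A\<rbrakk> \<Longrightarrow> (adj H H a \<circ>\<^bsub>H\<^esub> b) \<in> A"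
  by (intro A_closed)

lemma ts_ip_scl_right:
  assumes "u \<in> pts ts" "v \<in> pts ts" shows "ip ts u (scl ts c v) = c * ip ts u v"
proof -
  have "form p (fst q, scl K c (snd q)) = c * form p q" if "p \<in> set u" "q \<in> set v" for p q
    using ts_mem[OF assms(1) that(1)] ts_mem[OF assms(2) that(2)]
    by (simp add: form_def bounded_ops_scl[OF \<Psi>_in] A_adj_comp K.ip_simps \<Psi>_mem)
  hence "(\<Sum>p\<leftarrow>u. \<Sum>q\<leftarrow>v. form p (fst q, scl K c (snd q))) = (\<Sum>p\<leftarrow>u. \<Sum>q\<leftarrow>v. c * form p q)"
    by (intro sum_list_cong)
  thus ?thesis by (simp add: ts_ip ts_scl o_def sum_list_const_mult)
qed

lemma ts_ip_scl_left:
  assumes "u \<in> pts ts" "v \<in> pts ts" shows "ip ts (scl ts c u) v = cnj c * ip ts u v"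
proof -
  have "form (fst p, scl K c (snd p)) q = cnj c * form p q" if "p \<in> set u" "q \<in> set v" for p q
    using ts_mem[OF assms(1) that(1)] ts_mem[OF assms(2) that(2)]
    by (simp add: form_def A_adj_comp K.ip_simps \<Psi>_mem)
  hence "(\<Sum>p\<leftarrow>u. \<Sum>q\<leftarrow>v. form (fst p, scl K c (snd p)) q) = (\<Sum>p\<leftarrow>u. \<Sum>q\<leftarrow>v. cnj c * form p q)"
    by (intro sum_list_cong)
  thus ?thesis by (simp add: ts_ip ts_scl o_def sum_list_const_mult)
qed

text \<open>The form is Hermitian because its quadratic form is real, by polarisation.\<close>

sublocale ts: semi_inner_product_space ts
proof
  show zero: "zero ts \<in> pts ts" by (simp add: ts_pts ts_zero)
  show add: "add ts u v \<in> pts ts" if "u \<in> pts ts" "v \<in> pts ts" for u v using that by (simp add: ts_pts ts_add)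
  show scl: "scl ts c u \<in> pts ts" if "u \<in> pts ts" for u c
    using that by (auto simp: ts_pts ts_scl in_lists_conv_set mem_Times_iff K.in_simps)
  show "ip ts u (add ts v w) = ip ts u v + ip ts u w" for u v w by (simp add: ts_add ts_ip_add_right)
  show "ip ts u (scl ts c v) = c * ip ts u v" if "u \<in> pts ts" "v \<in> pts ts" for u v c
    by (rule ts_ip_scl_right[OF that])
  show "ip ts u (zero ts) = 0" for u by (simp add: ts_ip ts_zero)
  show "0 \<le> Re (ip ts u u)" if "u \<in> pts ts" for u
    using ts_nonneg[OF that] by (simp add: complex_nonneg_Reals_iff)
  show "ip ts v u = cnj (ip ts u v)" if u: "u \<in> pts ts" and v: "v \<in> pts ts" for u v
  proof -
    let ?w = "scl ts \<i> v"
    have w: "?w \<in> pts ts" by (rule scl[OF v])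
    have real: "Im (ip ts x x) = 0" if "x \<in> pts ts" for x
      using ts_nonneg[OF that] by (simp add: complex_nonneg_Reals_iff)
    have "Im (ip ts (u @ v) (u @ v)) = 0" by (rule real) (use add[OF u v] in \<open>simp add: ts_add\<close>)
    hence 1: "Im (ip ts u v) + Im (ip ts v u) = 0"
      using real[OF u] real[OF v] by (simp add: ts_ip_add_right ts_ip_add_left)
    have "Im (ip ts (u @ ?w) (u @ ?w)) = 0" by (rule real) (use add[OF u w] in \<open>simp add: ts_add\<close>)
    hence "Im (ip ts u ?w) + Im (ip ts ?w u) = 0"
      using real[OF u] real[OF w] by (simp add: ts_ip_add_right ts_ip_add_left)
    hence 2: "Re (ip ts u v) - Re (ip ts v u) = 0"
      by (simp add: ts_ip_scl_left ts_ip_scl_right u v)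
    show ?thesis using 1 2 by (simp add: complex_eq_iff)
  qed
qed

abbreviation "G \<equiv> stinespring_space H A K \<Psi>"

definition j :: "('h op \<times> ('h op, 'h) tower) list \<Rightarrow> ('h op, 'h) tower" where
  "j u = Compl (completion_emb ts u)"

sublocale dense_embedding ts G j
proof -
  have "inj (Compl :: _ \<Rightarrow> ('h op, 'h) tower)" by (simp add: inj_def)
  from ts.dense_embedding_completion[OF this] show "dense_embedding ts G j"
    by (simp add: stinespring_space_def j_def[abs_def])
qed

lemma G [simp]: "hilbert_space G" "inner_product_space G"
  by (rule G.hilbert_space_axioms G.inner_product_space_axioms)+

lemma act_add: "act a (add ts u v) = add ts (act a u) (act a v)"
  by (simp add: act_def ts_add)

lemma act_scl: "act a (scl ts c u) = scl ts c (act a u)"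
  by (simp add: act_def ts_scl)

text \<open>With \<open>c = B\<^sup>2 - a\<^sup>* a \<ge> 0\<close>, the defect \<open>B\<^sup>2 \<parallel>u\<parallel>\<^sup>2 - \<parallel>a u\<parallel>\<^sup>2\<close> is the value of the form at \<open>(u, c u)\<close>.\<close>

lemma act_contractive:
  assumes a: "a \<in> A" and u: "u \<in> pts ts" and B: "B \<ge> 0" "\<And>x. x \<in> pts H \<Longrightarrow> hnorm H (a x) \<le> B * hnorm H x"
  shows "hnorm ts (act a u) \<le> B * hnorm ts u"
proof -
  define aa where "aa = (adj H H a \<circ>\<^bsub>H\<^esub> a)"
  define c where "c = op_add H H (op_scl H H (complex_of_real (B\<^sup>2)) (op_id H)) (op_scl H H (-1) aa)"
  have aaA: "aa \<in> A" unfolding aa_def using a by (intro A_closed)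
  have cA: "c \<in> A" unfolding c_def by (intro A_closed aaA)
  have "positive_matrix H (Suc 0) (\<lambda>_ _. c)"
    unfolding positive_matrix_1
  proof
    fix x assume x: "x \<in> pts H"
    have "ip H x (aa x) = ip H (a x) (a x)"
      unfolding aa_def using x a by (simp add: ip_adj A_in A_mem)
    hence "ip H x (c x) = complex_of_real (B\<^sup>2) * ip H x x - ip H (a x) (a x)"
      unfolding c_def using x by (simp add: H.ip_simps H.in_simps A_mem[OF aaA])
    also have "\<dots> = complex_of_real ((B * hnorm H x)\<^sup>2 - (hnorm H (a x))\<^sup>2)"
      using x by (simp add: H.ip_self A_mem[OF a] power_mult_distrib)
    finally show "ip H x (c x) \<in> \<real>\<^sub>\<ge>\<^sub>0"
      using power_mono[OF B(2)[OF x] H.hnorm_ge_0[OF A_mem[OF a x]], of 2] by (simp add: complex_nonneg_Reals_iff)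
  qed
  from cp_conjugate_ts[OF _ this, of "\<lambda>_. u"] have nn: "ip ts u (act c u) \<in> \<real>\<^sub>\<ge>\<^sub>0" using cA u by simp
  have "form p (c \<circ>\<^bsub>H\<^esub> fst q, snd q) = complex_of_real (B\<^sup>2) * form p q - form (a \<circ>\<^bsub>H\<^esub> fst p, snd p) (a \<circ>\<^bsub>H\<^esub> fst q, snd q)"
    if "p \<in> set u" "q \<in> set u" for p q
  proof -
    have p: "fst p \<in> A" "snd p \<in> pts K" and q: "fst q \<in> A" "snd q \<in> pts K" using ts_mem[OF u] that by auto
    note b = A_in[OF p(1)] A_in[OF q(1)] A_in[OF a] A_in[OF aaA] A_in[OF A_closed(5)[OF p(1)]]
    let ?pq = "adj H H (fst p) \<circ>\<^bsub>H\<^esub> fst q"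
    let ?apq = "adj H H (a \<circ>\<^bsub>H\<^esub> fst p) \<circ>\<^bsub>H\<^esub> (a \<circ>\<^bsub>H\<^esub> fst q)"
    have aq: "?pq \<in> A" "?apq \<in> A" using p q a by (auto intro!: A_closed)
    have "?apq = (adj H H (fst p) \<circ>\<^bsub>H\<^esub> (aa \<circ>\<^bsub>H\<^esub> fst q))"
      unfolding aa_def using b adj_comp[OF H H ips(1) b(1) b(3)]
      by (simp add: op_comp_assoc[of _ H H] op_comp_in[of _ H H] adj_in)
    hence "(adj H H (fst p) \<circ>\<^bsub>H\<^esub> (c \<circ>\<^bsub>H\<^esub> fst q)) = op_add H H (op_scl H H (complex_of_real (B\<^sup>2)) ?pq) (op_scl H H (-1) ?apq)"
      unfolding c_def using b
      by (simp add: op_comp_add_left[of _ H H] op_comp_scl_left[of _ H H] op_comp_add_right[of _ H H]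
          op_comp_scl_right[of _ H H] op_comp_in[of _ H H] op_scl_in op_id_comp[of _ H H] adj_in)
    thus ?thesis using aq p q
      by (simp add: form_def \<Psi>_add \<Psi>_scl A_closed K.ip_simps K.in_simps \<Psi>_mem)
  qed
  hence "ip ts u (act c u) = (\<Sum>p\<leftarrow>u. \<Sum>q\<leftarrow>u. complex_of_real (B\<^sup>2) * form p q - form (a \<circ>\<^bsub>H\<^esub> fst p, snd p) (a \<circ>\<^bsub>H\<^esub> fst q, snd q))"
    unfolding ts_ip act_def map_map o_def by (intro sum_list_cong) simp
  also have "\<dots> = complex_of_real (B\<^sup>2) * ip ts u u - ip ts (act a u) (act a u)"
    by (simp add: ts_ip act_def o_def sum_list_subtractf sum_list_const_mult)
  finally have "Re (ip ts (act a u) (act a u)) \<le> B\<^sup>2 * Re (ip ts u u)"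
    using nn by (simp add: complex_nonneg_Reals_iff)
  hence "(hnorm ts (act a u))\<^sup>2 \<le> (B * hnorm ts u)\<^sup>2"
    using u act_in[OF a u] by (simp add: ts.hnorm_sq power_mult_distrib)
  thus ?thesis by (rule power2_le_imp_le) (use B u in simp)
qed

abbreviation "\<sigma> \<equiv> stinespring_rep H A K \<Psi>"

lemma elementary_j: "stinespring_tensor H A K \<Psi> x \<xi> = j [(x, \<xi>)]"
  by (simp add: stinespring_tensor_def j_def)

lemma rep:
  assumes a: "a \<in> A"
  shows rep_in: "\<sigma> a \<in> bounded_ops G G" and rep_j: "u \<in> pts ts \<Longrightarrow> \<sigma> a (j u) = j (act a u)"
    and rep_contractive: "\<lbrakk>B \<ge> 0; \<And>x. x \<in> pts H \<Longrightarrow> hnorm H (a x) \<le> B * hnorm H x; g \<in> pts G\<rbrakk>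
      \<Longrightarrow> hnorm G (\<sigma> a g) \<le> B * hnorm G g"
proof -
  have ex: "\<exists>T\<in>bounded_ops G G. (\<forall>u\<in>pts ts. T (j u) = j (act a u)) \<and> (\<forall>g\<in>pts G. hnorm G (T g) \<le> B * hnorm G g)"
    if B: "B \<ge> 0" "\<And>x. x \<in> pts H \<Longrightarrow> hnorm H (a x) \<le> B * hnorm H x" for B
  proof -
    obtain T where "T \<in> bounded_ops G G" "\<And>u. u \<in> pts ts \<Longrightarrow> T (j u) = j (act a u)"
      "\<And>g. g \<in> pts G \<Longrightarrow> hnorm G (T g) \<le> B * hnorm G g"
      by (rule extension[of G "\<lambda>u. j (act a u)" B])
        (use a act_contractive[OF a _ B] in \<open>simp_all add: act_in j_in act_add act_scl j_add j_scl j_hnorm\<close>)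
    thus ?thesis by blast
  qed
  let ?P = "\<lambda>T. T \<in> bounded_ops G G \<and> (\<forall>x\<in>A. \<forall>\<xi>\<in>pts K. T (stinespring_tensor H A K \<Psi> x \<xi>)
            = stinespring_tensor H A K \<Psi> (a \<circ>\<^bsub>H\<^esub> x) \<xi>)"
  have on_j: "T (j u) = j (act a u)" if T: "?P T" and u: "u \<in> pts ts" for T u
    using u
  proof (induction u)
    case Nil
    have Tz: "T (zero G) \<in> pts G" by (rule bounded_ops_mem[OF conjunct1[OF T] G.zero_in])
    have "zero G = scl G 0 (zero G)" by (rule G.vec_eqI) (simp_all add: G.in_simps G.ip_simps)
    moreover have "T (scl G 0 (zero G)) = scl G 0 (T (zero G))" using T by (simp add: bounded_ops_scl G.in_simps)
    moreover have "scl G 0 (T (zero G)) = zero G"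
      by (rule G.vec_eqI) (use Tz in \<open>simp_all add: G.in_simps G.ip_simps\<close>)
    ultimately show ?case using j_zero by (simp add: act_def ts_zero)
  next
    case (Cons p u)
    have p: "[p] \<in> pts ts" "fst p \<in> A" "snd p \<in> pts K" and u: "u \<in> pts ts" using Cons.prems by (auto simp: ts_pts)
    have T1: "T (j [p]) = j (act a [p])" using T p by (cases p) (simp add: elementary_j act_def)
    have "T (j (add ts [p] u)) = T (add G (j [p]) (j u))" using p u by (simp add: j_add)
    also have "\<dots> = add G (T (j [p])) (T (j u))" using T p u by (intro bounded_ops_add[of T G G]) (auto simp: j_in)
    also have "\<dots> = j (add ts (act a [p]) (act a u))"
      unfolding T1 Cons.IH[OF u] by (rule j_add[symmetric]) (use p u a in \<open>auto simp: act_in\<close>)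
    also have "\<dots> = j (act a (add ts [p] u))" by (simp only: act_add)
    finally show ?case by (simp add: ts_add)
  qed
  have rep_eq: "\<sigma> a = T" if "T \<in> bounded_ops G G" "\<forall>u\<in>pts ts. T (j u) = j (act a u)" for T
    unfolding stinespring_rep_def
  proof (rule the_equality)
    show "?P T" using that by (auto simp: elementary_j act_def ts_pts)
    show "T' = T" if "?P T'" for T'
      by (rule op_eqI_j[of T' G T]) (use that on_j[OF that] \<open>T \<in> _\<close> \<open>\<forall>u\<in>pts ts. _\<close> in auto)
  qed
  obtain B where "B \<ge> 0" "\<And>x. x \<in> pts H \<Longrightarrow> hnorm H (a x) \<le> B * hnorm H x"
    using bounded_ops_bound[OF A_in[OF a] H.semi_inner_product_space_axioms] by metis
  from ex[OF this] show "\<sigma> a \<in> bounded_ops G G" "u \<in> pts ts \<Longrightarrow> \<sigma> a (j u) = j (act a u)"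
    using rep_eq by auto
  show "hnorm G (\<sigma> a g) \<le> B * hnorm G g"
    if "B \<ge> 0" "\<And>x. x \<in> pts H \<Longrightarrow> hnorm H (a x) \<le> B * hnorm H x" "g \<in> pts G" for B g
    using ex[OF that(1,2)] rep_eq that(3) by auto
qed

lemma ip_act_right:
  "ip ts u (act a v) = (\<Sum>p\<leftarrow>u. \<Sum>q\<leftarrow>v. form p (a \<circ>\<^bsub>H\<^esub> fst q, snd q))"
  by (simp add: ts_ip act_def o_def)

lemma rep_add:
  assumes a: "a \<in> A" and b: "b \<in> A"
  shows "\<sigma> (op_add H H a b) = op_add G G (\<sigma> a) (\<sigma> b)"
proof (rule op_eqI_j[of _ G])
  have ab: "op_add H H a b \<in> A" using a b by (rule A_closed)
  show "\<sigma> (op_add H H a b) (j v) = op_add G G (\<sigma> a) (\<sigma> b) (j v)" if v: "v \<in> pts ts" for v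
  proof (rule eqI_j)
    fix u assume u: "u \<in> pts ts"
    have "form p (op_add H H a b \<circ>\<^bsub>H\<^esub> fst q, snd q) = form p (a \<circ>\<^bsub>H\<^esub> fst q, snd q) + form p (b \<circ>\<^bsub>H\<^esub> fst q, snd q)"
      if "p \<in> set u" "q \<in> set v" for p q
    proof -
      have p: "fst p \<in> A" "snd p \<in> pts K" and q: "fst q \<in> A" "snd q \<in> pts K"
        using ts_mem[OF u that(1)] ts_mem[OF v that(2)] by auto
      have "(adj H H (fst p) \<circ>\<^bsub>H\<^esub> (op_add H H a b \<circ>\<^bsub>H\<^esub> fst q)) =
          op_add H H (adj H H (fst p) \<circ>\<^bsub>H\<^esub> (a \<circ>\<^bsub>H\<^esub> fst q)) (adj H H (fst p) \<circ>\<^bsub>H\<^esub> (b \<circ>\<^bsub>H\<^esub> fst q))"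
        using A_in[OF p(1)] A_in[OF q(1)] A_in[OF a] A_in[OF b]
        by (simp add: op_comp_add_left[of _ H H] op_comp_add_right[of _ H H] op_comp_in[of _ H H] adj_in)
      thus ?thesis using p q a b by (simp add: form_def \<Psi>_add A_closed K.ip_simps \<Psi>_mem)
    qed
    hence "ip ts u (act (op_add H H a b) v) = ip ts u (act a v) + ip ts u (act b v)"
      unfolding ip_act_right sum_list_addf[symmetric] by (intro sum_list_cong) simp
    thus "ip G (j u) (\<sigma> (op_add H H a b) (j v)) = ip G (j u) (op_add G G (\<sigma> a) (\<sigma> b) (j v))"
      using a b ab u v by (simp add: rep_j j_in j_ip act_in G.ip_simps)
  qed (use ab a b v in \<open>auto simp: rep_j j_in act_in G.in_simps\<close>)
qed (use a b in \<open>auto simp: rep_in A_closed op_add_in\<close>)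

lemma rep_scl:
  assumes a: "a \<in> A"
  shows "\<sigma> (op_scl H H c a) = op_scl G G c (\<sigma> a)"
proof (rule op_eqI_j[of _ G])
  have ca: "op_scl H H c a \<in> A" using a by (rule A_closed)
  show "\<sigma> (op_scl H H c a) (j v) = op_scl G G c (\<sigma> a) (j v)" if v: "v \<in> pts ts" for v
  proof (rule eqI_j)
    fix u assume u: "u \<in> pts ts"
    have "form p (op_scl H H c a \<circ>\<^bsub>H\<^esub> fst q, snd q) = c * form p (a \<circ>\<^bsub>H\<^esub> fst q, snd q)"
      if "p \<in> set u" "q \<in> set v" for p q
    proof -
      have p: "fst p \<in> A" "snd p \<in> pts K" and q: "fst q \<in> A" "snd q \<in> pts K"
        using ts_mem[OF u that(1)] ts_mem[OF v that(2)] by auto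
      have "(adj H H (fst p) \<circ>\<^bsub>H\<^esub> (op_scl H H c a \<circ>\<^bsub>H\<^esub> fst q)) =
          op_scl H H c (adj H H (fst p) \<circ>\<^bsub>H\<^esub> (a \<circ>\<^bsub>H\<^esub> fst q))"
        using A_in[OF p(1)] A_in[OF q(1)] A_in[OF a]
        by (simp add: op_comp_scl_left[of _ H H] op_comp_scl_right[of _ H H] op_comp_in[of _ H H] adj_in)
      thus ?thesis using p q a by (simp add: form_def \<Psi>_scl A_closed K.ip_simps \<Psi>_mem)
    qed
    hence "ip ts u (act (op_scl H H c a) v) = c * ip ts u (act a v)"
      unfolding ip_act_right sum_list_const_mult[symmetric] by (intro sum_list_cong) simp
    thus "ip G (j u) (\<sigma> (op_scl H H c a) (j v)) = ip G (j u) (op_scl G G c (\<sigma> a) (j v))"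
      using a ca u v by (simp add: rep_j j_in j_ip act_in G.ip_simps)
  qed (use ca a v in \<open>auto simp: rep_j j_in act_in G.in_simps\<close>)
qed (use a in \<open>auto simp: rep_in A_closed op_scl_in\<close>)

lemma rep_comp:
  assumes a: "a \<in> A" and b: "b \<in> A"
  shows "\<sigma> (a \<circ>\<^bsub>H\<^esub> b) = (\<sigma> a \<circ>\<^bsub>G\<^esub> \<sigma> b)"
proof (rule op_eqI_j[of _ G])
  have "act (a \<circ>\<^bsub>H\<^esub> b) v = act a (act b v)" if "v \<in> pts ts" for v
    using ts_mem[OF that] unfolding act_def by (auto simp: op_comp_assoc[OF A_in])
  thus "\<sigma> (a \<circ>\<^bsub>H\<^esub> b) (j v) = (\<sigma> a \<circ>\<^bsub>G\<^esub> \<sigma> b) (j v)" if "v \<in> pts ts" for v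
    using a b that by (simp add: rep_j A_closed j_in act_in)
qed (use a b in \<open>auto simp: rep_in A_closed op_comp_in[of _ G G]\<close>)

lemma rep_id: "\<sigma> (op_id H) = op_id G"
  by (rule op_eqI_j[of _ G]) (auto simp: rep_in A_closed rep_j act_id j_in)

lemma rep_adj:
  assumes a: "a \<in> A"
  shows "\<sigma> (adj H H a) = adj G G (\<sigma> a)"
proof (rule op_eqI_j[of _ G])
  have a': "adj H H a \<in> A" using a by (rule A_closed)
  show "\<sigma> (adj H H a) (j v) = adj G G (\<sigma> a) (j v)" if v: "v \<in> pts ts" for v
  proof (rule eqI_j)
    fix u assume u: "u \<in> pts ts"
    have "form p (adj H H a \<circ>\<^bsub>H\<^esub> fst q, snd q) = form (a \<circ>\<^bsub>H\<^esub> fst p, snd p) q" if "p \<in> set u" "q \<in> set v" for p q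
    proof -
      have p: "fst p \<in> A" "snd p \<in> pts K" and q: "fst q \<in> A" "snd q \<in> pts K"
        using ts_mem[OF u that(1)] ts_mem[OF v that(2)] by auto
      show ?thesis
        using adj_comp[OF H H ips(1) A_in[OF p(1)] A_in[OF a]] A_in[OF q(1)]
        by (simp add: form_def op_comp_assoc[of _ H H])
    qed
    hence "ip ts u (act (adj H H a) v) = ip ts (act a u) v"
      unfolding ts_ip act_def map_map o_def by (intro sum_list_cong) simp
    thus "ip G (j u) (\<sigma> (adj H H a) (j v)) = ip G (j u) (adj G G (\<sigma> a) (j v))"
      using a a' u v by (simp add: rep_j j_in j_ip act_in ip_adj rep_in)
  qed (use a a' v in \<open>auto simp: rep_in j_in intro!: bounded_ops_mem[OF rep_in] bounded_ops_mem[OF adj_in]\<close>)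
qed (use a in \<open>auto simp: rep_in A_closed adj_in\<close>)

lemma rep_star_hom: "star_hom H A G (bounded_ops G G) \<sigma>"
  unfolding star_hom_def using rep_in rep_add rep_scl rep_comp rep_adj by blast

text \<open>On the dense set of tensors this is \<open>cp_conjugate\<close> once more.  It makes \<open>\<sigma> \<circ> \<Phi>\<close> completely positive,
  so that the next level of the tower exists.\<close>

lemma rep_completely_positive: "completely_positive H A G \<sigma>"
proof -
  have "positive_matrix G n (\<lambda>i k. \<sigma> (a i k))"
    if aA: "\<forall>i<n. \<forall>k<n. a i k \<in> A" and pos: "positive_matrix H n a" for n a
    unfolding positive_matrix_def
  proof (intro allI impI)
    fix g assume g: "\<forall>i<n. g i \<in> pts G"
    have "\<exists>u. (\<forall>m. u m \<in> pts ts) \<and> (\<lambda>m. hnorm G (diff G (j (u m)) (g i))) \<longlonglongrightarrow> 0" if "i < n" for i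
      using j_approx[of "g i"] g that by metis
    then obtain u where u: "\<And>i m. i < n \<Longrightarrow> u i m \<in> pts ts"
      "\<And>i. i < n \<Longrightarrow> (\<lambda>m. hnorm G (diff G (j (u i m)) (g i))) \<longlonglongrightarrow> 0" by metis
    have lim: "(\<lambda>m. \<Sum>i<n. \<Sum>k<n. ip G (j (u i m)) (\<sigma> (a i k) (j (u k m)))) \<longlonglongrightarrow> (\<Sum>i<n. \<Sum>k<n. ip G (g i) (\<sigma> (a i k) (g k)))"
    proof (intro tendsto_sum)
      fix i k assume ik: "i \<in> {..<n}" "k \<in> {..<n}"
      have s: "\<sigma> (a i k) \<in> bounded_ops G G" using aA ik by (simp add: rep_in)
      show "(\<lambda>m. ip G (j (u i m)) (\<sigma> (a i k) (j (u k m)))) \<longlonglongrightarrow> ip G (g i) (\<sigma> (a i k) (g k))"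
      proof (rule G.ip_tendsto)
        show "(\<lambda>m. hnorm G (diff G (\<sigma> (a i k) (j (u k m))) (\<sigma> (a i k) (g k)))) \<longlonglongrightarrow> 0"
          by (rule bounded_ops_tendsto[OF s]) (use ik u g in \<open>auto simp: j_in\<close>)
      qed (use ik u g s in \<open>auto simp: j_in bounded_ops_mem\<close>)
    qed
    have nn: "(\<Sum>i<n. \<Sum>k<n. ip G (j (u i m)) (\<sigma> (a i k) (j (u k m)))) \<in> \<real>\<^sub>\<ge>\<^sub>0" for m
    proof -
      have "(\<Sum>i<n. \<Sum>k<n. ip G (j (u i m)) (\<sigma> (a i k) (j (u k m)))) = (\<Sum>i<n. \<Sum>k<n. ip ts (u i m) (act (a i k) (u k m)))"
        using aA u(1) by (intro sum.cong refl) (simp add: rep_j j_ip act_in)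
      also have "\<dots> \<in> \<real>\<^sub>\<ge>\<^sub>0" by (rule cp_conjugate_ts[OF _ pos]) (use aA u(1) in simp_all)
      finally show ?thesis .
    qed
    show "(\<Sum>i<n. \<Sum>k<n. ip G (g i) (\<sigma> (a i k) (g k))) \<in> \<real>\<^sub>\<ge>\<^sub>0"
      using closed_nonneg_Reals_complex nn lim by (rule closed_sequentially)
  qed
  thus ?thesis unfolding completely_positive_def using rep_in rep_add rep_scl by blast
qed

abbreviation "W \<equiv> stinespring_isometry H A K \<Psi>"

lemma W_apply: "\<xi> \<in> pts K \<Longrightarrow> W \<xi> = j [(op_id H, \<xi>)]"
  by (simp add: stinespring_isometry_def elementary_j)

lemma unit_tensor_in: "\<xi> \<in> pts K \<Longrightarrow> [(op_id H, \<xi>)] \<in> pts ts"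
  by (simp add: ts_pts A_closed)

lemma compression:
  assumes a: "a \<in> A" and "\<xi> \<in> pts K" "\<eta> \<in> pts K"
  shows "ip G (W \<xi>) (\<sigma> a (W \<eta>)) = ip K \<xi> (\<Psi> a \<eta>)"
proof -
  have "(adj H H (op_id H) \<circ>\<^bsub>H\<^esub> (a \<circ>\<^bsub>H\<^esub> op_id H)) = a"
    using A_in[OF a] by (simp add: adj_id op_comp_id op_id_comp[of _ H H])
  thus ?thesis using assms
    by (simp add: W_apply rep_j unit_tensor_in j_ip act_in ip_act_right form_def)
qed

lemma W_ip: "\<lbrakk>\<xi> \<in> pts K; \<eta> \<in> pts K\<rbrakk> \<Longrightarrow> ip G (W \<xi>) (W \<eta>) = ip K \<xi> \<eta>"
  using compression[OF A_closed(1), of \<xi> \<eta>] unital by (simp add: rep_id W_apply unit_tensor_in j_in unital_def)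

lemma W_isometry: "isometry K G W"
proof -
  have mem: "W \<xi> \<in> pts G" if "\<xi> \<in> pts K" for \<xi> using that by (simp add: W_apply unit_tensor_in j_in)
  have norm: "hnorm G (W \<xi>) = hnorm K \<xi>" if "\<xi> \<in> pts K" for \<xi> using that by (simp add: hnorm_def W_ip)
  have form_add: "ip G (j u) (W (add K \<xi> \<eta>)) = ip G (j u) (add G (W \<xi>) (W \<eta>))"
    if u: "u \<in> pts ts" and "\<xi> \<in> pts K" "\<eta> \<in> pts K" for u \<xi> \<eta>
  proof -
    have "form p (op_id H, add K \<xi> \<eta>) = form p (op_id H, \<xi>) + form p (op_id H, \<eta>)" if "p \<in> set u" for p
      using ts_mem[OF u that] \<open>\<xi> \<in> pts K\<close> \<open>\<eta> \<in> pts K\<close>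
      by (simp add: form_def bounded_ops_add[OF \<Psi>_in] A_closed K.ip_simps \<Psi>_mem)
    hence "(\<Sum>p\<leftarrow>u. form p (op_id H, add K \<xi> \<eta>)) = (\<Sum>p\<leftarrow>u. form p (op_id H, \<xi>) + form p (op_id H, \<eta>))"
      by (rule sum_list_cong)
    thus ?thesis using that
      by (simp add: W_apply unit_tensor_in j_in j_ip G.ip_simps K.in_simps ts_ip sum_list_addf)
  qed
  have scl: "W (scl K c \<xi>) = scl G c (W \<xi>)" if "\<xi> \<in> pts K" for c \<xi>
    using that j_scl[OF unit_tensor_in[OF that], of c] by (simp add: W_apply K.in_simps ts_scl)
  have "W \<in> bounded_ops K G"
  proof (rule bounded_opsI[where B=1])
    show "W \<in> pts K \<rightarrow>\<^sub>E pts G" using mem by (auto simp: stinespring_isometry_def)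
    show "W (add K \<xi> \<eta>) = add G (W \<xi>) (W \<eta>)" if "\<xi> \<in> pts K" "\<eta> \<in> pts K" for \<xi> \<eta>
      by (rule eqI_j) (use that mem form_add in \<open>simp_all add: K.in_simps G.in_simps\<close>)
  qed (simp_all add: scl norm)
  thus ?thesis using norm by (simp add: isometry_def)
qed

end

section \<open>Direct sums\<close>

locale hilbert_family =
  fixes L :: "nat \<Rightarrow> 'v hspace"
  assumes family: "hilbert_space (L n)"
begin

sublocale L: hilbert_space "L n" for n by (rule family)

abbreviation "D \<equiv> direct_sum L"

lemma D_simps:
  "zero D = (\<lambda>n. zero (L n))" "add D f g = (\<lambda>n. add (L n) (f n) (g n))"
  "scl D c f = (\<lambda>n. scl (L n) c (f n))" "diff D f g = (\<lambda>n. diff (L n) (f n) (g n))"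
  "ip D f g = (\<Sum>n. ip (L n) (f n) (g n))"
  by (simp_all add: direct_sum_def diff_def)

lemma D_pts: "f \<in> pts D \<longleftrightarrow> (\<forall>n. f n \<in> pts (L n)) \<and> summable (\<lambda>n. (hnorm (L n) (f n))\<^sup>2)"
  by (simp add: direct_sum_def)

lemma D_mem: "f \<in> pts D \<Longrightarrow> f n \<in> pts (L n)"
  by (simp add: D_pts)

lemma D_summable: "f \<in> pts D \<Longrightarrow> summable (\<lambda>n. (hnorm (L n) (f n))\<^sup>2)"
  by (simp add: D_pts)

lemma D_ptsI:
  assumes "\<And>n. f n \<in> pts (L n)" "summable b" "\<And>n. (hnorm (L n) (f n))\<^sup>2 \<le> b n"
  shows "f \<in> pts D"
  unfolding D_pts
proof (intro conjI allI)
  show "summable (\<lambda>n. (hnorm (L n) (f n))\<^sup>2)"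
    by (rule summable_comparison_test'[OF assms(2), of 0]) (use assms(3) in simp)
qed (rule assms(1))

lemma hnorm_add_sq:
  assumes "x \<in> pts (L n)" "y \<in> pts (L n)"
  shows "(hnorm (L n) (add (L n) x y))\<^sup>2 \<le> 2 * (hnorm (L n) x)\<^sup>2 + 2 * (hnorm (L n) y)\<^sup>2"
  using L.parallelogram[OF assms] zero_le_power2[of "hnorm (L n) (diff (L n) x y)"] by linarith

lemma D_add: "\<lbrakk>f \<in> pts D; g \<in> pts D\<rbrakk> \<Longrightarrow> add D f g \<in> pts D"
  by (rule D_ptsI[of _ "\<lambda>n. 2 * (hnorm (L n) (f n))\<^sup>2 + 2 * (hnorm (L n) (g n))\<^sup>2"])
     (auto simp: D_simps D_mem L.in_simps hnorm_add_sq intro!: summable_add summable_mult D_summable)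

lemma D_scl: "f \<in> pts D \<Longrightarrow> scl D c f \<in> pts D"
  by (rule D_ptsI[of _ "\<lambda>n. (cmod c)\<^sup>2 * (hnorm (L n) (f n))\<^sup>2"])
     (auto simp: D_simps D_mem L.in_simps L.hnorm_scl power_mult_distrib intro!: summable_mult D_summable)

lemma D_ip_sums:
  assumes f: "f \<in> pts D" and g: "g \<in> pts D"
  shows "(\<lambda>n. ip (L n) (f n) (g n)) sums ip D f g"
proof -
  have "summable (\<lambda>n. (hnorm (L n) (f n))\<^sup>2 + (hnorm (L n) (g n))\<^sup>2)"
    using f g by (intro summable_add D_summable)
  moreover have "norm (ip (L n) (f n) (g n)) \<le> (hnorm (L n) (f n))\<^sup>2 + (hnorm (L n) (g n))\<^sup>2" for n
  proof -
    have "norm (ip (L n) (f n) (g n)) \<le> hnorm (L n) (f n) * hnorm (L n) (g n)"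
      using L.cauchy_schwarz f g D_mem by blast
    also have "\<dots> \<le> (hnorm (L n) (f n))\<^sup>2 + (hnorm (L n) (g n))\<^sup>2"
      using sum_squares_bound[of "hnorm (L n) (f n)" "hnorm (L n) (g n)"]
        mult_nonneg_nonneg[OF L.hnorm_ge_0[OF D_mem[OF f]] L.hnorm_ge_0[OF D_mem[OF g]], of n n] by linarith
    finally show ?thesis .
  qed
  ultimately have "summable (\<lambda>n. ip (L n) (f n) (g n))"
    by (rule summable_comparison_test'[where N=0])
  thus ?thesis by (simp add: D_simps summable_sums)
qed

lemma D_norm_sums:
  assumes f: "f \<in> pts D" shows "(\<lambda>n. (hnorm (L n) (f n))\<^sup>2) sums (Re (ip D f f))"
  using sums_Re[OF D_ip_sums[OF f f]] D_mem[OF f] by (simp add: L.hnorm_sq)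

definition single :: "nat \<Rightarrow> 'v \<Rightarrow> nat \<Rightarrow> 'v" where
  "single n x = (\<lambda>k. if k = n then x else zero (L k))"

lemma single_in: "x \<in> pts (L n) \<Longrightarrow> single n x \<in> pts D"
  by (rule D_ptsI[of _ "\<lambda>k. if k = n then (hnorm (L n) x)\<^sup>2 else 0"])
     (auto simp: single_def L.in_simps L.hnorm_zero intro: sums_summable[OF sums_single])

lemma ip_single: "\<lbrakk>x \<in> pts (L n); f \<in> pts D\<rbrakk> \<Longrightarrow> ip D (single n x) f = ip (L n) x (f n)"
proof -
  assume x: "x \<in> pts (L n)" and f: "f \<in> pts D"
  have "(\<lambda>k. ip (L k) (single n x k) (f k)) = (\<lambda>k. if k = n then ip (L k) x (f k) else 0)"
    by (auto simp: single_def L.ip_zero_left D_mem[OF f])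
  hence "(\<lambda>k. ip (L k) (single n x k) (f k)) sums ip (L n) x (f n)"
    using sums_single[of n "\<lambda>k. ip (L k) x (f k)"] by simp
  thus ?thesis using D_ip_sums[OF single_in[OF x] f] sums_unique2 by blast
qed

lemma inner_product_space_D: "inner_product_space D"
proof (rule inner_product_spaceI)
  show "semi_inner_product_space D"
  proof
    show "zero D \<in> pts D"
      by (rule D_ptsI[of _ "\<lambda>_. 0"]) (auto simp: D_simps L.in_simps L.hnorm_zero)
    show "ip D y x = cnj (ip D x y)" if "x \<in> pts D" "y \<in> pts D" for x y
    proof -
      have "(\<lambda>n. ip (L n) (y n) (x n)) = (\<lambda>n. cnj (ip (L n) (x n) (y n)))"
        by (intro ext L.ip_cnj D_mem that)
      hence "(\<lambda>n. ip (L n) (y n) (x n)) sums cnj (ip D x y)"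
        using D_ip_sums[OF that] by (simp add: sums_cnj)
      thus ?thesis by (rule sums_unique2[OF D_ip_sums[OF that(2,1)]])
    qed
    show "ip D x (add D y z) = ip D x y + ip D x z" if "x \<in> pts D" "y \<in> pts D" "z \<in> pts D" for x y z
    proof -
      have "(\<lambda>n. ip (L n) (x n) (add D y z n)) sums (ip D x y + ip D x z)"
        using sums_add[OF D_ip_sums[OF that(1,2)] D_ip_sums[OF that(1,3)]] that
        by (simp add: D_simps(2) L.ip_simps D_mem)
      thus ?thesis by (rule sums_unique2[OF D_ip_sums[OF that(1) D_add[OF that(2,3)]]])
    qed
    show "ip D x (scl D c y) = c * ip D x y" if "x \<in> pts D" "y \<in> pts D" for x y c
    proof -
      have "(\<lambda>n. ip (L n) (x n) (scl D c y n)) sums (c * ip D x y)"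
        using sums_mult[OF D_ip_sums[OF that], of c] that by (simp add: D_simps(3) L.ip_simps D_mem)
      thus ?thesis by (rule sums_unique2[OF D_ip_sums[OF that(1) D_scl[OF that(2)]]])
    qed
    show "ip D x (zero D) = 0" if "x \<in> pts D" for x
      using that by (simp add: D_simps L.ip_simps D_mem)
    show "0 \<le> Re (ip D x x)" if "x \<in> pts D" for x
      by (rule sums_le[OF _ sums_zero D_norm_sums[OF that]]) simp
  qed (rule D_add D_scl; assumption)+
  show "f = g" if fg: "f \<in> pts D" "g \<in> pts D" and eq: "\<And>z. z \<in> pts D \<Longrightarrow> ip D z f = ip D z g" for f g
  proof
    fix n show "f n = g n"
    proof (rule L.vec_eqI)
      show "ip (L n) z (f n) = ip (L n) z (g n)" if "z \<in> pts (L n)" for z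
        using eq[OF single_in[OF that]] ip_single[OF that] fg by simp
    qed (use fg D_mem in auto)
  qed
qed

sublocale D: inner_product_space D by (rule inner_product_space_D)

lemma D_hnorm_sums: "f \<in> pts D \<Longrightarrow> (\<lambda>n. (hnorm (L n) (f n))\<^sup>2) sums (hnorm D f)\<^sup>2"
  using D_norm_sums by (simp add: D.hnorm_sq)

lemma partial_sum_le: "f \<in> pts D \<Longrightarrow> (\<Sum>n<m. (hnorm (L n) (f n))\<^sup>2) \<le> (hnorm D f)\<^sup>2"
  using sum_le_suminf[OF D_summable, of f "{..<m}"] sums_unique[OF D_hnorm_sums, of f] by simp

lemma component_le:
  assumes f: "f \<in> pts D" shows "hnorm (L n) (f n) \<le> hnorm D f"
proof (rule power2_le_imp_le)
  have "(hnorm (L n) (f n))\<^sup>2 \<le> (\<Sum>k<Suc n. (hnorm (L k) (f k))\<^sup>2)" by (simp add: sum_nonneg)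
  also have "\<dots> \<le> (hnorm D f)\<^sup>2" by (rule partial_sum_le[OF f])
  finally show "(hnorm (L n) (f n))\<^sup>2 \<le> (hnorm D f)\<^sup>2" .
qed (use f in simp)

text \<open>The componentwise limits of a Cauchy sequence satisfy the Cauchy estimate for every partial sum,
  uniformly in its length.\<close>

theorem hilbert_space_D: "hilbert_space D"
proof (rule hilbert_spaceI[OF inner_product_space_D])
  fix X :: "nat \<Rightarrow> nat \<Rightarrow> 'v"
  assume X: "\<And>k. X k \<in> pts D"
    and cau: "\<And>e. e > 0 \<Longrightarrow> \<exists>N. \<forall>m\<ge>N. \<forall>n\<ge>N. hnorm D (diff D (X m) (X n)) < e"
  have Xm: "X k n \<in> pts (L n)" for k n by (rule D_mem[OF X])
  have comp: "hnorm (L n) (diff (L n) (X i n) (X k n)) \<le> hnorm D (diff D (X i) (X k))" for n i k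
    using component_le[OF D.diff_in[OF X[of i] X[of k]], of n] by (simp add: D_simps)
  have "\<exists>y\<in>pts (L n). (\<lambda>k. hnorm (L n) (diff (L n) (X k n) y)) \<longlonglongrightarrow> 0" for n
  proof (rule L.cauchy_convergent[of "\<lambda>k. X k n" n])
    fix e :: real assume "e > 0"
    then obtain N where N: "\<forall>i\<ge>N. \<forall>k\<ge>N. hnorm D (diff D (X i) (X k)) < e" using cau by blast
    show "\<exists>N. \<forall>i\<ge>N. \<forall>k\<ge>N. hnorm (L n) (diff (L n) (X i n) (X k n)) < e"
      using N comp le_less_trans by blast
  qed (use Xm in auto)
  then obtain y where y: "\<And>n. y n \<in> pts (L n)"
    and lim: "\<And>n. (\<lambda>k. hnorm (L n) (diff (L n) (X k n) (y n))) \<longlonglongrightarrow> 0" by metis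
  have part: "\<exists>N. \<forall>k\<ge>N. \<forall>m. (\<Sum>n<m. (hnorm (L n) (diff (L n) (X k n) (y n)))\<^sup>2) \<le> e\<^sup>2" if e: "e > 0" for e :: real
  proof -
    obtain N where N: "\<forall>i\<ge>N. \<forall>k\<ge>N. hnorm D (diff D (X i) (X k)) < e" using cau[OF e] by blast
    have "(\<Sum>n<m. (hnorm (L n) (diff (L n) (X k n) (y n)))\<^sup>2) \<le> e\<^sup>2" if k: "k \<ge> N" for k m
    proof (rule LIMSEQ_le_const2)
      have l: "(\<lambda>i. hnorm (L n) (diff (L n) (X k n) (X i n))) \<longlonglongrightarrow> hnorm (L n) (diff (L n) (X k n) (y n))" for n
      proof (rule L.hnorm_tendsto)
        have "hnorm (L n) (diff (L n) (diff (L n) (X k n) (X i n)) (diff (L n) (X k n) (y n)))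
            = hnorm (L n) (diff (L n) (X i n) (y n))" for i
        proof -
          have "hnorm (L n) (diff (L n) (diff (L n) (X k n) (X i n)) (diff (L n) (X k n) (y n)))
            = hnorm (L n) (diff (L n) (y n) (X i n))"
            by (rule L.hnorm_eq_of_ip) (use Xm y in \<open>simp_all add: L.in_simps L.ip_simps\<close>)
          thus ?thesis using L.hnorm_diff_commute[OF Xm[of i n] y[of n]] by simp
        qed
        thus "(\<lambda>i. hnorm (L n) (diff (L n) (diff (L n) (X k n) (X i n)) (diff (L n) (X k n) (y n)))) \<longlonglongrightarrow> 0"
          using lim[of n] by simp
      qed (use Xm y in \<open>simp_all add: L.in_simps\<close>)
      show "(\<lambda>i. \<Sum>n<m. (hnorm (L n) (diff (L n) (X k n) (X i n)))\<^sup>2) \<longlonglongrightarrow>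
          (\<Sum>n<m. (hnorm (L n) (diff (L n) (X k n) (y n)))\<^sup>2)"
        by (intro tendsto_sum tendsto_power l)
      have "(\<Sum>n<m. (hnorm (L n) (diff (L n) (X k n) (X i n)))\<^sup>2) \<le> e\<^sup>2" if i: "i \<ge> N" for i
      proof -
        have "(\<Sum>n<m. (hnorm (L n) (diff (L n) (X k n) (X i n)))\<^sup>2) \<le> (hnorm D (diff D (X k) (X i)))\<^sup>2"
          using partial_sum_le[OF D.diff_in[OF X[of k] X[of i]], of m] by (simp add: D_simps)
        also have "\<dots> \<le> e\<^sup>2"
          using N k i X by (intro power_mono) (auto simp: D.diff_in less_imp_le)
        finally show ?thesis .
      qed
      thus "\<exists>N. \<forall>i\<ge>N. (\<Sum>n<m. (hnorm (L n) (diff (L n) (X k n) (X i n)))\<^sup>2) \<le> e\<^sup>2" by blast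
    qed
    thus ?thesis by blast
  qed
  have summ: "summable (\<lambda>n. (hnorm (L n) (diff (L n) (X k n) (y n)))\<^sup>2)"
    "(\<Sum>n. (hnorm (L n) (diff (L n) (X k n) (y n)))\<^sup>2) \<le> e\<^sup>2"
    if "\<forall>m. (\<Sum>n<m. (hnorm (L n) (diff (L n) (X k n) (y n)))\<^sup>2) \<le> e\<^sup>2" for k and e :: real
  proof -
    show 1: "summable (\<lambda>n. (hnorm (L n) (diff (L n) (X k n) (y n)))\<^sup>2)"
      by (rule summableI_nonneg_bounded[where x="e\<^sup>2"]) (use that in simp_all)
    show "(\<Sum>n. (hnorm (L n) (diff (L n) (X k n) (y n)))\<^sup>2) \<le> e\<^sup>2"
      by (rule suminf_le_const[OF 1]) (use that in blast)
  qed
  have yD: "y \<in> pts D"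
  proof -
    obtain k where k: "\<forall>m. (\<Sum>n<m. (hnorm (L n) (diff (L n) (X k n) (y n)))\<^sup>2) \<le> 1\<^sup>2"
      using part[of 1] by auto
    show ?thesis
    proof (rule D_ptsI[OF y])
      show "summable (\<lambda>n. 2 * (hnorm (L n) (diff (L n) (X k n) (y n)))\<^sup>2 + 2 * (hnorm (L n) (X k n))\<^sup>2)"
        by (intro summable_add summable_mult summ(1)[OF k] D_summable X)
      show "(hnorm (L n) (y n))\<^sup>2 \<le> 2 * (hnorm (L n) (diff (L n) (X k n) (y n)))\<^sup>2 + 2 * (hnorm (L n) (X k n))\<^sup>2" for n
      proof -
        have "hnorm (L n) (y n) = hnorm (L n) (add (L n) (diff (L n) (y n) (X k n)) (X k n))"
          by (rule L.hnorm_eq_of_ip) (use Xm y in \<open>simp_all add: L.in_simps L.ip_simps\<close>)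
        thus ?thesis using hnorm_add_sq[OF L.diff_in[OF y[of n] Xm[of k n]] Xm[of k n]] L.hnorm_diff_commute[OF Xm[of k n] y[of n]] by simp
      qed
    qed
  qed
  have "(\<lambda>k. hnorm D (diff D (X k) y)) \<longlonglongrightarrow> 0"
  proof (rule LIMSEQ_I)
    fix e :: real assume e: "e > 0"
    obtain N where N: "\<forall>k\<ge>N. \<forall>m. (\<Sum>n<m. (hnorm (L n) (diff (L n) (X k n) (y n)))\<^sup>2) \<le> (e / 2)\<^sup>2"
      using part[OF half_gt_zero[OF e]] by blast
    have "hnorm D (diff D (X k) y) < e" if k: "k \<ge> N" for k
    proof -
      have "(hnorm D (diff D (X k) y))\<^sup>2 \<le> (e / 2)\<^sup>2"
        using summ(2)[OF N[rule_format, OF k, THEN allI]] sums_unique[OF D_hnorm_sums[OF D.diff_in[OF X yD]], of k]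
        by (simp add: D_simps)
      hence "hnorm D (diff D (X k) y) \<le> e / 2" by (rule power2_le_imp_le) (use e in simp)
      thus ?thesis using e by simp
    qed
    thus "\<exists>N. \<forall>k\<ge>N. norm (hnorm D (diff D (X k) y) - 0) < e"
      using D.hnorm_ge_0[OF D.diff_in[OF X yD]] by (intro exI[of _ N]) simp
  qed
  thus "\<exists>x\<in>pts D. (\<lambda>k. hnorm D (diff D (X k) x)) \<longlonglongrightarrow> 0" using yD by blast
qed

end


section \<open>The tower of dilations\<close>

lemma (in inner_product_space) add_zero_zero: "add H (zero H) (zero H) = zero H"
  by (rule add_zero[OF zero_in])

lemma (in inner_product_space) scl_zero: "scl H c (zero H) = zero H"
  by (rule vec_eqI) (simp_all add: in_simps ip_simps)

text \<open>The properties of \<open>\<sigma>\<^sub>n\<close> that are carried through the recursion.  Complete positivity makes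
  \<open>\<sigma>\<^sub>n \<circ> \<Phi>\<close> dilatable, and contractivity makes the direct sum of the \<open>\<sigma>\<^sub>n(a)\<close> bounded.\<close>

definition dilatable_rep :: "'h hspace \<Rightarrow> 'h op set \<Rightarrow> 'w hspace \<Rightarrow> ('h op \<Rightarrow> 'w op) \<Rightarrow> bool" where
  "dilatable_rep H A K \<sigma> \<longleftrightarrow> hilbert_space K \<and> star_hom H A K (bounded_ops K K) \<sigma>
     \<and> \<sigma> (op_id H) = op_id K \<and> completely_positive H A K \<sigma>
     \<and> (\<forall>a\<in>A. \<forall>B\<ge>0. (\<forall>x\<in>pts H. hnorm H (a x) \<le> B * hnorm H x) \<longrightarrow>
          (\<forall>y\<in>pts K. hnorm K (\<sigma> a y) \<le> B * hnorm K y))"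

lemma dilatable_rep_transport:
  assumes H: "hilbert_space H" and A: "unital_cstar_algebra H A" and f: "inj f"
  shows "dilatable_rep H A (transport f H) (transport_op f H)"
proof -
  interpret H: hilbert_space H by (rule H)
  let ?K = "transport f H" and ?\<sigma> = "transport_op f H"
  note t = transport_simps[OF f]
  interpret K: hilbert_space ?K by (rule hilbert_space_transport[OF H f])
  note ips = H.inner_product_space_axioms K.inner_product_space_axioms
  have s: "?\<sigma> a (f x) = f (a x)" if "x \<in> pts H" for a x
    using that by (simp add: transport_op_def inv_f_f[OF f])
  have sb: "?\<sigma> a \<in> bounded_ops ?K ?K" if a: "a \<in> bounded_ops H H" for a
  proof -
    obtain B where B: "\<And>x. x \<in> pts H \<Longrightarrow> hnorm H (a x) \<le> B * hnorm H x"
      using bounded_ops_bound[OF a H.semi_inner_product_space_axioms] by metis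
    show ?thesis
    proof (rule bounded_opsI[where B=B])
      show "?\<sigma> a \<in> pts ?K \<rightarrow>\<^sub>E pts ?K"
        using a by (auto simp: t(1) s bounded_ops_mem) (auto simp: transport_op_def)
    qed (use a B in \<open>auto simp: t s bounded_ops_mem bounded_ops_add bounded_ops_scl H.in_simps\<close>)
  qed
  have eqI: "S = T" if "S \<in> bounded_ops ?K ?K" "T \<in> bounded_ops ?K ?K" "\<And>x. x \<in> pts H \<Longrightarrow> S (f x) = T (f x)" for S T
    by (rule op_eqI[OF that(1,2)]) (use that(3) in \<open>auto simp: t(1)\<close>)
  note Ab = unital_cstar_algebraD(1)[OF A]
  have add: "?\<sigma> (op_add H H a b) = op_add ?K ?K (?\<sigma> a) (?\<sigma> b)" if "a \<in> A" "b \<in> A" for a b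
    by (rule eqI) (use that ips Ab in \<open>auto simp: t s sb op_add_in\<close>)
  have scl: "?\<sigma> (op_scl H H c a) = op_scl ?K ?K c (?\<sigma> a)" if "a \<in> A" for c a
    by (rule eqI) (use that ips Ab in \<open>auto simp: t s sb op_scl_in\<close>)
  have comp: "?\<sigma> (a \<circ>\<^bsub>H\<^esub> b) = (?\<sigma> a \<circ>\<^bsub>?K\<^esub> ?\<sigma> b)" if "a \<in> A" "b \<in> A" for a b
    by (rule eqI) (use that ips Ab in \<open>auto simp: t s sb op_comp_in[of _ H H] op_comp_in[of _ ?K ?K] bounded_ops_mem[of _ H H]\<close>)
  have adj: "?\<sigma> (adj H H a) = adj ?K ?K (?\<sigma> a)" if "a \<in> A" for a
  proof (rule adj_eqI[OF ips(2), symmetric])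
    note a = Ab[OF that]
    show "?\<sigma> (adj H H a) \<in> bounded_ops ?K ?K" using a ips H by (intro sb adj_in)
    fix x y assume "x \<in> pts ?K" "y \<in> pts ?K"
    then obtain x' y' where xy: "x = f x'" "y = f y'" "x' \<in> pts H" "y' \<in> pts H" unfolding t by blast
    show "ip ?K x (?\<sigma> (adj H H a) y) = ip ?K (?\<sigma> a x) y"
      unfolding xy s[OF xy(3)] s[OF xy(4)] t using ip_adj[OF H ips(1) a xy(3,4)] .
  qed
  have star: "star_hom H A ?K (bounded_ops ?K ?K) ?\<sigma>"
    unfolding star_hom_def using sb Ab add scl comp adj by blast
  have "positive_matrix ?K n (\<lambda>i j. ?\<sigma> (a i j))" if pos: "positive_matrix H n a" for n a
    unfolding positive_matrix_def
  proof (intro allI impI)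
    fix \<xi> assume "\<forall>i<n. \<xi> i \<in> pts ?K"
    hence "\<forall>i<n. \<exists>x\<in>pts H. \<xi> i = f x" unfolding t by blast
    then obtain \<eta> where \<eta>: "\<And>i. i < n \<Longrightarrow> \<eta> i \<in> pts H \<and> \<xi> i = f (\<eta> i)" by metis
    have "(\<Sum>i<n. \<Sum>j<n. ip ?K (\<xi> i) (?\<sigma> (a i j) (\<xi> j))) = (\<Sum>i<n. \<Sum>j<n. ip H (\<eta> i) (a i j (\<eta> j)))"
      using \<eta> by (intro sum.cong refl) (simp add: s t)
    thus "(\<Sum>i<n. \<Sum>j<n. ip ?K (\<xi> i) (?\<sigma> (a i j) (\<xi> j))) \<in> \<real>\<^sub>\<ge>\<^sub>0"
      using pos \<eta> unfolding positive_matrix_def by simp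
  qed
  hence cp: "completely_positive H A ?K ?\<sigma>"
    unfolding completely_positive_def using sb Ab add scl by blast
  have id: "?\<sigma> (op_id H) = op_id ?K"
    by (rule eqI) (use ips in \<open>auto simp: t s sb\<close>)
  have "hnorm ?K (?\<sigma> a y) \<le> B * hnorm ?K y"
    if "\<forall>x\<in>pts H. hnorm H (a x) \<le> B * hnorm H x" "y \<in> pts ?K" for a B y
    using that by (auto simp: t s)
  thus ?thesis unfolding dilatable_rep_def
    using star cp id K.hilbert_space_axioms by blast
qed

lemma completely_positive_comp:
  assumes \<Phi>: "completely_positive H A H \<Phi>" "\<Phi> \<in> A \<rightarrow> A" and \<sigma>: "completely_positive H A K \<sigma>"
  shows "completely_positive H A K (\<sigma> \<circ> \<Phi>)"
proof -
  have "positive_matrix K n (\<lambda>i j. (\<sigma> \<circ> \<Phi>) (a i j))"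
    if a: "\<forall>i<n. \<forall>j<n. a i j \<in> A" and pos: "positive_matrix H n a" for n a
  proof -
    have "positive_matrix H n (\<lambda>i j. \<Phi> (a i j))" using \<Phi>(1) a pos unfolding completely_positive_def by blast
    moreover have "\<forall>i<n. \<forall>j<n. \<Phi> (a i j) \<in> A" using a \<Phi>(2) by blast
    moreover have "\<forall>n a. (\<forall>i<n. \<forall>j<n. a i j \<in> A) \<longrightarrow> positive_matrix H n a \<longrightarrow> positive_matrix K n (\<lambda>i j. \<sigma> (a i j))"
      using \<sigma> unfolding completely_positive_def by (elim conjE)
    from spec[OF spec[OF this], of n "\<lambda>i j. \<Phi> (a i j)"]
    have "(\<forall>i<n. \<forall>j<n. \<Phi> (a i j) \<in> A) \<longrightarrow> positive_matrix H n (\<lambda>i j. \<Phi> (a i j)) \<longrightarrow>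
        positive_matrix K n (\<lambda>i j. \<sigma> (\<Phi> (a i j)))" .
    ultimately show ?thesis by simp
  qed
  moreover have "(\<sigma> \<circ> \<Phi>) \<in> A \<rightarrow> bounded_ops K K" using \<Phi>(2) \<sigma> unfolding completely_positive_def by auto
  moreover have "(\<sigma> \<circ> \<Phi>) (op_add H H a b) = op_add K K ((\<sigma> \<circ> \<Phi>) a) ((\<sigma> \<circ> \<Phi>) b)" if "a \<in> A" "b \<in> A" for a b
  proof -
    have "\<Phi> a \<in> A" "\<Phi> b \<in> A" using that \<Phi>(2) by auto
    thus ?thesis using \<Phi>(1) \<sigma> that unfolding completely_positive_def by simp
  qed
  moreover have "(\<sigma> \<circ> \<Phi>) (op_scl H H c a) = op_scl K K c ((\<sigma> \<circ> \<Phi>) a)" if "a \<in> A" for c a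
  proof -
    have "\<Phi> a \<in> A" using that \<Phi>(2) by auto
    thus ?thesis using \<Phi>(1) \<sigma> that unfolding completely_positive_def by simp
  qed
  ultimately show ?thesis unfolding completely_positive_def by blast
qed

locale cp_tower =
  fixes H :: "'h hspace" and A :: "'h op set" and \<Phi> :: "'h op \<Rightarrow> 'h op"
  assumes H: "hilbert_space H" and A: "unital_cstar_algebra H A" and \<Phi>_A: "\<Phi> \<in> A \<rightarrow> A"
    and \<Phi>_cp: "completely_positive H A H \<Phi>" and \<Phi>_unital: "unital H H \<Phi>"
begin

sublocale H: hilbert_space H by (rule H)

abbreviation "Hn \<equiv> tower_space H A \<Phi>"
abbreviation "\<sigma> \<equiv> tower_rep H A \<Phi>"
abbreviation "Vn \<equiv> tower_isometry H A \<Phi>"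

lemma stinespring_step:
  assumes "dilatable_rep H A K \<rho>" shows "stinespring H A K (\<rho> \<circ> \<Phi>)"
proof (rule stinespring.intro)
  show "hilbert_space K" using assms by (simp add: dilatable_rep_def)
  show "completely_positive H A K (\<rho> \<circ> \<Phi>)"
    using assms by (intro completely_positive_comp[OF \<Phi>_cp \<Phi>_A]) (simp add: dilatable_rep_def)
  show "unital H K (\<rho> \<circ> \<Phi>)" using assms \<Phi>_unital by (simp add: dilatable_rep_def unital_def)
qed (rule H A)+

lemma tower_space_Suc: "Hn (Suc n) = stinespring_space H A (Hn n) (\<sigma> n \<circ> \<Phi>)"
  and tower_rep_Suc: "\<sigma> (Suc n) = stinespring_rep H A (Hn n) (\<sigma> n \<circ> \<Phi>)"
  by (simp_all add: tower_space_def tower_rep_def Let_def)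

lemma dilatable_tower: "dilatable_rep H A (Hn n) (\<sigma> n)"
proof (induction n)
  case 0
  have "inj (Base :: 'h \<Rightarrow> ('h op, 'h) tower)" by (simp add: inj_def)
  thus ?case by (simp add: tower_space_def tower_rep_def dilatable_rep_transport[OF H A])
next
  case (Suc n)
  interpret s: stinespring H A "Hn n" "\<sigma> n \<circ> \<Phi>" by (rule stinespring_step[OF Suc])
  show ?case unfolding tower_space_Suc tower_rep_Suc dilatable_rep_def
    using s.G(1) s.rep_star_hom s.rep_id s.rep_completely_positive s.rep_contractive by blast
qed

sublocale hilbert_family Hn
  by (rule hilbert_family.intro) (use dilatable_tower in \<open>simp add: dilatable_rep_def\<close>)

sublocale s: stinespring H A "Hn n" "\<sigma> n \<circ> \<Phi>" for n
  by (rule stinespring_step[OF dilatable_tower])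

lemma \<sigma>_star_hom: "star_hom H A (Hn n) (bounded_ops (Hn n) (Hn n)) (\<sigma> n)"
  and \<sigma>_id: "\<sigma> n (op_id H) = op_id (Hn n)"
  and \<sigma>_bound: "\<lbrakk>a \<in> A; B \<ge> 0; \<And>x. x \<in> pts H \<Longrightarrow> hnorm H (a x) \<le> B * hnorm H x; y \<in> pts (Hn n)\<rbrakk>
      \<Longrightarrow> hnorm (Hn n) (\<sigma> n a y) \<le> B * hnorm (Hn n) y"
  using dilatable_tower[of n] unfolding dilatable_rep_def by blast+

lemma Vn_isometry: "isometry (Hn n) (Hn (Suc n)) (Vn n)"
  using s.W_isometry unfolding tower_isometry_def tower_space_Suc .

lemma Vn_compression:
  "\<lbrakk>a \<in> A; x \<in> pts (Hn n); y \<in> pts (Hn n)\<rbrakk> \<Longrightarrow>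
    ip (Hn (Suc n)) (Vn n x) (\<sigma> (Suc n) a (Vn n y)) = ip (Hn n) x (\<sigma> n (\<Phi> a) y)"
  using s.compression unfolding tower_isometry_def tower_space_Suc tower_rep_Suc by simp

abbreviation "Hi \<equiv> space_inf H A \<Phi>"
abbreviation "\<pi> \<equiv> rep_inf H A \<Phi>"
abbreviation "V \<equiv> isometry_inf H A \<Phi>"

lemma Hi: "Hi = D"
  by (simp add: space_inf_def)

lemma hilbert_Hi: "hilbert_space Hi"
  unfolding Hi by (rule hilbert_space_D)

sublocale Hi: hilbert_space Hi by (rule hilbert_Hi)

lemmas ips [simp] = H.inner_product_space_axioms Hi.inner_product_space_axioms H hilbert_Hi
lemmas A_in = unital_cstar_algebraD(1)[OF A]
lemmas A_closed = unital_cstar_algebraD(2-6)[OF A]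

lemma \<Phi>_in: "a \<in> A \<Longrightarrow> \<Phi> a \<in> A"
  using \<Phi>_A by auto

lemma \<sigma>_mem: "\<lbrakk>a \<in> A; x \<in> pts (Hn n)\<rbrakk> \<Longrightarrow> \<sigma> n a x \<in> pts (Hn n)"
  by (rule bounded_ops_mem[OF star_homD(1)[OF \<sigma>_star_hom]])

lemma \<pi>_apply: "f \<in> pts Hi \<Longrightarrow> \<pi> a f = (\<lambda>n. \<sigma> n a (f n))"
  by (simp add: rep_inf_def)

lemma Hi_mem: "f \<in> pts Hi \<Longrightarrow> f n \<in> pts (Hn n)"
  unfolding Hi by (rule D_mem)

lemma \<pi>_mem_bound:
  assumes a: "a \<in> A" and B: "B \<ge> 0" "\<And>x. x \<in> pts H \<Longrightarrow> hnorm H (a x) \<le> B * hnorm H x" and f: "f \<in> pts Hi"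
  shows "\<pi> a f \<in> pts Hi \<and> hnorm Hi (\<pi> a f) \<le> B * hnorm Hi f"
proof -
  have fD: "f \<in> pts D" using f by (simp add: Hi)
  have le: "(hnorm (Hn n) (\<sigma> n a (f n)))\<^sup>2 \<le> B\<^sup>2 * (hnorm (Hn n) (f n))\<^sup>2" for n
    using power_mono[OF \<sigma>_bound[OF a B Hi_mem[OF f]], of n 2] \<sigma>_mem[OF a Hi_mem[OF f]]
    by (simp add: power_mult_distrib)
  have in_D: "(\<lambda>n. \<sigma> n a (f n)) \<in> pts D"
    by (rule D_ptsI[OF _ summable_mult[OF D_summable[OF fD]] le]) (rule \<sigma>_mem[OF a Hi_mem[OF f]])
  have "(hnorm D (\<lambda>n. \<sigma> n a (f n)))\<^sup>2 \<le> B\<^sup>2 * (hnorm D f)\<^sup>2"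
    by (rule sums_le[OF _ D_hnorm_sums[OF in_D] sums_mult[OF D_hnorm_sums[OF fD]]]) (rule le)
  hence "(hnorm D (\<lambda>n. \<sigma> n a (f n)))\<^sup>2 \<le> (B * hnorm D f)\<^sup>2" by (simp only: power_mult_distrib)
  hence "hnorm D (\<lambda>n. \<sigma> n a (f n)) \<le> B * hnorm D f"
    by (rule power2_le_imp_le) (use B(1) fD in simp)
  thus ?thesis using in_D f by (simp add: \<pi>_apply Hi)
qed

lemma \<pi>_in:
  assumes a: "a \<in> A" shows "\<pi> a \<in> bounded_ops Hi Hi"
proof -
  obtain B where B: "B \<ge> 0" "\<And>x. x \<in> pts H \<Longrightarrow> hnorm H (a x) \<le> B * hnorm H x"
    using bounded_ops_bound[OF A_in[OF a] H.semi_inner_product_space_axioms] by metis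
  have mb: "\<pi> a f \<in> pts Hi \<and> hnorm Hi (\<pi> a f) \<le> B * hnorm Hi f" if "f \<in> pts Hi" for f
    by (rule \<pi>_mem_bound[OF a B(1) _ that]) (rule B(2))
  note s = star_homD(1)[OF \<sigma>_star_hom a]
  show ?thesis
  proof (rule bounded_opsI[where B=B])
    show "\<pi> a \<in> pts Hi \<rightarrow>\<^sub>E pts Hi"
    proof (rule PiE_I)
      show "\<pi> a f \<in> pts Hi" if "f \<in> pts Hi" for f by (rule conjunct1[OF mb[OF that]])
      show "\<pi> a f = undefined" if "f \<notin> pts Hi" for f unfolding rep_inf_def using that by simp
    qed
    show "\<pi> a (add Hi f g) = add Hi (\<pi> a f) (\<pi> a g)" if "f \<in> pts Hi" "g \<in> pts Hi" for f g
      unfolding \<pi>_apply[OF that(1)] \<pi>_apply[OF that(2)] \<pi>_apply[OF Hi.add_in[OF that]] unfolding Hi D_simps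
      by (rule ext) (rule bounded_ops_add[OF s Hi_mem[OF that(1)] Hi_mem[OF that(2)]])
    show "\<pi> a (scl Hi c f) = scl Hi c (\<pi> a f)" if "f \<in> pts Hi" for c f
      unfolding \<pi>_apply[OF that] \<pi>_apply[OF Hi.scl_in[OF that]] unfolding Hi D_simps
      by (rule ext) (rule bounded_ops_scl[OF s Hi_mem[OF that]])
  qed (rule conjunct2[OF mb])
qed

lemma \<pi>_mem: "\<lbrakk>a \<in> A; f \<in> pts Hi\<rbrakk> \<Longrightarrow> \<pi> a f \<in> pts Hi"
  by (rule bounded_ops_mem[OF \<pi>_in])

lemma Hi_ip_sums: "\<lbrakk>f \<in> pts Hi; g \<in> pts Hi\<rbrakk> \<Longrightarrow> (\<lambda>n. ip (Hn n) (f n) (g n)) sums ip Hi f g"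
  unfolding Hi by (rule D_ip_sums)

lemma \<pi>_star_hom: "star_hom H A Hi (bounded_ops Hi Hi) \<pi>"
proof -
  note h = star_homD[OF \<sigma>_star_hom]
  have add: "\<pi> (op_add H H a b) = op_add Hi Hi (\<pi> a) (\<pi> b)" if "a \<in> A" "b \<in> A" for a b
  proof (rule op_eqI[of _ Hi Hi])
    fix f assume f: "f \<in> pts Hi"
    have "\<sigma> n (op_add H H a b) (f n) = add (Hn n) (\<sigma> n a (f n)) (\<sigma> n b (f n))" for n
      unfolding h(2)[OF that] by (rule op_add_apply[OF Hi_mem[OF f]])
    thus "\<pi> (op_add H H a b) f = op_add Hi Hi (\<pi> a) (\<pi> b) f"
      using f by (simp add: \<pi>_apply) (simp add: Hi D_simps)
  qed (use that in \<open>simp_all add: \<pi>_in A_closed op_add_in\<close>)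
  have scl: "\<pi> (op_scl H H c a) = op_scl Hi Hi c (\<pi> a)" if "a \<in> A" for a c
  proof (rule op_eqI[of _ Hi Hi])
    fix f assume f: "f \<in> pts Hi"
    have "\<sigma> n (op_scl H H c a) (f n) = scl (Hn n) c (\<sigma> n a (f n))" for n
      unfolding h(3)[OF that] by (rule op_scl_apply[OF Hi_mem[OF f]])
    thus "\<pi> (op_scl H H c a) f = op_scl Hi Hi c (\<pi> a) f"
      using f by (simp add: \<pi>_apply) (simp add: Hi D_simps)
  qed (use that in \<open>simp_all add: \<pi>_in A_closed op_scl_in\<close>)
  have comp: "\<pi> (a \<circ>\<^bsub>H\<^esub> b) = (\<pi> a \<circ>\<^bsub>Hi\<^esub> \<pi> b)" if "a \<in> A" "b \<in> A" for a b
  proof (rule op_eqI[of _ Hi Hi])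
    show "\<pi> (a \<circ>\<^bsub>H\<^esub> b) f = (\<pi> a \<circ>\<^bsub>Hi\<^esub> \<pi> b) f" if f: "f \<in> pts Hi" for f
    proof -
      have "\<sigma> n (a \<circ>\<^bsub>H\<^esub> b) (f n) = \<sigma> n a (\<sigma> n b (f n))" for n
        unfolding h(4)[OF \<open>a \<in> A\<close> \<open>b \<in> A\<close>] by (rule op_comp_apply[OF Hi_mem[OF f]])
      thus ?thesis using f \<pi>_mem[OF \<open>b \<in> A\<close> f] by (simp add: \<pi>_apply)
    qed
  qed (use that in \<open>simp_all add: \<pi>_in A_closed op_comp_in[of _ Hi Hi]\<close>)
  have adj: "\<pi> (adj H H a) = adj Hi Hi (\<pi> a)" if a: "a \<in> A" for a
  proof (rule adj_eqI[symmetric])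
    have a': "adj H H a \<in> A" using a by (rule A_closed)
    thus "\<pi> (adj H H a) \<in> bounded_ops Hi Hi" by (rule \<pi>_in)
    show "ip Hi f (\<pi> (adj H H a) g) = ip Hi (\<pi> a f) g" if f: "f \<in> pts Hi" and g: "g \<in> pts Hi" for f g
    proof (rule sums_unique2[OF Hi_ip_sums[OF f \<pi>_mem[OF a' g]]])
      have "ip (Hn n) (f n) (\<pi> (adj H H a) g n) = ip (Hn n) (\<pi> a f n) (g n)" for n
        unfolding \<pi>_apply[OF f] \<pi>_apply[OF g] h(5)[OF a]
        by (rule ip_adj[OF family L.inner_product_space_axioms h(1)[OF a] Hi_mem[OF f] Hi_mem[OF g]])
      thus "(\<lambda>n. ip (Hn n) (f n) (\<pi> (adj H H a) g n)) sums ip Hi (\<pi> a f) g"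
        using Hi_ip_sums[OF \<pi>_mem[OF a f] g] by simp
    qed
  qed simp
  show ?thesis unfolding star_hom_def using \<pi>_in add scl comp adj by blast
qed

lemma \<pi>_id: "\<pi> (op_id H) = op_id Hi"
  by (rule op_eqI[of _ Hi Hi]) (auto simp: \<pi>_in A_closed \<pi>_apply \<sigma>_id Hi_mem)

text \<open>The embedding of \<open>\<H>\<close> as level \<open>0\<close>.  Compressing \<open>\<pi> a\<close> to it returns \<open>a\<close>.\<close>

definition bottom :: "'h \<Rightarrow> nat \<Rightarrow> ('h op, 'h) tower" where
  "bottom = restrict (\<lambda>x. single 0 (Base x)) (pts H)"

lemma Base_simps:
  "x \<in> pts H \<Longrightarrow> Base x \<in> pts (Hn 0)" "ip (Hn 0) (Base x) (Base y) = ip H x y"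
  "add (Hn 0) (Base x) (Base y) = Base (add H x y)" "scl (Hn 0) c (Base x) = Base (scl H c x)"
  "x \<in> pts H \<Longrightarrow> \<sigma> 0 a (Base x) = Base (a x)"
proof -
  have i: "inj (Base :: 'h \<Rightarrow> ('h op, 'h) tower)" by (simp add: inj_def)
  have h: "Hn 0 = transport Base H" "\<sigma> 0 = transport_op Base H" by (simp_all add: tower_space_def tower_rep_def)
  show "x \<in> pts H \<Longrightarrow> Base x \<in> pts (Hn 0)" "ip (Hn 0) (Base x) (Base y) = ip H x y"
    "add (Hn 0) (Base x) (Base y) = Base (add H x y)" "scl (Hn 0) c (Base x) = Base (scl H c x)"
    "x \<in> pts H \<Longrightarrow> \<sigma> 0 a (Base x) = Base (a x)"
    unfolding h by (simp_all add: transport_simps[OF i] transport_op_def inv_f_f[OF i])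
qed

lemma bottom_mem: "x \<in> pts H \<Longrightarrow> bottom x \<in> pts Hi"
  by (simp add: bottom_def Hi single_in Base_simps)

lemma bottom_ip: "\<lbrakk>x \<in> pts H; f \<in> pts Hi\<rbrakk> \<Longrightarrow> ip Hi (bottom x) f = ip (Hn 0) (Base x) (f 0)"
  by (simp add: bottom_def Hi ip_single Base_simps)

lemma bottom_0: "x \<in> pts H \<Longrightarrow> bottom x 0 = Base x"
  by (simp add: bottom_def single_def)

lemma bottom_in: "bottom \<in> bounded_ops H Hi"
proof (rule bounded_opsI[where B=1])
  show "bottom \<in> pts H \<rightarrow>\<^sub>E pts Hi" using bottom_mem by (auto simp: bottom_def)
  show "bottom (add H x y) = add Hi (bottom x) (bottom y)" if "x \<in> pts H" "y \<in> pts H" for x y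
    using that by (simp add: bottom_def Hi D_simps single_def H.in_simps fun_eq_iff L.add_zero_zero L.scl_zero Base_simps)
  show "bottom (scl H c x) = scl Hi c (bottom x)" if "x \<in> pts H" for x c
    using that by (simp add: bottom_def Hi D_simps single_def H.in_simps fun_eq_iff L.add_zero_zero L.scl_zero Base_simps)
  show "hnorm Hi (bottom x) \<le> 1 * hnorm H x" if "x \<in> pts H" for x
    using that by (simp add: hnorm_def bottom_ip bottom_mem bottom_0 Base_simps)
qed

lemma bottom_compression:
  assumes "a \<in> A" "x \<in> pts H" "y \<in> pts H" shows "ip Hi (bottom x) (\<pi> a (bottom y)) = ip H x (a y)"
proof -
  have "ip Hi (bottom x) (\<pi> a (bottom y)) = ip (Hn 0) (Base x) (\<pi> a (bottom y) 0)"
    by (rule bottom_ip[OF assms(2) \<pi>_mem[OF assms(1) bottom_mem[OF assms(3)]]])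
  thus ?thesis using assms(3) by (simp add: \<pi>_apply bottom_mem bottom_0 Base_simps)
qed

lemma adj_bottom_\<pi>:
  assumes "a \<in> A" "y \<in> pts H" shows "adj H Hi bottom (\<pi> a (bottom y)) = a y"
proof (rule H.vec_eqI)
  show "adj H Hi bottom (\<pi> a (bottom y)) \<in> pts H"
    using assms bottom_in by (intro bounded_ops_mem[OF adj_in[of H Hi]]) (auto simp: \<pi>_mem bottom_mem)
  show "ip H z (adj H Hi bottom (\<pi> a (bottom y))) = ip H z (a y)" if "z \<in> pts H" for z
    using assms that bottom_in by (simp add: ip_adj \<pi>_mem bottom_mem bottom_compression)
qed (rule bounded_ops_mem[OF A_in[OF assms(1)] assms(2)])

lemma \<pi>_inj: "inj_on \<pi> A"
proof
  fix a b assume ab: "a \<in> A" "b \<in> A" and eq: "\<pi> a = \<pi> b"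
  show "a = b"
  proof (rule op_eqI[OF A_in[OF ab(1)] A_in[OF ab(2)]])
    show "a x = b x" if "x \<in> pts H" for x
      using adj_bottom_\<pi>[OF ab(1) that] adj_bottom_\<pi>[OF ab(2) that] eq by simp
  qed
qed

lemma \<pi>_faithful: "faithful_representation H A Hi \<pi>"
  unfolding faithful_representation_def using \<pi>_star_hom \<pi>_id \<pi>_inj by blast

lemma \<pi>_diff:
  assumes "a \<in> A" "b \<in> A" "f \<in> pts Hi"
  shows "\<pi> (op_add H H a (op_scl H H (-1) b)) f = diff Hi (\<pi> a f) (\<pi> b f)"
  using assms star_homD(2,3)[OF \<pi>_star_hom] by (simp add: A_closed diff_def)

text \<open>The range is norm closed: a limit \<open>T\<close> of operators \<open>\<pi> b\<close> has a compression \<open>a\<close> to the bottom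
  level, which is the limit of the operators \<open>b\<close>, so that \<open>a \<in> A\<close> and \<open>T = \<pi> a\<close> by contractivity.\<close>

lemma \<pi>_algebra: "unital_cstar_algebra Hi (\<pi> ` A)"
proof (rule unital_cstar_algebraI)
  note h = star_homD[OF \<pi>_star_hom]
  show sub: "\<pi> ` A \<subseteq> bounded_ops Hi Hi" using \<pi>_in by blast
  show "op_id Hi \<in> \<pi> ` A" using \<pi>_id A_closed(1) by (metis imageI)
  show "op_add Hi Hi S T \<in> \<pi> ` A" if "S \<in> \<pi> ` A" "T \<in> \<pi> ` A" for S T
    using that by (auto simp flip: h(2) intro!: imageI A_closed)
  show "op_scl Hi Hi c T \<in> \<pi> ` A" if "T \<in> \<pi> ` A" for T c
    using that by (auto simp flip: h(3) intro!: imageI A_closed)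
  show "(S \<circ>\<^bsub>Hi\<^esub> T) \<in> \<pi> ` A" if "S \<in> \<pi> ` A" "T \<in> \<pi> ` A" for S T
    using that by (auto simp flip: h(4) intro!: imageI A_closed)
  show "adj Hi Hi T \<in> \<pi> ` A" if "T \<in> \<pi> ` A" for T
    using that by (auto simp flip: h(5) intro!: imageI A_closed)
  show "T \<in> \<pi> ` A" if T: "T \<in> bounded_ops Hi Hi" and lim: "norm_limit Hi Hi (\<pi> ` A) T" for T
  proof -
    let ?J = "adj H Hi bottom"
    have J: "?J \<in> bounded_ops Hi H" using bottom_in by (intro adj_in) auto
    define a where "a = (?J \<circ>\<^bsub>H\<^esub> (T \<circ>\<^bsub>H\<^esub> bottom))"
    have a: "a \<in> bounded_ops H H"
      unfolding a_def using T J bottom_in by (intro op_comp_in[of _ H Hi]) auto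
    have bottom_norm: "hnorm Hi (bottom x) = hnorm H x" if "x \<in> pts H" for x
      using that by (simp add: hnorm_def bottom_ip bottom_mem bottom_0 Base_simps)
    have bottom_le: "hnorm Hi (bottom x) \<le> 1 * hnorm H x" if "x \<in> pts H" for x
      unfolding bottom_norm[OF that] by simp
    have adj_bottom_le: "hnorm H (?J f) \<le> 1 * hnorm Hi f" if f: "f \<in> pts Hi" for f
      using H ips(2) bottom_in zero_le_one bottom_le f by (rule adj_bound)
    have close: "hnorm H (diff H (a x) (b x)) \<le> e * hnorm H x"
      if b: "b \<in> A" and le: "\<And>f. f \<in> pts Hi \<Longrightarrow> hnorm Hi (diff Hi (T f) (\<pi> b f)) \<le> e * hnorm Hi f" and x: "x \<in> pts H"
      for b e x
    proof -
      note m = bounded_ops_mem[OF T bottom_mem[OF x]] \<pi>_mem[OF b bottom_mem[OF x]]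
      have "a x = ?J (T (bottom x))" using x by (simp add: a_def)
      hence eq: "diff H (a x) (b x) = ?J (diff Hi (T (bottom x)) (\<pi> b (bottom x)))"
        unfolding bounded_ops_diff[OF J ips(2) m] adj_bottom_\<pi>[OF b x] by (rule arg_cong)
      have "hnorm H (diff H (a x) (b x)) \<le> 1 * hnorm Hi (diff Hi (T (bottom x)) (\<pi> b (bottom x)))"
        unfolding eq by (rule adj_bottom_le[OF Hi.diff_in[OF m]])
      also have "\<dots> \<le> e * hnorm Hi (bottom x)" unfolding mult_1 by (rule le[OF bottom_mem[OF x]])
      also have "\<dots> = e * hnorm H x" by (simp only: bottom_norm[OF x])
      finally show ?thesis .
    qed
    have "norm_limit H H A a"
      unfolding norm_limit_def
    proof (intro allI impI)
      fix e :: real assume "e > 0"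
      then obtain b where "b \<in> A" "\<forall>f\<in>pts Hi. hnorm Hi (diff Hi (T f) (\<pi> b f)) \<le> e * hnorm Hi f"
        using lim unfolding norm_limit_def by blast
      thus "\<exists>b\<in>A. \<forall>x\<in>pts H. hnorm H (diff H (a x) (b x)) \<le> e * hnorm H x" using close by blast
    qed
    hence aA: "a \<in> A" using a by (intro unital_cstar_algebraD(7)[OF A]) auto
    have "T = \<pi> a"
    proof (rule op_eqI[OF T \<pi>_in[OF aA]])
      fix f assume f: "f \<in> pts Hi"
      note Tf = bounded_ops_mem[OF T f] and af = \<pi>_mem[OF aA f]
      have "hnorm Hi (diff Hi (T f) (\<pi> a f)) \<le> 0"
      proof (rule field_le_epsilon)
        fix \<delta> :: real assume d: "\<delta> > 0"
        define e where "e = \<delta> / (2 * (hnorm Hi f + 1))"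
        have pos: "hnorm Hi f + 1 > 0" using f by (simp add: add_nonneg_pos)
        have e: "e > 0" using d pos by (simp add: e_def)
        then obtain b where b: "b \<in> A" and le': "\<forall>f\<in>pts Hi. hnorm Hi (diff Hi (T f) (\<pi> b f)) \<le> e * hnorm Hi f"
          using lim unfolding norm_limit_def by blast
        note le = bspec[OF le']
        note bf = \<pi>_mem[OF b f]
        let ?d = "op_add H H a (op_scl H H (-1) b)"
        have dA: "?d \<in> A" using aA b by (intro A_closed)
        have db: "hnorm H (?d x) \<le> e * hnorm H x" if "x \<in> pts H" for x
          using close[OF b le that] that by (simp add: diff_def)
        have "hnorm Hi (\<pi> ?d f) \<le> e * hnorm Hi f"
          by (rule conjunct2[OF \<pi>_mem_bound[OF dA less_imp_le[OF e] _ f]]) (rule db)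
        hence "hnorm Hi (diff Hi (\<pi> b f) (\<pi> a f)) \<le> e * hnorm Hi f"
          using \<pi>_diff[OF aA b f] Hi.hnorm_diff_commute[OF af bf] by simp
        hence "hnorm Hi (diff Hi (T f) (\<pi> a f)) \<le> e * hnorm Hi f + e * hnorm Hi f"
          using Hi.hnorm_diff_triangle[OF Tf bf af] le[OF f] by linarith
        also have "\<dots> \<le> 2 * e * (hnorm Hi f + 1)" using e by (simp add: algebra_simps)
        also have "\<dots> = \<delta>" using pos by (simp add: e_def field_simps)
        finally show "hnorm Hi (diff Hi (T f) (\<pi> a f)) \<le> 0 + \<delta>" by simp
      qed
      thus "T f = \<pi> a f" using Hi.hnorm_diff_eq_0[OF Tf af] Hi.hnorm_ge_0[OF Hi.diff_in[OF Tf af]] by linarith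
    qed
    thus ?thesis using aA by blast
  qed
qed simp

lemma V_apply: "f \<in> pts Hi \<Longrightarrow> V f = (\<lambda>n. case n of 0 \<Rightarrow> zero (Hn 0) | Suc m \<Rightarrow> Vn m (f m))"
  by (simp add: isometry_inf_def)

lemma Vn_in: "Vn n \<in> bounded_ops (Hn n) (Hn (Suc n))"
  using Vn_isometry by (simp add: isometry_def)

lemma Vn_mem: "x \<in> pts (Hn n) \<Longrightarrow> Vn n x \<in> pts (Hn (Suc n))"
  by (rule bounded_ops_mem[OF Vn_in])

lemma V_mem:
  assumes f: "f \<in> pts Hi" shows "V f \<in> pts Hi"
proof -
  have fD: "f \<in> pts D" using f by (simp add: Hi)
  have "V f n \<in> pts (Hn n)" for n
    using f by (cases n) (auto simp: V_apply L.in_simps Vn_mem Hi_mem)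
  moreover have "(hnorm (Hn (Suc n)) (V f (Suc n)))\<^sup>2 = (hnorm (Hn n) (f n))\<^sup>2" for n
    using f Vn_isometry[of n] by (simp add: V_apply isometry_def Hi_mem)
  hence "summable (\<lambda>n. (hnorm (Hn (Suc n)) (V f (Suc n)))\<^sup>2)" using D_summable[OF fD] by simp
  hence "summable (\<lambda>n. (hnorm (Hn n) (V f n))\<^sup>2)"
    using summable_Suc_iff[of "\<lambda>n. (hnorm (Hn n) (V f n))\<^sup>2"] by simp
  ultimately show ?thesis by (simp add: Hi D_pts)
qed

text \<open>Both the isometry property (for \<open>a = 1\<close>) and the covariance of \<open>V\<close> reduce to the compression
  formula of the single levels, since \<open>V\<close> shifts the levels by one.\<close>

lemma V_compression:
  assumes a: "a \<in> A" and f: "f \<in> pts Hi" and g: "g \<in> pts Hi"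
  shows "ip Hi (V f) (\<pi> a (V g)) = ip Hi f (\<pi> (\<Phi> a) g)"
proof (rule sums_unique2[OF Hi_ip_sums[OF V_mem[OF f] \<pi>_mem[OF a V_mem[OF g]]]])
  let ?F = "\<lambda>n. ip (Hn n) (V f n) (\<pi> a (V g) n)"
  have "?F (Suc n) = ip (Hn n) (f n) (\<pi> (\<Phi> a) g n)" for n
    using a f g by (simp add: \<pi>_apply V_mem \<Phi>_in) (simp add: V_apply Vn_compression Hi_mem)
  hence "(\<lambda>n. ?F (Suc n)) sums ip Hi f (\<pi> (\<Phi> a) g)"
    using Hi_ip_sums[OF f \<pi>_mem[OF \<Phi>_in[OF a] g]] by simp
  moreover have "?F 0 = 0"
    using f a Hi_mem[OF \<pi>_mem[OF a V_mem[OF g]], of 0] by (simp add: V_apply[OF f] L.ip_zero_left)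
  ultimately show "?F sums ip Hi f (\<pi> (\<Phi> a) g)" using sums_Suc[of ?F] by fastforce
qed

lemma V_isometry: "isometry Hi Hi V"
proof -
  have "ip Hi (V f) (V f) = ip Hi f f" if "f \<in> pts Hi" for f
    using V_compression[OF A_closed(1) that that] \<Phi>_unital that by (simp add: unital_def \<pi>_id V_mem)
  hence norm: "hnorm Hi (V f) = hnorm Hi f" if "f \<in> pts Hi" for f using that by (simp add: hnorm_def)
  have "V \<in> bounded_ops Hi Hi"
  proof (rule bounded_opsI[where B=1])
    show "V \<in> pts Hi \<rightarrow>\<^sub>E pts Hi" using V_mem by (auto simp: isometry_inf_def)
    show "V (add Hi f g) = add Hi (V f) (V g)" if "f \<in> pts Hi" "g \<in> pts Hi" for f g
      using that by (simp add: V_apply Hi.in_simps)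
        (simp add: Hi D_simps fun_eq_iff L.add_zero_zero L.scl_zero bounded_ops_add[OF Vn_in] D_mem split: nat.split)
    show "V (scl Hi c f) = scl Hi c (V f)" if "f \<in> pts Hi" for f c
      using that by (simp add: V_apply Hi.in_simps)
        (simp add: Hi D_simps fun_eq_iff L.add_zero_zero L.scl_zero bounded_ops_scl[OF Vn_in] D_mem split: nat.split)
  qed (simp add: norm)
  thus ?thesis using norm by (simp add: isometry_def)
qed

lemma V_covariant:
  assumes a: "a \<in> A" shows "(adj Hi Hi V \<circ>\<^bsub>Hi\<^esub> (\<pi> a \<circ>\<^bsub>Hi\<^esub> V)) = \<pi> (\<Phi> a)"
proof (rule op_eqI_ip[of Hi _ Hi])
  have V: "V \<in> bounded_ops Hi Hi" using V_isometry by (simp add: isometry_def)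
  show "(adj Hi Hi V \<circ>\<^bsub>Hi\<^esub> (\<pi> a \<circ>\<^bsub>Hi\<^esub> V)) \<in> bounded_ops Hi Hi"
    using V \<pi>_in[OF a] by (intro op_comp_in[of _ Hi Hi]) (auto intro: adj_in)
  show "\<pi> (\<Phi> a) \<in> bounded_ops Hi Hi" by (intro \<pi>_in \<Phi>_in a)
  show "ip Hi f ((adj Hi Hi V \<circ>\<^bsub>Hi\<^esub> (\<pi> a \<circ>\<^bsub>Hi\<^esub> V)) g) = ip Hi f (\<pi> (\<Phi> a) g)"
    if "g \<in> pts Hi" "f \<in> pts Hi" for f g
    using that V a by (simp add: ip_adj \<pi>_mem V_mem V_compression)
qed simp

end

section \<open>The dilation of a completely positive map\<close>

theorem mainTheorem4:
  fixes H :: "'h hspace" and A :: "'h op set" and \<Phi> :: "'h op \<Rightarrow> 'h op"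
    and Hi :: "(nat \<Rightarrow> ('h op, 'h) tower) hspace"
    and \<pi> :: "'h op \<Rightarrow> (nat \<Rightarrow> ('h op, 'h) tower) op"
    and V :: "(nat \<Rightarrow> ('h op, 'h) tower) op"
    and Hh :: "'k hspace" and Vh :: "'k op" and Z :: "(nat \<Rightarrow> ('h op, 'h) tower) \<Rightarrow> 'k"
  assumes "hilbert_space H"
    and "unital_cstar_algebra H A"
    and "\<Phi> \<in> A \<rightarrow> A" and "completely_positive H A H \<Phi>" and "unital H H \<Phi>"
    and "Hi = space_inf H A \<Phi>" and "\<pi> = rep_inf H A \<Phi>" and "V = isometry_inf H A \<Phi>"
    and "minimal_unitary_dilation Hi V Vh Hh Z"
  shows "(hilbert_space Hi \<and> faithful_representation H A Hi \<pi> \<and> isometry Hi Hi V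
        \<and> (\<forall>a\<in>A. (adj Hi Hi V \<circ>\<^bsub>Hi\<^esub> (\<pi> a \<circ>\<^bsub>Hi\<^esub> V)) = \<pi> (\<Phi> a)))
    \<and> (\<exists>Ah. unital_cstar_algebra Hh Ah
        \<and> (\<lambda>a. Z \<circ>\<^bsub>Hh\<^esub> (\<pi> a \<circ>\<^bsub>Hh\<^esub> adj Hi Hh Z)) ` A \<subseteq> Ah
        \<and> (\<lambda>X. adj Hi Hh Z \<circ>\<^bsub>Hi\<^esub> (X \<circ>\<^bsub>Hi\<^esub> Z)) ` Ah = \<pi> ` A
        \<and> (\<forall>X\<in>Ah. (adj Hi Hh Z \<circ>\<^bsub>Hi\<^esub> (adj Hh Hh Vh \<circ>\<^bsub>Hi\<^esub> (X \<circ>\<^bsub>Hi\<^esub> (Vh \<circ>\<^bsub>Hi\<^esub> Z))))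
              = (adj Hi Hi V \<circ>\<^bsub>Hi\<^esub> (adj Hi Hh Z \<circ>\<^bsub>Hi\<^esub> (X \<circ>\<^bsub>Hi\<^esub> (Z \<circ>\<^bsub>Hi\<^esub> V)))))
        \<and> (let \<Phi>h = (\<lambda>X. adj Hh Hh Vh \<circ>\<^bsub>Hh\<^esub> (X \<circ>\<^bsub>Hh\<^esub> Vh)) in
             star_hom Hh Ah Hh Ah \<Phi>h
             \<and> (\<forall>a\<in>A. \<forall>X\<in>Ah. \<forall>n.
                  \<pi> ((\<Phi> ^^ n) a)
                    = (adj Hi Hh Z \<circ>\<^bsub>Hi\<^esub>
                        ((\<Phi>h ^^ n) (Z \<circ>\<^bsub>Hh\<^esub> (\<pi> a \<circ>\<^bsub>Hh\<^esub> adj Hi Hh Z)) \<circ>\<^bsub>Hi\<^esub> Z))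
                  \<and> (adj Hi Hh Z \<circ>\<^bsub>Hi\<^esub> ((\<Phi>h ^^ n) X \<circ>\<^bsub>Hi\<^esub> Z))
                    = \<pi> ((\<Phi> ^^ n) (the_inv_into A \<pi> (adj Hi Hh Z \<circ>\<^bsub>Hi\<^esub> (X \<circ>\<^bsub>Hi\<^esub> Z)))))))"
proof -
  interpret t: cp_tower H A \<Phi>
    using assms(1-5) by (rule cp_tower.intro)
  note eqs = \<open>Hi = space_inf H A \<Phi>\<close> \<open>\<pi> = rep_inf H A \<Phi>\<close> \<open>V = isometry_inf H A \<Phi>\<close>
  have tower: "hilbert_space Hi" "faithful_representation H A Hi \<pi>" "isometry Hi Hi V"
    "unital_cstar_algebra Hi (\<pi> ` A)"
    "\<And>a. a \<in> A \<Longrightarrow> (adj Hi Hi V \<circ>\<^bsub>Hi\<^esub> (\<pi> a \<circ>\<^bsub>Hi\<^esub> V)) = \<pi> (\<Phi> a)"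
    unfolding eqs by (fact t.hilbert_Hi t.\<pi>_faithful t.V_isometry t.\<pi>_algebra t.V_covariant)+
  have \<pi>_inj: "inj_on \<pi> A" using tower(2) by (simp add: faithful_representation_def)
  have \<Phi>_pow: "(\<Phi> ^^ n) a \<in> A" if "a \<in> A" for a n
    using that \<open>\<Phi> \<in> A \<rightarrow> A\<close> by (induction n) auto
  have dil: "hilbert_space Hh" "isometry Hi Hh Z" "unitary Hh Vh"
    and pow: "\<And>n. (op_power Hh Vh n \<circ>\<^bsub>Hi\<^esub> Z) = (Z \<circ>\<^bsub>Hi\<^esub> op_power Hi V n)"
    using assms(9) unfolding minimal_unitary_dilation_def by blast+
  have intertwine: "Vh (Z x) = Z (V x)" if x: "x \<in> pts Hi" for x
  proof -
    have "Z x \<in> pts Hh" using bounded_ops_mem[of Z Hi Hh x] dil(2) x by (simp add: isometry_def)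
    thus ?thesis using fun_cong[OF pow[of 1], of x] x by simp
  qed
  interpret d: unitary_dilation Hi V Hh Vh Z "\<pi> ` A"
  proof (rule unitary_dilation.intro)
    show "(adj Hi Hi V \<circ>\<^bsub>Hi\<^esub> (r \<circ>\<^bsub>Hi\<^esub> V)) \<in> \<pi> ` A" if "r \<in> \<pi> ` A" for r
      using that tower(5) \<open>\<Phi> \<in> A \<rightarrow> A\<close> by auto
  qed (fact tower dil intertwine)+
  let ?Ah = "d.dilation_algebra" and ?C = "\<lambda>X. adj Hi Hh Z \<circ>\<^bsub>Hi\<^esub> (X \<circ>\<^bsub>Hi\<^esub> Z)"
  have corner: "(Z \<circ>\<^bsub>Hh\<^esub> (\<pi> a \<circ>\<^bsub>Hh\<^esub> adj Hi Hh Z)) \<in> ?Ah" "?C (Z \<circ>\<^bsub>Hh\<^esub> (\<pi> a \<circ>\<^bsub>Hh\<^esub> adj Hi Hh Z)) = \<pi> a"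
    if "a \<in> A" for a
    using d.corner_in_dilation_algebra[of "\<pi> a"] d.compression_corner[OF d.R_in, of "\<pi> a"] that by auto
  have image: "?C ` ?Ah = \<pi> ` A"
  proof
    show "?C ` ?Ah \<subseteq> \<pi> ` A" using d.compression_in_R by blast
    show "\<pi> ` A \<subseteq> ?C ` ?Ah" using corner by (metis (no_types, lifting) image_eqI image_subsetI)
  qed
  have endo: "d.endo = (\<lambda>X. adj Hh Hh Vh \<circ>\<^bsub>Hh\<^esub> (X \<circ>\<^bsub>Hh\<^esub> Vh))" by (simp add: d.endo_def fun_eq_iff)
  have iter: "?C ((d.endo ^^ n) X) = \<pi> ((\<Phi> ^^ n) (the_inv_into A \<pi> (?C X)))" if "X \<in> ?Ah" for n X
    using that
  proof (induction n arbitrary: X)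
    case 0
    thus ?case using f_the_inv_into_f[OF \<pi>_inj] d.compression_in_R by simp
  next
    case (Suc n)
    obtain a where a: "a \<in> A" "?C X = \<pi> a" using d.compression_in_R[OF Suc.prems] by blast
    have "?C (d.endo X) = \<pi> (\<Phi> a)"
      using d.compression_endo[OF d.dilation_algebraD[OF Suc.prems]] a tower(5) by simp
    moreover have "\<Phi> a \<in> A" using a \<Phi>_pow[of a 1] by simp
    ultimately have inv: "the_inv_into A \<pi> (?C (d.endo X)) = \<Phi> a" "the_inv_into A \<pi> (?C X) = a"
      using a the_inv_into_f_f[OF \<pi>_inj] by simp_all
    have "?C ((d.endo ^^ Suc n) X) = ?C ((d.endo ^^ n) (d.endo X))" by (simp add: funpow_swap1)
    also have "\<dots> = \<pi> ((\<Phi> ^^ n) (\<Phi> a))" using Suc.IH[OF d.endo_dilation_algebra[OF Suc.prems]] inv by simp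
    finally show ?case unfolding inv(2) by (simp add: funpow_swap1)
  qed
  have iter_corner: "\<pi> ((\<Phi> ^^ n) a) = ?C ((d.endo ^^ n) (Z \<circ>\<^bsub>Hh\<^esub> (\<pi> a \<circ>\<^bsub>Hh\<^esub> adj Hi Hh Z)))" if a: "a \<in> A" for a n
    using iter[OF corner(1)[OF a], of n] corner(2)[OF a] the_inv_into_f_f[OF \<pi>_inj a] by simp
  show ?thesis
    unfolding Let_def endo[symmetric]
    by (intro conjI exI[of _ ?Ah] ballI allI)
      (use tower d.unital_cstar_algebra_dilation_algebra corner(1) image d.star_hom_endo
           d.compression_intertwine[OF d.dilation_algebraD] iter iter_corner in blast)+
qed

end
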